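(* Let $q\in(1,2)$. Assume that $u_0\in\mathcal{C}_0(\mathbb{R}^N)$ is a non-positive function in $L^1(\mathbb{R}^N)\cap W^{1,\infty}(\mathbb{R}^N)$ with $u_0\not\equiv0$, let $u$ be the corresponding non-positive solution of $u_t-\Delta u+|\nabla u|^q=0$ in $\mathbb{R}^N\times(0,\infty)$, $u(\cdot,0)=u_0$, and assume that $$M_\infty:=\lim_{t\to\infty}\|u(t)\|_\infty>0.$$ Then $$\lim_{t\to\infty}\|u(t)-Z_{M_\infty}(t)\|_\infty=0,$$ where $Z_{M_\infty}$ is given by $$Z_{M_\infty}(x,t):=-\left(M_\infty-(q-1)\,q^{-q/(q-1)}\left(\frac{|x|}{t^{1/q}}\right)^{q/(q-1)}\right)^+$$ for $(x,t)\in\mathbb{R}^N\times(0,\infty)$. In fact, $Z_{M_\infty}$ is the unique viscosity solution in $\mathcal{BUC}(\mathbb{R}^N\times(0,\infty))$ to $$z_t+|\nabla z|^q=0\quad\text{in }\mathbb{R}^N\times(0,\infty)$$ with the bounded and lower semicontinuous initial datum $z(x,0)=0$ if $x\ne0$ and $z(0,0)=-M_\infty$.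
   Context: For $q>1$ and every $u_0\in W^{1,\infty}(\mathbb{R}^N)$, the Cauchy problem $u_t-\Delta u+|\nabla u|^q=0$ in $\mathbb{R}^N\times(0,\infty)$, $u(\cdot,0)=u_0$, has a unique global-in-time solution which is classical for positive times, that is, $u\in\mathcal{C}(\mathbb{R}^N\times[0,\infty))\cap\mathcal{C}^{2,1}(\mathbb{R}^N\times(0,\infty))$; it satisfies $\|u(t)\|_\infty\le\|u_0\|_\infty$ and $\|\nabla u(t)\|_\infty\le\|\nabla u_0\|_\infty$ for all $t>0$. "The solution" means this one. If $u_0\le0$ then $u\le0$. $\mathcal{C}_0(\mathbb{R}^N)$ is the set of continuous functions $v$ on $\mathbb{R}^N$ with $\lim_{R\to\infty}\sup_{|x|\ge R}|v(x)|=0$; $W^{1,\infty}(\mathbb{R}^N)$ is the Sobolev space of functions in $L^\infty(\mathbb{R}^N)$ whose first order generalized derivatives belong to $L^\infty(\mathbb{R}^N)$; $\mathcal{BUC}$ denotes the space of bounded and uniformly continuous functions; $r^+:=\max\{r,0\}$ for real $r$; $\|\cdot\|_\infty$ is the $L^\infty(\mathbb{R}^N)$-norm; $u(t)=u(\cdot,t)$ and $Z_{M_\infty}(t)=Z_{M_\infty}(\cdot,t)$.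
   Formalization: The class BUC(R^N×(0,∞)) is read as: bounded on R^N×(0,∞) and uniformly continuous on R^N×(τ,∞) for every τ>0, since Z itself is not uniformly continuous near (0,0); the initial datum is attained as the liminf of z(y,s) as (y,s)→(x,0). *)

theory Defs
  imports "HOL-Probability.Essential_Supremum"
begin

text \<open>
  Functions of \<open>(x,t)\<close> have type \<open>'a \<times> real \<Rightarrow> real\<close>, with \<open>'a\<close> a Euclidean space in the role
  of \<open>\<real>\<^sup>N\<close>; a function on a subset of space-time is a total function of which only the
  values on that subset matter.
\<close>

abbreviation space_time :: "('a::euclidean_space \<times> real) set" where
  "space_time \<equiv> UNIV \<times> {0<..}"


section \<open>Derivatives\<close>

definition partial :: "'a::euclidean_space \<Rightarrow> ('a \<Rightarrow> real) \<Rightarrow> 'a \<Rightarrow> real" where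
  "partial b f x = frechet_derivative f (at x) b"

definition grad :: "('a::euclidean_space \<Rightarrow> real) \<Rightarrow> 'a \<Rightarrow> 'a" where
  "grad f x = (\<Sum>b\<in>Basis. partial b f x *\<^sub>R b)"

definition laplacian :: "('a::euclidean_space \<Rightarrow> real) \<Rightarrow> 'a \<Rightarrow> real" where
  "laplacian f x = (\<Sum>b\<in>Basis. partial b (partial b f) x)"

definition dt :: "('a::euclidean_space \<times> real \<Rightarrow> real) \<Rightarrow> 'a \<times> real \<Rightarrow> real" where
  "dt u p = deriv (\<lambda>s. u (fst p, s)) (snd p)"

abbreviation at_time :: "('a \<times> real \<Rightarrow> real) \<Rightarrow> real \<Rightarrow> 'a \<Rightarrow> real" where
  "at_time u t \<equiv> (\<lambda>x. u (x, t))"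


section \<open>Function spaces\<close>

text \<open>Being an \<open>ereal\<close>, the norm is infinite for essentially unbounded functions.\<close>

definition Linf_norm :: "('a::euclidean_space \<Rightarrow> 'b::real_normed_vector) \<Rightarrow> ereal" where
  "Linf_norm f = esssup lborel (\<lambda>x. ereal (norm (f x)))"

definition in_Linf :: "('a::euclidean_space \<Rightarrow> 'b::real_normed_vector) \<Rightarrow> bool" where
  "in_Linf f \<longleftrightarrow> f \<in> borel_measurable lborel \<and> Linf_norm f < \<infinity>"

primrec Ck :: "nat \<Rightarrow> ('a::euclidean_space \<Rightarrow> real) \<Rightarrow> bool" where
  "Ck 0 f \<longleftrightarrow> continuous_on UNIV f"
| "Ck (Suc k) f \<longleftrightarrow> (\<forall>x. f differentiable (at x)) \<and> (\<forall>b\<in>Basis. Ck k (partial b f))"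

definition test_function :: "('a::euclidean_space \<Rightarrow> real) \<Rightarrow> bool" where
  "test_function \<phi> \<longleftrightarrow> (\<forall>k. Ck k \<phi>) \<and> compact (closure {x. \<phi> x \<noteq> 0})"

definition locally_integrable ::
    "('a::euclidean_space \<Rightarrow> 'b::{banach, second_countable_topology}) \<Rightarrow> bool" where
  "locally_integrable f \<longleftrightarrow> (\<forall>K. compact K \<longrightarrow> set_integrable lborel K f)"

definition has_weak_gradient :: "('a::euclidean_space \<Rightarrow> real) \<Rightarrow> ('a \<Rightarrow> 'a) \<Rightarrow> bool" where
  "has_weak_gradient f g \<longleftrightarrow> locally_integrable f \<and> locally_integrable g \<and>
     (\<forall>\<phi>. test_function \<phi> \<longrightarrow> (\<forall>b\<in>Basis.
        (LINT x|lborel. f x * partial b \<phi> x) = - (LINT x|lborel. (g x \<bullet> b) * \<phi> x)))"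

text \<open>A weak gradient is determined up to a null set only; its \<open>L\<^sup>\<infinity>\<close>-norm does not depend on
  the choice.\<close>

definition weak_gradient :: "('a::euclidean_space \<Rightarrow> real) \<Rightarrow> 'a \<Rightarrow> 'a" where
  "weak_gradient f = (SOME g. has_weak_gradient f g)"

definition in_W1inf :: "('a::euclidean_space \<Rightarrow> real) \<Rightarrow> bool" where
  "in_W1inf f \<longleftrightarrow> in_Linf f \<and> (\<exists>g. has_weak_gradient f g \<and> in_Linf g)"

definition in_C0 :: "('a::euclidean_space \<Rightarrow> real) \<Rightarrow> bool" where
  "in_C0 v \<longleftrightarrow> continuous_on UNIV v \<and>
     ((\<lambda>R. SUP x\<in>{x. R \<le> norm x}. ereal \<bar>v x\<bar>) \<longlongrightarrow> 0) at_top"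

definition C21 :: "('a::euclidean_space \<times> real \<Rightarrow> real) \<Rightarrow> bool" where
  "C21 u \<longleftrightarrow> continuous_on space_time u \<and>
     (\<forall>x. \<forall>t>0. (\<lambda>s. u (x, s)) differentiable (at t)) \<and>
     continuous_on space_time (dt u) \<and>
     (\<forall>x. \<forall>t>0. at_time u t differentiable (at x)) \<and>
     (\<forall>b\<in>Basis. continuous_on space_time (\<lambda>(x, t). partial b (at_time u t) x)) \<and>
     (\<forall>b\<in>Basis. \<forall>x. \<forall>t>0. partial b (at_time u t) differentiable (at x)) \<and>
     (\<forall>b\<in>Basis. \<forall>c\<in>Basis.
        continuous_on space_time (\<lambda>(x, t). partial c (partial b (at_time u t)) x))"


section \<open>The viscous Hamilton-Jacobi equation\<close>

definition classical_solution ::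
    "real \<Rightarrow> ('a::euclidean_space \<Rightarrow> real) \<Rightarrow> ('a \<times> real \<Rightarrow> real) \<Rightarrow> bool" where
  "classical_solution q u0 u \<longleftrightarrow>
     continuous_on (UNIV \<times> {0..}) u \<and> C21 u \<and>
     (\<forall>x. \<forall>t>0. dt u (x, t) - laplacian (at_time u t) x
                  + norm (grad (at_time u t) x) powr q = 0) \<and>
     (\<forall>x. u (x, 0) = u0 x)"

text \<open>
  For \<open>u0\<close> in \<open>W\<^sup>1\<^sup>,\<^sup>\<infinity>\<close> the Cauchy problem has exactly one global solution with the bounds
  below, and this is the one called ``the'' solution. Classical solutions without any growth
  restriction are not claimed to be unique, so the bounds belong to the definition.
\<close>

definition the_solution ::
    "real \<Rightarrow> ('a::euclidean_space \<Rightarrow> real) \<Rightarrow> ('a \<times> real \<Rightarrow> real) \<Rightarrow> bool" where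
  "the_solution q u0 u \<longleftrightarrow> classical_solution q u0 u \<and>
     (\<forall>t>0. Linf_norm (at_time u t) \<le> Linf_norm u0 \<and>
            Linf_norm (grad (at_time u t)) \<le> Linf_norm (weak_gradient u0))"


section \<open>Viscosity solutions of \<open>z\<^sub>t + H(\<nabla>z) = 0\<close>\<close>

definition C1_space_time :: "('a::euclidean_space \<times> real \<Rightarrow> real) \<Rightarrow> bool" where
  "C1_space_time \<phi> \<longleftrightarrow> (\<forall>p\<in>space_time. \<phi> differentiable (at p)) \<and>
     (\<forall>b\<in>Basis. continuous_on space_time (partial b \<phi>))"

definition viscosity_subsolution ::
    "('a::euclidean_space \<Rightarrow> real) \<Rightarrow> ('a \<times> real \<Rightarrow> real) \<Rightarrow> bool" where
  "viscosity_subsolution H z \<longleftrightarrow>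
     (\<forall>\<phi> x t. C1_space_time \<phi> \<and> t > 0 \<and>
        (\<forall>\<^sub>F p in nhds (x, t). z p - \<phi> p \<le> z (x, t) - \<phi> (x, t)) \<longrightarrow>
        dt \<phi> (x, t) + H (grad (at_time \<phi> t) x) \<le> 0)"

definition viscosity_supersolution ::
    "('a::euclidean_space \<Rightarrow> real) \<Rightarrow> ('a \<times> real \<Rightarrow> real) \<Rightarrow> bool" where
  "viscosity_supersolution H z \<longleftrightarrow>
     (\<forall>\<phi> x t. C1_space_time \<phi> \<and> t > 0 \<and>
        (\<forall>\<^sub>F p in nhds (x, t). z p - \<phi> p \<ge> z (x, t) - \<phi> (x, t)) \<longrightarrow>
        dt \<phi> (x, t) + H (grad (at_time \<phi> t) x) \<ge> 0)"

definition viscosity_solution ::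
    "('a::euclidean_space \<Rightarrow> real) \<Rightarrow> ('a \<times> real \<Rightarrow> real) \<Rightarrow> bool" where
  "viscosity_solution H z \<longleftrightarrow>
     continuous_on space_time z \<and> viscosity_subsolution H z \<and> viscosity_supersolution H z"

text \<open>
  A solution with discontinuous initial datum cannot be uniformly continuous up to \<open>t = 0\<close>,
  so uniform continuity is required away from \<open>t = 0\<close>. Boundedness is required on all of
  \<open>space_time\<close>.
\<close>

definition BUC_space_time :: "('a::euclidean_space \<times> real \<Rightarrow> real) \<Rightarrow> bool" where
  "BUC_space_time z \<longleftrightarrow> bounded (z ` space_time) \<and>
     (\<forall>\<tau>>0. uniformly_continuous_on (UNIV \<times> {\<tau><..}) z)"

definition lower_semicontinuous :: "('a::topological_space \<Rightarrow> real) \<Rightarrow> bool" where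
  "lower_semicontinuous f \<longleftrightarrow> (\<forall>x a. a < f x \<longrightarrow> (\<forall>\<^sub>F y in nhds x. a < f y))"

text \<open>
  A lower semicontinuous initial datum is attained in the usual sense for such data: it is the
  trace at \<open>t = 0\<close> of the lower semicontinuous envelope of the solution.
\<close>

definition attains_lsc_datum ::
    "('a::euclidean_space \<times> real \<Rightarrow> real) \<Rightarrow> ('a \<Rightarrow> real) \<Rightarrow> bool" where
  "attains_lsc_datum z z0 \<longleftrightarrow>
     (\<forall>x. Liminf (at (x, 0) within space_time) (\<lambda>p. ereal (z p)) = ereal (z0 x))"


section \<open>The asymptotic profile\<close>

definition Z_profile :: "real \<Rightarrow> real \<Rightarrow> 'a::euclidean_space \<times> real \<Rightarrow> real" where
  "Z_profile q M = (\<lambda>(x, t).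
     - max (M - (q - 1) * q powr (- q / (q - 1)) *
              (norm x / t powr (1 / q)) powr (q / (q - 1))) 0)"

definition Z_datum :: "real \<Rightarrow> 'a::euclidean_space \<Rightarrow> real" where
  "Z_datum M x = (if x = 0 then - M else 0)"

end

(* With alpha = 1/(q-1) and beta = q/(q-1), the Hopf-Lax kernel kappa |x|^beta t^-alpha of
   z_t + |grad z|^q = 0 gives Z_M = min(0, kernel - M).

   Convergence. Smoothed kernels, corrected by a small function of time, are explicit barriers for
   the viscous equation, because the Laplacian of the kernel on a bounded level set is
   O(t^(-2/q)), which is integrable at infinity since q < 2. From below, a soft minimum of 0 and
   kernel - M is a subsolution (the Hamiltonian is convex). From above, a comparison from time t0
   on is possible once u(t0) is close to -M on a large ball. Such a ball exists because
   u + M + eta is a nonnegative solution that is small somewhere at time t0 + 1, while positivity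
   of a nonnegative solution on a small ball spreads quantitatively within unit time; the
   equicontinuity of u(t) that this needs follows by comparing u with its translates.

   Uniqueness. A viscosity subsolution satisfies z(x,t) <= z(y,s) + kernel(x-y, t-s), and letting
   (y,s) tend to the initial time along sequences that realise the lower semicontinuous envelope
   gives z <= Z_M. Conversely soft minima of 0 and kernel - M are smooth classical subsolutions up
   to time 0, so a supersolution attaining the datum lies above them. *)

theory Submission
  imports Defs
begin

section \<open>The Hopf--Lax kernel\<close>

text \<open>At a large time the minimum of u is only known to be nearly attained at some point, and
  diffusion can fill a narrow dip. An upper barrier started at time t0 carries a total viscous error
  of order d^(-(2/q - 1)), where d is the age of the kernel at the start. A small error needs a
  large d; the kernel is then flat, so u has to be near -M on a correspondingly large ball. Hence
  the radius is fixed before t0. Centre and age of the kernel fade under the scaling |x| / t^(1/q).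
  The two bounds need different comparison arguments. Below u the Hamiltonian is convex, and a
  strict penalty that tends to -infinity may be mixed in. For -u it is concave, so the barrier has
  to be strict itself and nonpositive far away. Viscosity test functions are C^1 on the whole open
  half-space and touch on a two-sided neighbourhood in time; this dictates the smooth constructions
  in the uniqueness part.\<close>

lemma powr_convex_nonneg:
  fixes x y l p :: real
  assumes "0 \<le> x" "0 \<le> y" "0 \<le> l" "l \<le> 1" "1 \<le> p"
  shows "((1 - l) * x + l * y) powr p \<le> (1 - l) * x powr p + l * y powr p"
proof -
  \<comment> \<open>This is the inequality when one of the two points is 0: on [0, 1] the power p >=
    1 lies below the identity.\<close>
  have aux: "(k * z) powr p \<le> k * z powr p" if "0 \<le> k" "k \<le> 1" "0 \<le> z" for k z :: real
  proof -
    have "k powr p \<le> k powr 1"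
    proof (cases "k = 0")
      case False
      thus ?thesis using that assms powr_mono'[of 1 p k] by auto
    qed auto
    thus ?thesis using that by (simp add: powr_mult mult_right_mono)
  qed
  consider "x = 0" | "y = 0" | "x > 0" "y > 0" using assms by linarith
  thus ?thesis
  proof cases
    case 3
    thus ?thesis using convex_onD[OF powr_convex[OF assms(5)], of l x y] assms by simp
  qed (use aux[of l y] aux[of "1 - l" x] assms in auto)
qed

lemma norm_powr_convex:
  fixes v w :: "'a::euclidean_space"
  assumes "0 \<le> l" "l \<le> 1" "1 \<le> p"
  shows "norm ((1 - l) *\<^sub>R v + l *\<^sub>R w) powr p \<le> (1 - l) * norm v powr p + l * norm w powr p"
proof -
  have "norm ((1 - l) *\<^sub>R v + l *\<^sub>R w) \<le> (1 - l) * norm v + l * norm w"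
    using assms norm_triangle_ineq[of "(1 - l) *\<^sub>R v" "l *\<^sub>R w"] by simp
  hence "norm ((1 - l) *\<^sub>R v + l *\<^sub>R w) powr p \<le> ((1 - l) * norm v + l * norm w) powr p"
    using assms by (intro powr_mono2) auto
  also have "\<dots> \<le> (1 - l) * norm v powr p + l * norm w powr p"
    using assms by (intro powr_convex_nonneg) auto
  finally show ?thesis .
qed

locale hj_exponent =
  fixes q :: real
  assumes q_gt_1: "1 < q" and q_less_2: "q < 2"
begin

definition \<alpha> :: real where "\<alpha> = 1 / (q - 1)"
definition \<beta> :: real where "\<beta> = q / (q - 1)"
text \<open>The constant of Legendre duality: the supremum of s r - r^q over r >= 0 is \<kappa>
  s^\<beta>.\<close>

definition \<kappa> :: real where "\<kappa> = (q - 1) * q powr - \<beta>"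

lemma beta_eq: "\<beta> = \<alpha> + 1"
  using q_gt_1 by (simp add: \<alpha>_def \<beta>_def field_simps)

lemma alpha_q: "\<alpha> * q = \<beta>"
  by (simp add: \<alpha>_def \<beta>_def)

lemma alpha_gt_1: "1 < \<alpha>"
  using q_gt_1 q_less_2 by (simp add: \<alpha>_def)

lemma beta_gt_2: "2 < \<beta>"
  using alpha_gt_1 beta_eq by simp

lemma kappa_pos: "0 < \<kappa>"
  using q_gt_1 by (simp add: \<kappa>_def)

lemma alpha_kappa: "\<alpha> * \<kappa> = q powr - \<beta>"
  using q_gt_1 by (simp add: \<alpha>_def \<kappa>_def)

lemma kappa_beta: "\<kappa> * \<beta> = q powr - \<alpha>"
proof -
  have "\<kappa> * \<beta> = q * q powr - \<beta>"
    using q_gt_1 by (simp add: \<kappa>_def \<beta>_def)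
  also have "\<dots> = q powr (1 + - \<beta>)"
    using q_gt_1 by (subst powr_mult_base) auto
  finally show ?thesis by (simp add: beta_eq)
qed

text \<open>This identity makes the kernel an exact solution. The gradient of \<kappa> |x|^\<beta>
  t^(-\<alpha>) has norm \<kappa> \<beta> |x|^\<alpha> t^(-\<alpha>), whose q-th power has the
  coefficient on the left; the one on the right comes from the time derivative.\<close>

lemma kappa_beta_powr: "(\<kappa> * \<beta>) powr q = \<alpha> * \<kappa>"
  unfolding kappa_beta alpha_kappa powr_powr by (simp add: alpha_q)

section \<open>Legendre duality between |g|^q and \<kappa> |v|^\<beta>\<close>

lemma young_scalar:
  assumes "0 \<le> r" "0 \<le> s"
  shows "s * r \<le> \<kappa> * s powr \<beta> + r powr q"
proof -
  \<comment> \<open>Young's inequality carries the weights 1/q and 1/\<beta>; rescaling by q^(1/q)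
    turns (r k)^q / q into r^q.\<close>
  define k where "k = q powr (1 / q)"
  have k: "0 < k" using q_gt_1 by (simp add: k_def)
  have "(s / k) * (r * k) \<le> (s / k) powr \<beta> / \<beta> + (r * k) powr q / q"
    using assms k q_gt_1 beta_gt_2
    by (intro Youngs_inequality) (auto simp: \<beta>_def field_simps)
  moreover have "(r * k) powr q / q = r powr q"
    using q_gt_1 by (simp add: powr_mult k_def powr_powr)
  moreover have "(s / k) powr \<beta> / \<beta> = \<kappa> * s powr \<beta>"
  proof -
    have "(s / k) powr \<beta> = s powr \<beta> * (\<kappa> * \<beta>)"
      unfolding powr_divide kappa_beta k_def powr_powr
      using q_gt_1 by (simp add: alpha_q[symmetric] powr_minus divide_inverse
          mult.left_commute[of "inverse q"])
    thus ?thesis using beta_gt_2 by simp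
  qed
  moreover have "(s / k) * (r * k) = s * r" using k by simp
  ultimately show ?thesis by simp
qed

definition lagrangian :: "'a::euclidean_space \<Rightarrow> real" where
  "lagrangian v = \<kappa> * norm v powr \<beta>"

lemma lagrangian_young: "v \<bullet> g \<le> lagrangian v + norm g powr q"
proof -
  have "v \<bullet> g \<le> norm v * norm g" by (rule norm_cauchy_schwarz)
  also have "\<dots> \<le> lagrangian v + norm g powr q"
    unfolding lagrangian_def by (rule young_scalar) auto
  finally show ?thesis .
qed

lemma lagrangian_young_attained:
  obtains v :: "'a::euclidean_space" where "v \<bullet> g = lagrangian v + norm g powr q"
proof (cases "g = 0")
  case True
  show ?thesis by (rule that[of 0]) (simp add: True lagrangian_def)
next
  case False
  \<comment> \<open>Equality in Young's inequality holds at the gradient of |g|^q.\<close>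
  define v where "v = (q * norm g powr (q - 2)) *\<^sub>R g"
  have "v \<bullet> g = q * (norm g powr (q - 2) * norm g powr 2)"
    by (simp add: v_def dot_square_norm)
  also have "\<dots> = q * norm g powr q"
    by (simp only: flip: powr_add) simp
  finally have 1: "v \<bullet> g = q * norm g powr q" .
  have "norm v = q * (norm g powr (q - 2) * norm g powr 1)"
    using q_gt_1 by (simp add: v_def)
  also have "\<dots> = q * norm g powr (q - 1)"
    by (simp only: flip: powr_add) simp
  finally have "norm v powr \<beta> = q powr \<beta> * norm g powr ((q - 1) * \<beta>)"
    by (simp add: powr_mult powr_powr)
  moreover have "(q - 1) * \<beta> = q" using q_gt_1 by (simp add: \<beta>_def)
  ultimately have "lagrangian v = (q - 1) * (q powr - \<beta> * q powr \<beta>) * norm g powr q"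
    by (simp add: lagrangian_def \<kappa>_def)
  also have "\<dots> = (q - 1) * norm g powr q"
    using q_gt_1 by (simp flip: powr_add)
  finally have 2: "lagrangian v = (q - 1) * norm g powr q" .
  show ?thesis by (rule that[of v]) (simp add: 1 2 algebra_simps)
qed

section \<open>Dynamic programming for the kernel\<close>

definition kernel :: "'a::euclidean_space \<Rightarrow> real \<Rightarrow> real" where
  "kernel x t = \<kappa> * norm x powr \<beta> * t powr - \<alpha>"

lemma kernel_lagrangian: "0 < t \<Longrightarrow> kernel (t *\<^sub>R v) t = t * lagrangian v"
  using powr_add[of t \<beta> "- \<alpha>"]
  by (simp add: kernel_def lagrangian_def powr_mult beta_eq)

lemma kernel_nonneg: "0 \<le> kernel x t"
  using kappa_pos by (simp add: kernel_def)

lemma kernel_0 [simp]: "kernel 0 t = 0"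
  by (simp add: kernel_def)

lemma kernel_antimono: "0 < s \<Longrightarrow> s \<le> t \<Longrightarrow> kernel x t \<le> kernel x s"
  unfolding kernel_def using kappa_pos alpha_gt_1
  by (intro mult_left_mono powr_mono2') auto

lemma continuous_on_kernel [continuous_intros]:
  assumes "continuous_on S f" "continuous_on S g" "\<And>x. x \<in> S \<Longrightarrow> 0 < g x"
  shows "continuous_on S (\<lambda>x. kernel (f x) (g x))"
proof -
  have "\<forall>x\<in>S. g x \<noteq> 0" using assms(3) by force
  thus ?thesis
    unfolding kernel_def using beta_gt_2 assms(1,2)
    by (intro continuous_intros continuous_on_powr') auto
qed

text \<open>The dynamic programming inequality: \<open>kernel x t\<close> is the least cost of travelling from
  \<open>0\<close> to \<open>x\<close> in time \<open>t\<close>, and a path may be forced through \<open>y\<close> at time \<open>s\<close>.\<close>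

lemma kernel_triangle:
  fixes x y :: "'a::euclidean_space"
  assumes "0 < s" "s < t"
  shows "kernel x t \<le> kernel y s + kernel (x - y) (t - s)"
proof -
  \<comment> \<open>\<open>l\<close> is the share of the time spent on the second leg. The mean
    velocity x / t is the convex combination of the leg velocities v and w with weights 1 - l and l,
    so the claim is convexity of the Lagrangian.\<close>
  define l where "l = (t - s) / t"
  have l: "0 \<le> l" "l \<le> 1" "t * (1 - l) = s" "t * l = t - s"
    using assms by (auto simp: l_def field_simps)
  define v w where "v = (1 / s) *\<^sub>R y" and "w = (1 / (t - s)) *\<^sub>R (x - y)"
  have vw: "s *\<^sub>R v = y" "(t - s) *\<^sub>R w = x - y" using assms by (auto simp: v_def w_def)
  have "t *\<^sub>R ((1 - l) *\<^sub>R v + l *\<^sub>R w) = x"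
    using vw by (simp only: scaleR_add_right scaleR_scaleR l) simp
  hence "kernel x t = t * lagrangian ((1 - l) *\<^sub>R v + l *\<^sub>R w)"
    using kernel_lagrangian[of t "(1 - l) *\<^sub>R v + l *\<^sub>R w"] assms by simp
  also have "\<dots> \<le> t * ((1 - l) * lagrangian v + l * lagrangian w)"
  proof -
    have "\<kappa> * norm ((1 - l) *\<^sub>R v + l *\<^sub>R w) powr \<beta>
       \<le> \<kappa> * ((1 - l) * norm v powr \<beta> + l * norm w powr \<beta>)"
      using l kappa_pos beta_gt_2 by (intro mult_left_mono norm_powr_convex) auto
    thus ?thesis using assms by (intro mult_left_mono) (auto simp: lagrangian_def algebra_simps)
  qed
  also have "\<dots> = t * (1 - l) * lagrangian v + t * l * lagrangian w"
    by (simp add: algebra_simps)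
  also have "\<dots> = s * lagrangian v + (t - s) * lagrangian w"
    by (simp only: l)
  also have "\<dots> = kernel y s + kernel (x - y) (t - s)"
    using kernel_lagrangian[of s v] kernel_lagrangian[of "t - s" w] assms vw by simp
  finally show ?thesis .
qed

lemma Z_profile_kernel:
  assumes "0 < t"
  shows "Z_profile q m (x, t) = min 0 (kernel x t - m)"
proof -
  have "(norm x / t powr (1 / q)) powr \<beta> = norm x powr \<beta> * t powr - \<alpha>"
    unfolding powr_divide powr_powr using q_gt_1
    by (simp add: powr_minus divide_inverse alpha_q[symmetric] mult.left_commute[of "inverse q"])
  thus ?thesis
    by (simp add: Z_profile_def kernel_def \<kappa>_def \<beta>_def min_def max_def mult.assoc)
qed

end

section \<open>Classical comparison principles\<close>

text \<open>\<open>\<tau>\<close>, \<open>g\<close> and \<open>l\<close> stand for time derivative,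
  gradient and Laplacian, taken along coordinate lines through one point. These are the data that
  the maximum principle compares; they combine linearly, and explicit barriers obtain them from
  one-variable calculus.\<close>

definition has_jet ::
    "('a::euclidean_space \<times> real \<Rightarrow> real) \<Rightarrow> 'a \<Rightarrow> real \<Rightarrow> real \<Rightarrow> 'a \<Rightarrow> real \<Rightarrow> bool" where
  "has_jet f x t \<tau> g l \<longleftrightarrow> ((\<lambda>s. f (x, s)) has_real_derivative \<tau>) (at t) \<and>
     (\<exists>\<phi> m. (\<forall>b\<in>Basis.
         (\<forall>s. ((\<lambda>s. f (x + s *\<^sub>R b, t)) has_real_derivative \<phi> b s) (at s)) \<and>
         \<phi> b 0 = g \<bullet> b \<and> (\<phi> b has_real_derivative m b) (at 0)) \<and> l = (\<Sum>b\<in>Basis. m b))"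

lemma has_jet_lincomb:
  assumes "has_jet f x t \<tau> g l" "has_jet f' x t \<tau>' g' l'"
  shows "has_jet (\<lambda>p. c * f p + c' * f' p) x t
           (c * \<tau> + c' * \<tau>') (c *\<^sub>R g + c' *\<^sub>R g') (c * l + c' * l')"
proof -
  obtain \<phi> m where 1: "\<forall>b\<in>Basis.
         (\<forall>s. ((\<lambda>s. f (x + s *\<^sub>R b, t)) has_real_derivative \<phi> b s) (at s)) \<and>
         \<phi> b 0 = g \<bullet> b \<and> (\<phi> b has_real_derivative m b) (at 0)" "l = (\<Sum>b\<in>Basis. m b)"
    using assms(1) unfolding has_jet_def by blast
  obtain \<phi>' m' where 2: "\<forall>b\<in>Basis.
         (\<forall>s. ((\<lambda>s. f' (x + s *\<^sub>R b, t)) has_real_derivative \<phi>' b s) (at s)) \<and>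
         \<phi>' b 0 = g' \<bullet> b \<and> (\<phi>' b has_real_derivative m' b) (at 0)" "l' = (\<Sum>b\<in>Basis. m' b)"
    using assms(2) unfolding has_jet_def by blast
  have time: "((\<lambda>s. f (x, s)) has_real_derivative \<tau>) (at t)"
    "((\<lambda>s. f' (x, s)) has_real_derivative \<tau>') (at t)"
    using assms unfolding has_jet_def by blast+
  show ?thesis
    unfolding has_jet_def
  proof (intro conjI exI[of _ "\<lambda>b s. c * \<phi> b s + c' * \<phi>' b s"] exI[of _ "\<lambda>b. c * m b + c' * m' b"]
      ballI allI)
    fix b :: 'a and s :: real assume b: "b \<in> Basis"
    show "((\<lambda>s. c * f (x + s *\<^sub>R b, t) + c' * f' (x + s *\<^sub>R b, t)) has_real_derivative
        c * \<phi> b s + c' * \<phi>' b s) (at s)"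
      using b 1 2 by (intro DERIV_add DERIV_cmult) auto
    show "((\<lambda>s. c * \<phi> b s + c' * \<phi>' b s) has_real_derivative c * m b + c' * m' b) (at 0)"
      using b 1 2 by (intro DERIV_add DERIV_cmult) auto
    show "c * \<phi> b 0 + c' * \<phi>' b 0 = (c *\<^sub>R g + c' *\<^sub>R g') \<bullet> b"
      using b 1 2 by (simp add: inner_add_left)
  qed (use time 1(2) 2(2) in \<open>auto intro!: DERIV_add DERIV_cmult
         simp: sum.distrib sum_distrib_left\<close>)
qed

lemma has_jet_const: "has_jet (\<lambda>p. c) x t 0 0 0"
  unfolding has_jet_def by (auto intro!: exI[of _ "\<lambda>_ _. 0"] exI[of _ "\<lambda>_. 0"])

lemma DERIV_diff_const_iff:
  fixes f :: "real \<Rightarrow> real"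
  shows "((\<lambda>s. f s - c) has_real_derivative D) (at x) \<longleftrightarrow> (f has_real_derivative D) (at x)"
proof
  assume "((\<lambda>s. f s - c) has_real_derivative D) (at x)"
  from DERIV_add[OF this DERIV_const[of c]] show "(f has_real_derivative D) (at x)" by simp
qed (auto intro!: derivative_eq_intros)

lemma has_jet_translate:
  assumes "has_jet f (x + h) t \<tau> g l"
  shows "has_jet (\<lambda>(y, s). f (y + h, s) - c) x t \<tau> g l"
proof -
  have eq: "(\<lambda>s. f (x + s *\<^sub>R b + h, t) - c) = (\<lambda>s. f (x + h + s *\<^sub>R b, t) - c)" for b
    by (simp add: add_ac)
  show ?thesis
    using assms unfolding has_jet_def prod.case eq
    by (simp add: DERIV_diff_const_iff)
qed

lemma has_jet_uminus:
  assumes "has_jet f x t \<tau> g l"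
  shows "has_jet (\<lambda>p. - f p) x t (- \<tau>) (- g) (- l)"
  using has_jet_lincomb[OF assms has_jet_const[of 0], of "-1" 0] by simp

section \<open>Maximum principle for jets\<close>

lemma deriv2_local_max:
  fixes f f' :: "real \<Rightarrow> real"
  assumes f: "\<And>s. (f has_real_derivative f' s) (at s)"
    and f': "(f' has_real_derivative m) (at 0)"
    and max: "\<And>s. f s \<le> f 0"
  shows "f' 0 = 0" "m \<le> 0"
proof -
  show 0: "f' 0 = 0"
    using DERIV_local_max[OF f, of 1] max by auto
  show "m \<le> 0"
  proof (rule ccontr)
    assume "\<not> m \<le> 0"
    then obtain d where d: "d > 0" "\<And>h. 0 < h \<Longrightarrow> h < d \<Longrightarrow> f' 0 < f' (0 + h)"
      using DERIV_pos_inc_right[OF f'] by auto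
    have "f 0 < f (d / 2)"
    proof (rule DERIV_pos_imp_increasing_open[of 0 "d / 2" f])
      fix s assume "0 < s" "s < d / 2"
      thus "\<exists>y. DERIV f s :> y \<and> 0 < y"
        using f[of s] d(2)[of s] 0 by (intro exI[of _ "f' s"]) auto
    next
      show "continuous_on {0..d / 2} f"
        by (rule DERIV_continuous_on[OF has_field_derivative_at_within[OF f]])
    qed (use d in simp)
    thus False using max[of "d / 2"] by simp
  qed
qed

text \<open>The comparison in time is one-sided, with earlier times only, so \<tau> is nonnegative
  rather than zero. This admits a maximum at the final time of a slab.\<close>

lemma has_jet_max:
  assumes jet: "has_jet f x t \<tau> g l"
    and space: "\<And>y. f (y, t) \<le> f (x, t)"
    and time: "\<And>s. t0 < s \<Longrightarrow> s \<le> t \<Longrightarrow> f (x, s) \<le> f (x, t)" and "t0 < t"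
  shows "0 \<le> \<tau>" "g = 0" "l \<le> 0"
proof -
  obtain \<phi> m where 1: "\<And>b s. b \<in> Basis \<Longrightarrow>
      ((\<lambda>s. f (x + s *\<^sub>R b, t)) has_real_derivative \<phi> b s) (at s)"
    "\<And>b. b \<in> Basis \<Longrightarrow> \<phi> b 0 = g \<bullet> b"
    "\<And>b. b \<in> Basis \<Longrightarrow> (\<phi> b has_real_derivative m b) (at 0)" "l = (\<Sum>b\<in>Basis. m b)"
    using jet unfolding has_jet_def by blast
  show "0 \<le> \<tau>"
  proof (rule ccontr)
    assume "\<not> 0 \<le> \<tau>"
    then obtain d where d: "d > 0" "\<And>h. 0 < h \<Longrightarrow> h < d \<Longrightarrow> f (x, t) < f (x, t - h)"
      using DERIV_neg_dec_left[of "\<lambda>s. f (x, s)" \<tau> t] jet unfolding has_jet_def by auto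
    define h where "h = min (d / 2) ((t - t0) / 2)"
    have "0 < h" "h < d" "h < t - t0" using d \<open>t0 < t\<close> by (auto simp: h_def min_def field_simps)
    thus False using d(2)[of h] time[of "t - h"] by auto
  qed
  have "\<phi> b 0 = 0" "m b \<le> 0" if "b \<in> Basis" for b
    using deriv2_local_max[OF 1(1)[OF that] 1(3)[OF that]] space by auto
  thus "g = 0" "l \<le> 0"
    using 1(2,4) by (simp_all add: euclidean_eq_iff[of g 0] sum_nonpos)
qed

text \<open>At a positive maximum of W - u the gradients agree, so the terms in H cancel and the
  remaining inequality between time derivatives and Laplacians contradicts strictness. The
  hypothesis \<open>far\<close> supplies compactness. H is a parameter because both |g|^q and -|g|^q
  occur below.\<close>

lemma comparison_strict:
  fixes W u :: "'a::euclidean_space \<times> real \<Rightarrow> real"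
  assumes cont: "continuous_on (UNIV \<times> {t0..t1}) W" "continuous_on (UNIV \<times> {t0..t1}) u"
    and init: "\<And>x. W (x, t0) \<le> u (x, t0)"
    and far: "\<And>x t. R \<le> norm x \<Longrightarrow> t0 \<le> t \<Longrightarrow> t \<le> t1 \<Longrightarrow> W (x, t) \<le> u (x, t)"
    and u: "\<And>x t. t0 < t \<Longrightarrow> t \<le> t1 \<Longrightarrow> \<exists>\<tau> g l. has_jet u x t \<tau> g l \<and> 0 \<le> \<tau> - l + H g"
    and W: "\<And>x t. t0 < t \<Longrightarrow> t \<le> t1 \<Longrightarrow> u (x, t) < W (x, t) \<Longrightarrow>
               \<exists>\<tau> g l. has_jet W x t \<tau> g l \<and> \<tau> - l + H g < 0"
    and t: "t0 \<le> t" "t \<le> t1"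
  shows "W (x, t) \<le> u (x, t)"
proof (rule ccontr)
  assume "\<not> W (x, t) \<le> u (x, t)"
  define f where "f p = W p - u p" for p
  define K where "K = cball (0::'a) \<bar>R\<bar> \<times> {t0..t1}"
  have "norm x < R" using far[of x t] t \<open>\<not> _\<close> by force
  hence xt: "(x, t) \<in> K" "0 < f (x, t)" using t \<open>\<not> _\<close> by (auto simp: K_def f_def)
  have "compact K" unfolding K_def by (intro compact_Times) auto
  moreover have "continuous_on K f"
    unfolding f_def K_def by (intro continuous_on_diff continuous_on_subset[OF cont(1)]
      continuous_on_subset[OF cont(2)]) auto
  ultimately obtain p where p: "p \<in> K" "\<And>z. z \<in> K \<Longrightarrow> f z \<le> f p"
    using continuous_attains_sup[of K f] xt(1) by blast
  obtain y s where ys: "p = (y, s)" by (cases p)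
  have pos: "0 < f (y, s)" using p(2)[OF xt(1)] xt(2) ys by simp
  have s: "t0 < s" "s \<le> t1" "t0 \<le> s"
    using init[of y] pos p(1) ys by (auto simp: K_def f_def order_less_le)
  have max: "f (z, r) \<le> f (y, s)" if "t0 \<le> r" "r \<le> t1" for z r
  proof (cases "norm z \<le> \<bar>R\<bar>")
    case True
    thus ?thesis using p(2)[of "(z, r)"] that ys by (auto simp: K_def)
  next
    case False
    hence "R \<le> norm z" by linarith
    thus ?thesis using far[of z r] that pos by (simp add: f_def)
  qed
  obtain \<tau> g l where U: "has_jet u y s \<tau> g l" "0 \<le> \<tau> - l + H g" using u s by blast
  obtain \<tau>' g' l' where W': "has_jet W y s \<tau>' g' l'" "\<tau>' - l' + H g' < 0"
    using W[of s y] s pos by (auto simp: f_def)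
  have "has_jet (\<lambda>p. 1 * W p + (-1) * u p) y s (1 * \<tau>' + (-1) * \<tau>) (1 *\<^sub>R g' + (-1) *\<^sub>R g)
      (1 * l' + (-1) * l)"
    by (rule has_jet_lincomb[OF W'(1) U(1)])
  hence "has_jet f y s (\<tau>' - \<tau>) (g' - g) (l' - l)" by (simp add: f_def[abs_def])
  from has_jet_max[OF this, of t0] max s
  have "\<tau> \<le> \<tau>'" "g' = g" "l' \<le> l" by auto
  thus False using U(2) W'(2) by auto
qed

text \<open>Along a coordinate line the squared distance to a is the quadratic polynomial
  \<open>\<rho>\<close>, so the chain rule in one variable gives everything. The square as variable
  avoids the singularity of the norm at a.\<close>

lemma has_jet_radial:
  fixes a x :: "'a::euclidean_space" and F :: "real \<Rightarrow> real \<Rightarrow> real" and F' :: "real \<Rightarrow> real"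
  assumes F: "\<And>r. 0 \<le> r \<Longrightarrow> ((\<lambda>r. F r t) has_real_derivative F' r) (at r)"
    and F': "(F' has_real_derivative F'') (at ((norm (x - a))\<^sup>2))"
    and time: "((\<lambda>s. F ((norm (x - a))\<^sup>2) s) has_real_derivative \<tau>) (at t)"
  shows "has_jet (\<lambda>(y, s). F ((norm (y - a))\<^sup>2) s) x t \<tau> ((2 * F' ((norm (x - a))\<^sup>2)) *\<^sub>R (x - a))
     (4 * (norm (x - a))\<^sup>2 * F'' + 2 * real DIM('a) * F' ((norm (x - a))\<^sup>2))"
proof -
  define z where "z = x - a"
  define \<rho> where "\<rho> b s = (norm z)\<^sup>2 + 2 * s * (z \<bullet> b) + s\<^sup>2" for b :: 'a and s
  have norm_eq: "(norm (x + s *\<^sub>R b - a))\<^sup>2 = \<rho> b s" if "b \<in> Basis" for b s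
  proof -
    have eq: "x + s *\<^sub>R b - a = z + s *\<^sub>R b" by (simp add: z_def)
    show ?thesis unfolding eq using that
      unfolding \<rho>_def power2_norm_eq_inner
      by (simp add: inner_add_left inner_add_right inner_commute[of b z] power2_eq_square
          distrib_left)
  qed
  have nonneg: "0 \<le> \<rho> b s" if "b \<in> Basis" for b s
    using norm_eq[OF that, of s] by (metis zero_le_power2)
  have \<rho>0: "\<rho> b 0 = (norm z)\<^sup>2" for b by (simp add: \<rho>_def)
  have \<rho>': "(\<rho> b has_real_derivative (2 * (z \<bullet> b) + 2 * s)) (at s)" for b s
    unfolding \<rho>_def by (auto intro!: derivative_eq_intros)
  show ?thesis unfolding has_jet_def prod.case
  proof (intro conjI exI[of _ "\<lambda>b s. F' (\<rho> b s) * (2 * (z \<bullet> b) + 2 * s)"]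
      exI[of _ "\<lambda>b. F'' * (2 * (z \<bullet> b)) * (2 * (z \<bullet> b)) + F' ((norm z)\<^sup>2) * 2"] ballI allI)
    fix b :: 'a and s :: real assume b: "b \<in> Basis"
    show "((\<lambda>s. F ((norm (x + s *\<^sub>R b - a))\<^sup>2) t) has_real_derivative
        F' (\<rho> b s) * (2 * (z \<bullet> b) + 2 * s)) (at s)"
      unfolding norm_eq[OF b] by (rule DERIV_chain2[OF F[OF nonneg[OF b]] \<rho>'])
    show "F' (\<rho> b 0) * (2 * (z \<bullet> b) + 2 * 0) = (2 * F' ((norm (x - a))\<^sup>2)) *\<^sub>R (x - a) \<bullet> b"
      by (simp add: \<rho>0 z_def)
    have "((\<lambda>s. F' (\<rho> b s)) has_real_derivative F'' * (2 * (z \<bullet> b))) (at 0)"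
      using F' \<rho>'[of b 0] by (intro DERIV_chain2[of F' F'' "\<rho> b" 0]) (auto simp: \<rho>0 z_def)
    thus "((\<lambda>s. F' (\<rho> b s) * (2 * (z \<bullet> b) + 2 * s)) has_real_derivative
        F'' * (2 * (z \<bullet> b)) * (2 * (z \<bullet> b)) + F' ((norm z)\<^sup>2) * 2) (at 0)"
      by (auto intro!: derivative_eq_intros simp: \<rho>0)
  next
    have "(\<Sum>b\<in>(Basis::'a set). (z \<bullet> b) * (z \<bullet> b)) = (norm z)\<^sup>2"
      unfolding power2_norm_eq_inner by (rule euclidean_inner[symmetric])
    moreover have "(\<Sum>b\<in>(Basis::'a set). F'' * (2 * (z \<bullet> b)) * (2 * (z \<bullet> b)) + F' ((norm z)\<^sup>2) * 2)
       = (4 * F'') * (\<Sum>b\<in>(Basis::'a set). (z \<bullet> b) * (z \<bullet> b)) + 2 * real DIM('a) * F' ((norm z)\<^sup>2)"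
      unfolding sum_distrib_left by (simp add: sum.distrib algebra_simps)
    ultimately show "4 * (norm (x - a))\<^sup>2 * F'' + 2 * real DIM('a) * F' ((norm (x - a))\<^sup>2)
       = (\<Sum>b\<in>(Basis::'a set). F'' * (2 * (z \<bullet> b)) * (2 * (z \<bullet> b)) + F' ((norm z)\<^sup>2) * 2)"
      by (simp add: z_def)
  qed (use time in simp)
qed

lemma C21_has_jet:
  fixes u :: "'a::euclidean_space \<times> real \<Rightarrow> real"
  assumes "C21 u" "0 < t"
  shows "has_jet u x t (dt u (x, t)) (grad (at_time u t) x) (laplacian (at_time u t) x)"
proof -
  define f where "f = at_time u t"
  have diff: "(f has_derivative frechet_derivative f (at y)) (at y)" for y
    using assms frechet_derivative_works unfolding C21_def f_def by blast
  have diff2: "(partial b f has_derivative frechet_derivative (partial b f) (at y)) (at y)"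
    if "b \<in> Basis" for b y
    using assms that frechet_derivative_works unfolding C21_def f_def by blast
  have line: "((\<lambda>s. h (x + s *\<^sub>R b)) has_real_derivative h' b) (at s)"
    if "(h has_derivative h') (at (x + s *\<^sub>R b))" for h h' b s
  proof -
    have "((\<lambda>s. x + s *\<^sub>R b) has_derivative (\<lambda>k. k *\<^sub>R b)) (at s)"
      by (auto intro!: derivative_eq_intros)
    from diff_chain_at[OF this that]
    have "((\<lambda>s. h (x + s *\<^sub>R b)) has_derivative (\<lambda>k. h' (k *\<^sub>R b))) (at s)"
      by (simp add: o_def)
    moreover have "(\<lambda>k. h' (k *\<^sub>R b)) = (*) (h' b)"
      using linear_scale[OF has_derivative_linear[OF that]] by (auto simp: mult.commute)
    ultimately show ?thesis
      by (simp only: has_field_derivative_def)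
  qed
  show ?thesis unfolding has_jet_def
  proof (intro conjI exI[of _ "\<lambda>b s. partial b f (x + s *\<^sub>R b)"]
      exI[of _ "\<lambda>b. partial b (partial b f) x"] ballI allI)
    have "(\<lambda>s. u (x, s)) differentiable (at t)" using assms by (auto simp: C21_def)
    thus "((\<lambda>s. u (x, s)) has_real_derivative dt u (x, t)) (at t)"
      by (simp add: dt_def DERIV_deriv_iff_real_differentiable)
    fix b :: 'a and s :: real assume b: "b \<in> Basis"
    show "((\<lambda>s. u (x + s *\<^sub>R b, t)) has_real_derivative partial b f (x + s *\<^sub>R b)) (at s)"
      using line[OF diff, of b s] by (simp add: f_def partial_def)
    show "partial b f (x + 0 *\<^sub>R b) = grad (at_time u t) x \<bullet> b"
      using b by (simp add: grad_def f_def inner_sum_left_Basis)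
    show "((\<lambda>s. partial b f (x + s *\<^sub>R b)) has_real_derivative partial b (partial b f) x) (at 0)"
      using line[OF diff2[OF b], of b 0] by (simp add: partial_def)
  qed (simp add: laplacian_def f_def)
qed

section \<open>Comparison of one-sidedly bounded functions on the whole space\<close>

definition penalty :: "real \<Rightarrow> real \<Rightarrow> 'a::euclidean_space \<times> real \<Rightarrow> real" where
  "penalty B t0 = (\<lambda>(x, t). - sqrt (1 + (norm x)\<^sup>2) - real (DIM('a) + 2) * (t - t0) - B)"

lemma penalty_le:
  assumes "t0 \<le> t"
  shows "penalty B t0 (x, t) \<le> - norm x - B"
proof -
  have "norm x \<le> sqrt (1 + (norm x)\<^sup>2)"
    by (rule real_le_rsqrt) simp
  moreover have "0 \<le> real (DIM('a) + 2) * (t - t0)" using assms by simp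
  ultimately show ?thesis unfolding penalty_def prod.case by linarith
qed

lemma continuous_on_penalty: "continuous_on S (penalty B t0)"
  unfolding penalty_def case_prod_beta by (intro continuous_intros)

text \<open>The spatial part has slope at most 1 and Laplacian at least \<open>- DIM('a)\<close>.
  The rate \<open>DIM('a) + 2\<close> therefore pays for the Laplacian, for |g|^q <= 1 and for a
  strict gap of 1.\<close>

lemma (in hj_exponent) penalty_jet:
  fixes x :: "'a::euclidean_space"
  shows "\<exists>\<tau> g l. has_jet (penalty B t0) x t \<tau> g l \<and> \<tau> - l + norm g powr q \<le> - 1"
proof -
  define r where "r = (norm x)\<^sup>2"
  define F' where "F' r = - 1 / (2 * sqrt (1 + r))" for r :: real
  define F'' where "F'' = 1 / (4 * (1 + r) * sqrt (1 + r))"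
  have r: "0 \<le> r" "0 < 1 + r" "0 < sqrt (1 + r)" by (auto simp: r_def add_pos_nonneg)
  have "has_jet (\<lambda>(y, s). - sqrt (1 + (norm (y - 0))\<^sup>2) - real (DIM('a) + 2) * (s - t0) - B) x t
     (- real (DIM('a) + 2)) ((2 * F' ((norm (x - 0))\<^sup>2)) *\<^sub>R (x - 0))
     (4 * (norm (x - 0))\<^sup>2 * F'' + 2 * real DIM('a) * F' ((norm (x - 0))\<^sup>2))"
  proof (rule has_jet_radial[of "\<lambda>r t. - sqrt (1 + r) - real (DIM('a) + 2) * (t - t0) - B"])
    fix r :: real assume "0 \<le> r"
    thus "((\<lambda>r. - sqrt (1 + r) - real (DIM('a) + 2) * (t - t0) - B) has_real_derivative F' r) (at r)"
      unfolding F'_def by (auto intro!: derivative_eq_intros simp: field_simps)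
  next
    show "(F' has_real_derivative F'') (at ((norm (x - 0))\<^sup>2))"
      using r unfolding F'_def F''_def
      by (auto intro!: derivative_eq_intros simp flip: r_def) (simp add: field_simps)
  qed (auto intro!: derivative_eq_intros)
  hence jet: "has_jet (penalty B t0) x t (- real (DIM('a) + 2)) ((2 * F' r) *\<^sub>R x)
     (4 * r * F'' + 2 * real DIM('a) * F' r)"
    by (simp add: penalty_def r_def)
  have "1 \<le> sqrt (1 + r)" using r by simp
  hence "- (2 * F' r) \<le> 1" by (simp add: F'_def)
  hence "real DIM('a) * (- (2 * F' r)) \<le> real DIM('a) * 1" by (intro mult_left_mono) auto
  moreover have "0 \<le> 4 * r * F''" using r by (simp add: F''_def)
  moreover have "norm ((2 * F' r) *\<^sub>R x) \<le> 1"
  proof -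
    have "norm x \<le> sqrt (1 + r)" by (rule real_le_rsqrt) (simp add: r_def)
    thus ?thesis using r by (simp add: F'_def)
  qed
  hence "norm ((2 * F' r) *\<^sub>R x) powr q \<le> 1"
    using powr_mono2[of q "norm ((2 * F' r) *\<^sub>R x)" 1] q_gt_1 by simp
  ultimately have "- real (DIM('a) + 2) - (4 * r * F'' + 2 * real DIM('a) * F' r)
     + norm ((2 * F' r) *\<^sub>R x) powr q \<le> - 1" by (simp only: of_nat_add of_nat_numeral)
  thus ?thesis using jet by blast
qed

text \<open>The Hamiltonian is convex, so a convex combination of a subsolution with the strict
  subsolution \<open>penalty\<close> is again strict; this restores compactness.\<close>

lemma (in hj_exponent) comparison:
  fixes W u :: "'a::euclidean_space \<times> real \<Rightarrow> real"
  assumes cont: "continuous_on (UNIV \<times> {t0..t1}) W" "continuous_on (UNIV \<times> {t0..t1}) u"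
    and init: "\<And>x. W (x, t0) \<le> u (x, t0)"
    and "0 \<le> K"
    and bound: "\<And>x t. t0 \<le> t \<Longrightarrow> t \<le> t1 \<Longrightarrow> W (x, t) \<le> K"
      "\<And>x t. t0 \<le> t \<Longrightarrow> t \<le> t1 \<Longrightarrow> - K \<le> u (x, t)"
    and u: "\<And>x t. t0 < t \<Longrightarrow> t \<le> t1 \<Longrightarrow>
               \<exists>\<tau> g l. has_jet u x t \<tau> g l \<and> 0 \<le> \<tau> - l + norm g powr q"
    and W: "\<And>x t. t0 < t \<Longrightarrow> t \<le> t1 \<Longrightarrow> u (x, t) < W (x, t) \<Longrightarrow>
               \<exists>\<tau> g l. has_jet W x t \<tau> g l \<and> \<tau> - l + norm g powr q \<le> 0"
    and t: "t0 \<le> t" "t \<le> t1"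
  shows "W (x, t) \<le> u (x, t)"
proof -
  define P where "P = (penalty K t0 :: 'a \<times> real \<Rightarrow> real)"
  have P_le: "P (x, t) \<le> - norm x - K" if "t0 \<le> t" for x t
    using penalty_le[OF that] by (auto simp: P_def)
  have P_u: "P (x, t) \<le> u (x, t)" if "t0 \<le> t" "t \<le> t1" for x t
    using P_le[OF that(1), of x] bound(2)[OF that, of x] norm_ge_zero[of x] by linarith
  have pen: "(1 - k) * W (x, t) + k * P (x, t) \<le> u (x, t)" if k: "0 < k" "k < 1" for k
  proof -
    define Wk where "Wk p = (1 - k) * W p + k * P p" for p
    have "Wk (x, t) \<le> u (x, t)"
    \<comment> \<open>Where |y| >= 2 K / k, the bounds W <= K and P <= -|y| - K force the
      combination below -K, hence below u.\<close>
    proof (rule comparison_strict[of t0 t1 Wk u "2 * K / k" "\<lambda>g. norm g powr q"])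
      show "continuous_on (UNIV \<times> {t0..t1}) Wk"
        unfolding Wk_def P_def by (intro continuous_intros cont continuous_on_penalty)
      show "continuous_on (UNIV \<times> {t0..t1}) u" by fact
      fix y :: 'a
      have "(1 - k) * W (y, t0) \<le> (1 - k) * u (y, t0)" "k * P (y, t0) \<le> k * u (y, t0)"
        using k init[of y] P_u[of t0 y] t by (auto intro!: mult_left_mono)
      thus "Wk (y, t0) \<le> u (y, t0)" unfolding Wk_def by (simp add: algebra_simps)
    next
      fix y :: 'a and s assume y: "2 * K / k \<le> norm y" and s: "t0 \<le> s" "s \<le> t1"
      have "(1 - k) * W (y, s) \<le> (1 - k) * K" "k * P (y, s) \<le> k * (- norm y - K)"
        using k bound(1)[OF s] P_le[OF s(1)] by (auto intro!: mult_left_mono)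
      moreover have "2 * K \<le> k * norm y" using y k by (simp add: field_simps)
      moreover have "0 \<le> k * K" using k \<open>0 \<le> K\<close> by simp
      ultimately have "Wk (y, s) \<le> - K" unfolding Wk_def by (simp add: algebra_simps)
      thus "Wk (y, s) \<le> u (y, s)" using bound(2)[OF s, of y] by linarith
    next
      fix y :: 'a and s assume s: "t0 < s" "s \<le> t1"
      show "\<exists>\<tau> g l. has_jet u y s \<tau> g l \<and> 0 \<le> \<tau> - l + norm g powr q"
        by (rule u[OF s])
      assume less: "u (y, s) < Wk (y, s)"
      \<comment> \<open>P lies below u, so the combination can exceed u only where W itself does,
        which is where W is known to be a subsolution.\<close>
      have "k * P (y, s) \<le> k * u (y, s)" using k P_u[of s y] s by (auto intro!: mult_left_mono)
      hence "(1 - k) * u (y, s) < (1 - k) * W (y, s)"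
        using less unfolding Wk_def by (simp add: algebra_simps)
      hence "u (y, s) < W (y, s)" using k by simp
      then obtain \<tau> g l where 1: "has_jet W y s \<tau> g l" "\<tau> - l + norm g powr q \<le> 0"
        using W[OF s] by blast
      obtain \<tau>' g' l' where 2: "has_jet P y s \<tau>' g' l'" "\<tau>' - l' + norm g' powr q \<le> - 1"
        using penalty_jet[of K t0 y s] unfolding P_def by blast
      have jet: "has_jet Wk y s ((1 - k) * \<tau> + k * \<tau>') ((1 - k) *\<^sub>R g + k *\<^sub>R g')
          ((1 - k) * l + k * l')"
        unfolding Wk_def[abs_def] by (rule has_jet_lincomb[OF 1(1) 2(1)])
      have "(1 - k) * (\<tau> - l + norm g powr q) + k * (\<tau>' - l' + norm g' powr q)
          \<le> (1 - k) * 0 + k * (- 1)"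
        using k 1 2 by (intro add_mono mult_left_mono) auto
      moreover have "norm ((1 - k) *\<^sub>R g + k *\<^sub>R g') powr q
          \<le> (1 - k) * norm g powr q + k * norm g' powr q"
        using k q_gt_1 by (intro norm_powr_convex) auto
      ultimately have "((1 - k) * \<tau> + k * \<tau>') - ((1 - k) * l + k * l')
          + norm ((1 - k) *\<^sub>R g + k *\<^sub>R g') powr q < 0"
        using k by (simp add: algebra_simps)
      thus "\<exists>\<tau> g l. has_jet Wk y s \<tau> g l \<and> \<tau> - l + norm g powr q < 0"
        using jet by blast
    qed (use t in auto)
    thus ?thesis by (simp add: Wk_def)
  qed
  have "((\<lambda>k. (1 - k) * W (x, t) + k * P (x, t)) \<longlongrightarrow> (1 - 0) * W (x, t) + 0 * P (x, t)) (at_right 0)"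
    by (intro tendsto_intros)
  moreover have "\<forall>\<^sub>F k in at_right 0. (1 - k) * W (x, t) + k * P (x, t) \<le> u (x, t)"
    using eventually_at_right_real[OF zero_less_one] by (rule eventually_mono) (auto intro: pen)
  ultimately have "(1 - 0) * W (x, t) + 0 * P (x, t) \<le> u (x, t)"
    by (rule tendsto_upperbound) simp
  thus ?thesis by simp
qed

lemma classical_solution_jet:
  assumes "classical_solution q u0 u" "0 < t"
  shows "\<exists>\<tau> g l. has_jet u x t \<tau> g l \<and> \<tau> - l + norm g powr q = 0"
proof -
  have "has_jet u x t (dt u (x, t)) (grad (at_time u t) x) (laplacian (at_time u t) x)"
    using assms by (intro C21_has_jet) (auto simp: classical_solution_def)
  thus ?thesis using assms by (force simp: classical_solution_def)
qed

section \<open>Essential supremum of continuous functions\<close>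

lemma Linf_norm_le:
  fixes f :: "'a::euclidean_space \<Rightarrow> real"
  assumes "f \<in> borel_measurable borel" "\<And>x. \<bar>f x\<bar> \<le> C"
  shows "Linf_norm f \<le> ereal C"
  unfolding Linf_norm_def using assms by (intro esssup_I) auto

text \<open>If |f x| were larger than the norm, a level C' would fit strictly between, and the set
  where |f| exceeds C' would be a nonempty open null set.\<close>

lemma continuous_le_Linf_norm:
  fixes f :: "'a::euclidean_space \<Rightarrow> real"
  assumes f: "continuous_on UNIV f"
  shows "ereal \<bar>f x\<bar> \<le> Linf_norm f"
proof (rule ccontr)
  assume "\<not> ereal \<bar>f x\<bar> \<le> Linf_norm f"
  hence less: "Linf_norm f < ereal \<bar>f x\<bar>" by simp
  define C where "C = Linf_norm f"
  obtain C' where C': "C < ereal C'" "ereal C' < ereal \<bar>f x\<bar>"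
    using ereal_dense2[OF less] by (auto simp: C_def)
  define A where "A = {y. C' < \<bar>f y\<bar>}"
  have "AE y in lborel. ereal (norm (f y)) \<le> C"
    unfolding C_def Linf_norm_def by (rule esssup_AE)
  hence "AE y in lborel. y \<notin> A"
  proof eventually_elim
    case (elim y)
    hence "ereal \<bar>f y\<bar> < ereal C'" using C'(1) order.strict_trans1 by fastforce
    hence "\<bar>f y\<bar> < C'" by (simp only: less_ereal.simps)
    thus ?case by (simp add: A_def)
  qed
  moreover have "open A"
    unfolding A_def by (intro open_Collect_less continuous_intros f)
  moreover have "x \<in> A" using C' by (simp add: A_def)
  ultimately show False
    using AE_iff_null_sets[of A lborel] open_not_negligible[of A]
      negligible_iff_null_sets[of A] null_sets_completionI[of A lborel] by auto
qed

section \<open>Barriers for the viscous equation\<close>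

context hj_exponent
begin

text \<open>A function of \<open>r = \<bar>x\<bar>\<^sup>2\<close> that replaces \<open>kernel x T\<close>: the power \<open>r powr (\<beta> / 2)\<close> itself
  need not be twice differentiable at \<open>r = 0\<close>.\<close>

definition smooth_kernel :: "real \<Rightarrow> real \<Rightarrow> real" where
  "smooth_kernel r T = \<kappa> * (r + 1) powr (\<beta> / 2) * T powr - \<alpha>"

definition smooth_kernel_r :: "real \<Rightarrow> real \<Rightarrow> real" where
  "smooth_kernel_r r T = \<kappa> * (\<beta> / 2) * (r + 1) powr (\<beta> / 2 - 1) * T powr - \<alpha>"

definition smooth_kernel_rr :: "real \<Rightarrow> real \<Rightarrow> real" where
  "smooth_kernel_rr r T = \<kappa> * (\<beta> / 2) * (\<beta> / 2 - 1) * (r + 1) powr (\<beta> / 2 - 2) * T powr - \<alpha>"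

lemma smooth_kernel_DERIV:
  assumes "0 \<le> r" "0 < T"
  shows "((\<lambda>r. smooth_kernel r T) has_real_derivative smooth_kernel_r r T) (at r)"
    "((\<lambda>r. smooth_kernel_r r T) has_real_derivative smooth_kernel_rr r T) (at r)"
    "((\<lambda>T. smooth_kernel r T) has_real_derivative - \<alpha> * smooth_kernel r T / T) (at T)"
proof -
  show "((\<lambda>r. smooth_kernel r T) has_real_derivative smooth_kernel_r r T) (at r)"
    unfolding smooth_kernel_def smooth_kernel_r_def using assms
    by (auto intro!: derivative_eq_intros)
  show "((\<lambda>r. smooth_kernel_r r T) has_real_derivative smooth_kernel_rr r T) (at r)"
    unfolding smooth_kernel_r_def smooth_kernel_rr_def using assms
    by (auto intro!: derivative_eq_intros)
  have "T powr (- \<alpha> - 1) = T powr - \<alpha> / T"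
    using assms by (simp add: powr_diff)
  thus "((\<lambda>T. smooth_kernel r T) has_real_derivative - \<alpha> * smooth_kernel r T / T) (at T)"
    unfolding smooth_kernel_def using assms
    by (auto intro!: derivative_eq_intros)
qed

lemma smooth_kernel_nonneg:
  "0 \<le> smooth_kernel r T" "0 \<le> smooth_kernel_r r T" "0 \<le> smooth_kernel_rr r T"
  using kappa_pos beta_gt_2
  by (simp_all add: smooth_kernel_def smooth_kernel_r_def smooth_kernel_rr_def)

text \<open>With S the value of \<open>smooth_kernel\<close>, its time derivative is -\<alpha> S /
  T. So the factor (r / (r + 1))^(q/2) measures how far the smoothing is from solving the
  first-order equation: bounding it by 1 gives a subsolution, and it tends to 1 for large r.\<close>

lemma smooth_kernel_gradient:
  assumes "0 \<le> r" "0 < T"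
  shows "(2 * sqrt r * smooth_kernel_r r T) powr q
           = \<alpha> * (smooth_kernel r T / T) * (r / (r + 1)) powr (q / 2)"
proof -
  have "2 * sqrt r * smooth_kernel_r r T
      = (\<kappa> * \<beta>) * r powr (1 / 2) * (r + 1) powr (\<beta> / 2 - 1) * T powr - \<alpha>"
    using assms by (simp add: smooth_kernel_r_def powr_half_sqrt)
  hence "(2 * sqrt r * smooth_kernel_r r T) powr q
      = (\<kappa> * \<beta>) powr q * (r powr (1 / 2)) powr q * ((r + 1) powr (\<beta> / 2 - 1)) powr q
        * (T powr - \<alpha>) powr q"
    by (simp only: powr_mult)
  also have "\<dots> = (\<alpha> * \<kappa>) * r powr (q / 2) * (r + 1) powr ((\<beta> / 2 - 1) * q) * T powr (- \<alpha> * q)"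
    by (simp only: powr_powr kappa_beta_powr) simp
  also have "- \<alpha> * q = - \<alpha> - 1" using alpha_q beta_eq by simp
  also have "(\<beta> / 2 - 1) * q = \<beta> / 2 - q / 2"
    using alpha_q beta_eq by (simp add: field_simps)
  finally show ?thesis
    using assms by (simp add: smooth_kernel_def powr_diff powr_divide mult_ac)
qed

lemma smooth_kernel_gradient_le:
  assumes "0 \<le> r" "0 < T"
  shows "(2 * sqrt r * smooth_kernel_r r T) powr q \<le> \<alpha> * (smooth_kernel r T / T)"
proof -
  have "(r / (r + 1)) powr (q / 2) \<le> 1"
    using powr_mono2[of "q / 2" "r / (r + 1)" 1] assms q_gt_1 by simp
  hence "\<alpha> * (smooth_kernel r T / T) * (r / (r + 1)) powr (q / 2)
      \<le> \<alpha> * (smooth_kernel r T / T) * 1"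
    using assms alpha_gt_1 smooth_kernel_nonneg by (intro mult_left_mono) auto
  thus ?thesis by (simp add: smooth_kernel_gradient[OF assms])
qed

section \<open>Log-sum-exp approximation of the minimum of 0 and g - A\<close>

definition softmin :: "real \<Rightarrow> real \<Rightarrow> real \<Rightarrow> real" where
  "softmin k A g = - ln (1 + exp (k * (A - g))) / k"

definition softmin' :: "real \<Rightarrow> real \<Rightarrow> real \<Rightarrow> real" where
  "softmin' k A g = exp (k * (A - g)) / (1 + exp (k * (A - g)))"

lemma softmin_le: "0 < k \<Longrightarrow> softmin k A g \<le> min 0 (g - A)"
proof -
  assume k: "0 < k"
  have "0 \<le> ln (1 + exp (k * (A - g)))" by simp
  moreover have "k * (A - g) \<le> ln (1 + exp (k * (A - g)))"
    by (subst ln_exp[symmetric], subst ln_le_cancel_iff) (auto simp: add_pos_pos)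
  hence "A - g \<le> ln (1 + exp (k * (A - g))) / k" using k by (simp add: field_simps)
  ultimately show ?thesis using k by (simp add: softmin_def)
qed

lemma softmin_ge: "0 < k \<Longrightarrow> min 0 (g - A) - ln 2 / k \<le> softmin k A g"
proof -
  assume k: "0 < k"
  define m where "m = max 0 (k * (A - g))"
  have "1 \<le> exp m" "exp (k * (A - g)) \<le> exp m" by (simp_all add: m_def)
  hence "1 + exp (k * (A - g)) \<le> 2 * exp m" by linarith
  hence "ln (1 + exp (k * (A - g))) \<le> ln (2 * exp m)"
    by (subst ln_le_cancel_iff) (auto simp: add_pos_pos)
  also have "\<dots> = ln 2 + m" by (simp add: ln_mult)
  finally have "ln (1 + exp (k * (A - g))) / k \<le> (ln 2 + m) / k"
    using k by (simp add: divide_right_mono)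
  moreover have "m / k = - min 0 (g - A)"
    using k by (auto simp: m_def max_def min_def field_simps mult_le_0_iff)
  ultimately show ?thesis by (simp add: softmin_def add_divide_distrib)
qed

text \<open>A derivative p in (0, 1) satisfies p^q <= p, which is why composing with the soft
  minimum preserves subsolutions of the first-order equation. The exponential bound serves large
  values of the kernel.\<close>

lemma softmin'_bounds: "0 < softmin' k A g" "softmin' k A g < 1" "softmin' k A g \<le> exp (k * (A - g))"
proof -
  have "1 < 1 + exp (k * (A - g))" by simp
  thus "0 < softmin' k A g" "softmin' k A g < 1" "softmin' k A g \<le> exp (k * (A - g))"
    unfolding softmin'_def by (auto simp: field_simps add_pos_pos)
qed

lemma softmin_DERIV:
  assumes "0 < k"
  shows "(softmin k A has_real_derivative softmin' k A g) (at g)"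
    "(softmin' k A has_real_derivative - k * softmin' k A g * (1 - softmin' k A g)) (at g)"
proof -
  have pos: "0 < 1 + exp (k * (A - g))" by (simp add: add_pos_pos)
  show "(softmin k A has_real_derivative softmin' k A g) (at g)"
    unfolding softmin_def[abs_def] softmin'_def using assms pos
    by (auto intro!: derivative_eq_intros)
  show "(softmin' k A has_real_derivative - k * softmin' k A g * (1 - softmin' k A g)) (at g)"
    unfolding softmin'_def[abs_def] using assms pos
    by (auto intro!: derivative_eq_intros simp: field_simps)
qed

text \<open>Exponential decay of \<open>softmin'\<close> beats the power 2/q <= 2. The estimate is
  needed because the second derivative of \<open>softmin\<close> multiplies the squared gradient of
  the kernel, which is unbounded in space.\<close>

lemma softmin'_moment_bounded:
  assumes "0 < k"
  shows "\<exists>C\<ge>0. \<forall>g\<ge>0. softmin' k A g * (\<alpha> * g) powr (2 / q) \<le> C"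
proof (intro exI[of _ "1 + \<alpha>\<^sup>2 * exp (k * A) * (2 / k\<^sup>2)"] conjI allI impI)
  fix g :: real assume g: "0 \<le> g"
  have q: "0 \<le> 2 / q" "2 / q \<le> 2" using q_gt_1 by (auto simp: field_simps)
  have "(\<alpha> * g) powr (2 / q) \<le> 1 + (\<alpha> * g)\<^sup>2"
  proof (cases "\<alpha> * g \<le> 1")
    case True
    hence "(\<alpha> * g) powr (2 / q) \<le> 1"
      using powr_mono2[of "2 / q" "\<alpha> * g" 1] q g alpha_gt_1 by simp
    thus ?thesis using zero_le_power2[of "\<alpha> * g"] by linarith
  next
    case False
    hence "(\<alpha> * g) powr (2 / q) \<le> (\<alpha> * g) powr 2" using q by (intro powr_mono) auto
    thus ?thesis using False by simp
  qed
  hence "softmin' k A g * (\<alpha> * g) powr (2 / q) \<le> softmin' k A g * (1 + (\<alpha> * g)\<^sup>2)"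
    using softmin'_bounds[of k A g] by (intro mult_left_mono) auto
  also have "\<dots> \<le> 1 + exp (k * (A - g)) * (\<alpha> * g)\<^sup>2"
    using softmin'_bounds[of k A g]
      mult_right_mono[of "softmin' k A g" "exp (k * (A - g))" "(\<alpha> * g)\<^sup>2"]
    by (simp add: distrib_left)
  also have "exp (k * (A - g)) * (\<alpha> * g)\<^sup>2 \<le> \<alpha>\<^sup>2 * exp (k * A) * (2 / k\<^sup>2)"
  proof -
    have "(k * g)\<^sup>2 / 2 \<le> exp (k * g)"
      using exp_lower_Taylor_quadratic[of "k * g"] assms g mult_nonneg_nonneg[of k g]
      by (intro order.trans[OF _ exp_lower_Taylor_quadratic]) auto
    hence "g\<^sup>2 \<le> exp (k * g) * (2 / k\<^sup>2)"
      using assms by (simp add: field_simps power_mult_distrib)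
    hence "exp (k * (A - g)) * \<alpha>\<^sup>2 * g\<^sup>2 \<le> exp (k * (A - g)) * \<alpha>\<^sup>2 * (exp (k * g) * (2 / k\<^sup>2))"
      by (intro mult_left_mono) auto
    also have "\<dots> = \<alpha>\<^sup>2 * (exp (k * (A - g)) * exp (k * g)) * (2 / k\<^sup>2)" by simp
    also have "exp (k * (A - g)) * exp (k * g) = exp (k * A)"
      by (simp flip: exp_add add: algebra_simps)
    finally show ?thesis by (simp add: power_mult_distrib)
  qed
  finally show "softmin' k A g * (\<alpha> * g) powr (2 / q) \<le> 1 + \<alpha>\<^sup>2 * exp (k * A) * (2 / k\<^sup>2)"
    by simp
qed simp

text \<open>The derivative of \<open>T powr - decay_exp\<close> is a negative multiple of T^(-2/q),
  so this is the decay that remains after integrating the viscous error.\<close>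

definition decay_exp :: real where "decay_exp = 2 / q - 1"

lemma decay_exp_pos: "0 < decay_exp"
  using q_gt_1 q_less_2 by (simp add: decay_exp_def field_simps)

text \<open>For K >= 0 the correction starts at 0, decreases, and stays above
  \<open>- K * d powr - decay_exp\<close>; its fall pays for the viscous error. A large age d makes
  the total small, and e is an initial gap. The centre 0 is written out to fit
  \<open>has_jet_radial\<close>.\<close>

definition lower_barrier :: "real \<Rightarrow> real \<Rightarrow> real \<Rightarrow> real \<Rightarrow> real \<Rightarrow> real \<Rightarrow> 'a::euclidean_space \<times> real \<Rightarrow> real" where
  "lower_barrier k A K e t0 d = (\<lambda>(x, t). softmin k A (smooth_kernel ((norm (x - 0))\<^sup>2) (t - t0 + d))
      + K * ((t - t0 + d) powr - decay_exp - d powr - decay_exp) - e)"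

text \<open>By p^q <= p for p = \<open>softmin'\<close>, the time derivative of the kernel absorbs
  the Hamiltonian. The Laplacian of the kernel has the favourable sign. The one harmful term is k p
  (1 - p) times the squared gradient, from the concavity of the soft minimum, and the falling
  correction absorbs it.\<close>

lemma lower_barrier_jet:
  assumes k: "0 < k"
    and C: "\<And>g. 0 \<le> g \<Longrightarrow> k * (softmin' k A g * (\<alpha> * g) powr (2 / q)) \<le> K * decay_exp"
    and t: "t0 \<le> t" "0 < d"
  shows "\<exists>\<tau> g l. has_jet (lower_barrier k A K e t0 d) (x::'a::euclidean_space) t \<tau> g l \<and>
           \<tau> - l + norm g powr q \<le> 0"
proof -
  define T where "T = t - t0 + d"
  have T: "0 < T" using t by (simp add: T_def)
  define r where "r = (norm x)\<^sup>2"
  have r: "0 \<le> r" by (simp add: r_def)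
  define S where "S = smooth_kernel r T"
  define p where "p = softmin' k A S"
  have p: "0 < p" "p < 1" using softmin'_bounds by (auto simp: p_def)
  define F' where "F' r = softmin' k A (smooth_kernel r T) * smooth_kernel_r r T" for r
  define F'' where "F'' = - k * p * (1 - p) * smooth_kernel_r r T * smooth_kernel_r r T
     + smooth_kernel_rr r T * p"
  define \<tau> where "\<tau> = p * (- \<alpha> * S / T) + K * (- decay_exp * T powr (- (2 / q)))"
  define G where "G = 2 * sqrt r * smooth_kernel_r r T"
  have G: "0 \<le> G" using r smooth_kernel_nonneg by (simp add: G_def)
  have "has_jet (\<lambda>(y, s). softmin k A (smooth_kernel ((norm (y - 0))\<^sup>2) (s - t0 + d))
      + K * ((s - t0 + d) powr - decay_exp - d powr - decay_exp) - e) x t \<tau>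
     ((2 * F' ((norm (x - 0))\<^sup>2)) *\<^sub>R (x - 0))
     (4 * (norm (x - 0))\<^sup>2 * F'' + 2 * real DIM('a) * F' ((norm (x - 0))\<^sup>2))"
  proof (rule has_jet_radial[of "\<lambda>r s. softmin k A (smooth_kernel r (s - t0 + d))
      + K * ((s - t0 + d) powr - decay_exp - d powr - decay_exp) - e"])
    fix r :: real assume "0 \<le> r"
    have "((\<lambda>r. softmin k A (smooth_kernel r T)) has_real_derivative F' r) (at r)"
      unfolding F'_def
      by (rule DERIV_chain2[OF softmin_DERIV(1)[OF k] smooth_kernel_DERIV(1)[OF \<open>0 \<le> r\<close> T]])
    thus "((\<lambda>r. softmin k A (smooth_kernel r (t - t0 + d))
      + K * ((t - t0 + d) powr - decay_exp - d powr - decay_exp) - e) has_real_derivative F' r) (at r)"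
      unfolding T_def by (auto intro!: derivative_eq_intros)
  next
    have "((\<lambda>r. softmin' k A (smooth_kernel r T)) has_real_derivative
        - k * p * (1 - p) * smooth_kernel_r r T) (at r)"
      using DERIV_chain2[OF softmin_DERIV(2)[OF k] smooth_kernel_DERIV(1)[OF r T]]
      by (simp add: p_def S_def)
    from DERIV_mult[OF this smooth_kernel_DERIV(2)[OF r T]]
    show "(F' has_real_derivative F'') (at ((norm (x - 0))\<^sup>2))"
      unfolding F'_def[abs_def] F''_def by (simp add: r_def p_def S_def)
  next
    have "((\<lambda>s. s - t0 + d) has_real_derivative 1) (at t)"
      by (auto intro!: derivative_eq_intros)
    from DERIV_chain2[of "smooth_kernel r" _ "\<lambda>s. s - t0 + d", OF _ this]
    have 1: "((\<lambda>s. smooth_kernel r (s - t0 + d)) has_real_derivative - \<alpha> * S / T) (at t)"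
      using smooth_kernel_DERIV(3)[OF r T] by (simp add: T_def S_def)
    have 2: "((\<lambda>s. softmin k A (smooth_kernel r (s - t0 + d))) has_real_derivative p * (- \<alpha> * S / T)) (at t)"
      using DERIV_chain2[OF softmin_DERIV(1)[OF k] 1] by (simp add: p_def S_def T_def)
    have 3: "((\<lambda>s. (s - t0 + d) powr - decay_exp) has_real_derivative
        - decay_exp * T powr (- (2 / q))) (at t)"
      using T unfolding T_def by (auto intro!: derivative_eq_intros simp: decay_exp_def)
    have "((\<lambda>s. softmin k A (smooth_kernel r (s - t0 + d))
      + K * ((s - t0 + d) powr - decay_exp - d powr - decay_exp) - e) has_real_derivative
        p * (- \<alpha> * S / T) + K * (- decay_exp * T powr (- (2 / q)) - 0) - 0) (at t)"
      by (intro DERIV_diff DERIV_add DERIV_cmult 2 3 DERIV_const)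
    thus "((\<lambda>s. softmin k A (smooth_kernel ((norm (x - 0))\<^sup>2) (s - t0 + d))
      + K * ((s - t0 + d) powr - decay_exp - d powr - decay_exp) - e) has_real_derivative \<tau>) (at t)"
      unfolding \<tau>_def by (simp add: r_def)
  qed
  hence jet: "has_jet (lower_barrier k A K e t0 d) x t \<tau> ((2 * F' r) *\<^sub>R x)
     (4 * r * F'' + 2 * real DIM('a) * F' r)"
    by (simp add: lower_barrier_def r_def)
  have "norm ((2 * F' r) *\<^sub>R x) = p * G"
    using p smooth_kernel_nonneg by (simp add: F'_def p_def S_def G_def r_def abs_mult)
  hence "norm ((2 * F' r) *\<^sub>R x) powr q = p powr q * G powr q"
    using p G by (simp add: powr_mult)
  also have "\<dots> \<le> p * (\<alpha> * (S / T))"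
  proof (intro mult_mono)
    show "p powr q \<le> p" using powr_mono'[of 1 q p] p q_gt_1 by simp
    show "G powr q \<le> \<alpha> * (S / T)"
      unfolding G_def S_def by (rule smooth_kernel_gradient_le[OF r T])
  qed (use p in auto)
  finally have grad: "norm ((2 * F' r) *\<^sub>R x) powr q \<le> p * (\<alpha> * (S / T))" .
  have "4 * r * F'' + 2 * real DIM('a) * F' r \<ge> - k * p * (1 - p) * G\<^sup>2"
  proof -
    have "G\<^sup>2 = 4 * r * (smooth_kernel_r r T * smooth_kernel_r r T)"
      using r by (simp add: G_def power_mult_distrib power2_eq_square[of "smooth_kernel_r r T"])
    moreover have "0 \<le> 4 * r * (smooth_kernel_rr r T * p)" "0 \<le> 2 * real DIM('a) * F' r"
      using r p smooth_kernel_nonneg by (auto simp: F'_def p_def S_def)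
    ultimately show ?thesis unfolding F''_def by (simp add: algebra_simps)
  qed
  \<comment> \<open>Raising G^q <= \<alpha> S / T to the power 2/q splits off T^(-2/q), the rate at
    which the correction falls; what remains is the moment bounded by hypothesis C.\<close>
  moreover have "k * p * (1 - p) * G\<^sup>2 \<le> K * decay_exp * T powr (- (2 / q))"
  proof -
    have "G\<^sup>2 = (G powr q) powr (2 / q)"
      using G q_gt_1 by (cases "G = 0") (auto simp: powr_powr)
    also have "\<dots> \<le> (\<alpha> * (S / T)) powr (2 / q)"
      unfolding G_def S_def using q_gt_1
      by (intro powr_mono2 smooth_kernel_gradient_le[OF r T]) auto
    also have "\<dots> = (\<alpha> * S) powr (2 / q) * T powr (- (2 / q))"
      using T by (simp add: powr_divide powr_minus divide_inverse powr_mult inverse_powr)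
    finally have "G\<^sup>2 \<le> (\<alpha> * S) powr (2 / q) * T powr (- (2 / q))" .
    moreover have "k * p * (1 - p) \<le> k * p" using k p mult_left_mono[of "1 - p" 1 "k * p"] by simp
    ultimately have "k * p * (1 - p) * G\<^sup>2 \<le> k * p * ((\<alpha> * S) powr (2 / q) * T powr (- (2 / q)))"
      using k p by - (rule mult_mono, auto)
    also have "\<dots> = (k * (p * (\<alpha> * S) powr (2 / q))) * T powr (- (2 / q))" by simp
    also have "\<dots> \<le> (K * decay_exp) * T powr (- (2 / q))"
      using C[of S] smooth_kernel_nonneg by (intro mult_right_mono) (auto simp: p_def S_def)
    finally show ?thesis .
  qed
  ultimately have "\<tau> - (4 * r * F'' + 2 * real DIM('a) * F' r) + norm ((2 * F' r) *\<^sub>R x) powr q \<le> 0"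
    using grad unfolding \<tau>_def by (simp add: algebra_simps)
  thus ?thesis using jet by blast
qed

lemma continuous_on_lower_barrier:
  assumes "0 < k" "0 < d"
  shows "continuous_on (UNIV \<times> {t0..t1}) (lower_barrier k A K e t0 d)"
proof -
  have 1: "1 + exp (k * z) \<noteq> 0" for z :: real using exp_gt_zero[of "k * z"] by linarith
  have 2: "(norm y)\<^sup>2 + 1 \<noteq> 0" for y :: "'b::real_normed_vector" using zero_le_power2[of "norm y"] by linarith
  show ?thesis
    unfolding lower_barrier_def softmin_def smooth_kernel_def case_prod_beta
    using assms by (intro continuous_intros) (auto simp: 1 2)
qed

section \<open>Barrier for -u built from the smoothed kernel\<close>

definition upper_barrier :: "real \<Rightarrow> real \<Rightarrow> 'a \<Rightarrow> real \<Rightarrow> real \<Rightarrow> 'a::euclidean_space \<times> real \<Rightarrow> real" where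
  "upper_barrier A K a t0 d = (\<lambda>(x, t). A - smooth_kernel ((norm (x - a))\<^sup>2) (t - t0 + d)
      + K * ((t - t0 + d) powr - decay_exp - d powr - decay_exp))"

text \<open>With S = \<open>smooth_kernel r T\<close>, the left side, which controls the Laplacian,
  equals S^(1 - 2/\<beta>) (\<kappa> T^(-\<alpha>))^(2/\<beta>). Since 2 \<alpha> / \<beta> = 2/q, a
  bound on S leaves the integrable rate.\<close>

lemma smooth_kernel_level:
  assumes "0 \<le> r" "0 < T" "smooth_kernel r T \<le> A"
  shows "\<kappa> * (r + 1) powr (\<beta> / 2 - 1) * T powr - \<alpha>
           \<le> A powr (1 - 2 / \<beta>) * \<kappa> powr (2 / \<beta>) * T powr - (2 / q)"
proof -
  have "\<alpha> * (2 / \<beta>) = 2 / q" using alpha_q alpha_gt_1 q_gt_1 by (simp add: alpha_q[symmetric])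
  hence T: "(T powr - \<alpha>) powr (2 / \<beta>) = T powr - (2 / q)" by (simp add: powr_powr)
  have split: "z powr (1 - 2 / \<beta>) * z powr (2 / \<beta>) = z" if "0 < z" for z :: real
    using that by (simp flip: powr_add)
  have "(r + 1) powr (\<beta> / 2 - 1) = ((r + 1) powr (\<beta> / 2)) powr (1 - 2 / \<beta>)"
    using beta_gt_2 by (simp add: powr_powr right_diff_distrib)
  hence "\<kappa> * (r + 1) powr (\<beta> / 2 - 1) * T powr - \<alpha>
     = (\<kappa> powr (1 - 2 / \<beta>) * \<kappa> powr (2 / \<beta>)) * ((r + 1) powr (\<beta> / 2)) powr (1 - 2 / \<beta>)
       * ((T powr - \<alpha>) powr (1 - 2 / \<beta>) * (T powr - \<alpha>) powr (2 / \<beta>))"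
    using kappa_pos assms by (simp add: split)
  also have "\<dots> = smooth_kernel r T powr (1 - 2 / \<beta>) * \<kappa> powr (2 / \<beta>) * T powr - (2 / q)"
    unfolding T smooth_kernel_def by (simp only: powr_mult mult_ac)
  also have "\<dots> \<le> A powr (1 - 2 / \<beta>) * \<kappa> powr (2 / \<beta>) * T powr - (2 / q)"
    using assms smooth_kernel_nonneg beta_gt_2
    by (intro mult_right_mono powr_mono2) auto
  finally show ?thesis .
qed

text \<open>Where the barrier is positive the kernel is at most A, so
  \<open>smooth_kernel_level\<close> bounds all errors by multiples of T^(-2/q). In the constant,
  \<alpha> accounts for the smoothing defect in the first-order equation and the other two summands
  for the Laplacian; d >= 1 bounds a factor 1/T by 1. The Hamiltonian has the sign that belongs to
  -u.\<close>

lemma upper_barrier_jet: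
  fixes a x :: "'a::euclidean_space"
  assumes K: "(\<alpha> + \<beta> * (\<beta> - 2) + real DIM('a) * \<beta>) * (A powr (1 - 2 / \<beta>) * \<kappa> powr (2 / \<beta>))
                < K * decay_exp" "0 \<le> K"
    and t: "t0 \<le> t" "1 \<le> d" and pos: "0 < upper_barrier A K a t0 d (x, t)"
  shows "\<exists>\<tau> g l. has_jet (upper_barrier A K a t0 d) x t \<tau> g l \<and> \<tau> - l + - (norm g powr q) < 0"
proof -
  define T where "T = t - t0 + d"
  have T: "0 < T" "1 \<le> T" "d \<le> T" using t by (auto simp: T_def)
  define r where "r = (norm (x - a))\<^sup>2"
  have r: "0 \<le> r" by (simp add: r_def)
  define S where "S = smooth_kernel r T"
  define F' where "F' r = - smooth_kernel_r r T" for r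
  define F'' where "F'' = - smooth_kernel_rr r T"
  define \<tau> where "\<tau> = \<alpha> * S / T + K * (- decay_exp * T powr (- (2 / q)))"
  have "has_jet (\<lambda>(y, s). A - smooth_kernel ((norm (y - a))\<^sup>2) (s - t0 + d)
      + K * ((s - t0 + d) powr - decay_exp - d powr - decay_exp)) x t \<tau>
     ((2 * F' ((norm (x - a))\<^sup>2)) *\<^sub>R (x - a))
     (4 * (norm (x - a))\<^sup>2 * F'' + 2 * real DIM('a) * F' ((norm (x - a))\<^sup>2))"
  proof (rule has_jet_radial[of "\<lambda>r s. A - smooth_kernel r (s - t0 + d)
      + K * ((s - t0 + d) powr - decay_exp - d powr - decay_exp)"])
    fix r :: real assume "0 \<le> r"
    from smooth_kernel_DERIV(1)[OF this T(1)]
    show "((\<lambda>r. A - smooth_kernel r (t - t0 + d)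
      + K * ((t - t0 + d) powr - decay_exp - d powr - decay_exp)) has_real_derivative F' r) (at r)"
      unfolding F'_def T_def by (auto intro!: derivative_eq_intros)
  next
    show "(F' has_real_derivative F'') (at ((norm (x - a))\<^sup>2))"
      unfolding F'_def[abs_def] F''_def r_def[symmetric]
      by (rule DERIV_minus[OF smooth_kernel_DERIV(2)[OF r T(1)]])
  next
    have "((\<lambda>s. s - t0 + d) has_real_derivative 1) (at t)"
      by (auto intro!: derivative_eq_intros)
    from DERIV_chain2[of "smooth_kernel r" _ "\<lambda>s. s - t0 + d", OF _ this]
    have 2: "((\<lambda>s. smooth_kernel r (s - t0 + d)) has_real_derivative - \<alpha> * S / T) (at t)"
      using smooth_kernel_DERIV(3)[OF r T(1)] by (simp add: T_def S_def)
    have 3: "((\<lambda>s. (s - t0 + d) powr - decay_exp) has_real_derivative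
        - decay_exp * T powr (- (2 / q))) (at t)"
      using T unfolding T_def by (auto intro!: derivative_eq_intros simp: decay_exp_def)
    have "((\<lambda>s. A - smooth_kernel r (s - t0 + d)
      + K * ((s - t0 + d) powr - decay_exp - d powr - decay_exp)) has_real_derivative
        0 - (- \<alpha> * S / T) + K * (- decay_exp * T powr (- (2 / q)) - 0)) (at t)"
      by (intro DERIV_diff DERIV_add DERIV_cmult 2 3 DERIV_const)
    thus "((\<lambda>s. A - smooth_kernel ((norm (x - a))\<^sup>2) (s - t0 + d)
      + K * ((s - t0 + d) powr - decay_exp - d powr - decay_exp)) has_real_derivative \<tau>) (at t)"
      unfolding \<tau>_def by (simp add: r_def)
  qed
  hence jet: "has_jet (upper_barrier A K a t0 d) x t \<tau> ((2 * F' r) *\<^sub>R (x - a))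
     (4 * r * F'' + 2 * real DIM('a) * F' r)"
    by (simp add: upper_barrier_def r_def)
  define Q where "Q = \<kappa> * (r + 1) powr (\<beta> / 2 - 1) * T powr - \<alpha>"
  have Q: "0 \<le> Q" using kappa_pos by (simp add: Q_def)
  have rQ: "(r + 1) * Q = S"
  proof -
    have "(r + 1) * (r + 1) powr (\<beta> / 2 - 1) = (r + 1) powr (\<beta> / 2)"
      using r powr_mult_base[of "r + 1" "\<beta> / 2 - 1"] by simp
    thus ?thesis unfolding Q_def S_def smooth_kernel_def by (simp add: mult_ac)
  qed
  have r1: "0 < r + 1" using r by simp
  have "smooth_kernel_r r T = \<beta> / 2 * Q" by (simp add: smooth_kernel_r_def Q_def)
  moreover have "r * smooth_kernel_rr r T \<le> (\<beta> / 2) * (\<beta> / 2 - 1) * Q"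
  proof -
    have "(r + 1) powr (\<beta> / 2 - 2) = (r + 1) powr (\<beta> / 2 - 1) / (r + 1)"
      using r1 powr_diff[of "r + 1" "\<beta> / 2 - 1" 1] by simp
    hence "r * smooth_kernel_rr r T = (\<beta> / 2) * (\<beta> / 2 - 1) * Q * (r / (r + 1))"
      by (simp add: smooth_kernel_rr_def Q_def)
    also have "\<dots> \<le> (\<beta> / 2) * (\<beta> / 2 - 1) * Q * 1"
      using r Q beta_gt_2 by (intro mult_left_mono) auto
    finally show ?thesis by simp
  qed
  ultimately have lap: "- (4 * r * F'' + 2 * real DIM('a) * F' r)
      \<le> (\<beta> * (\<beta> - 2) + real DIM('a) * \<beta>) * Q"
    unfolding F'_def F''_def by (simp add: algebra_simps)
  have "norm ((2 * F' r) *\<^sub>R (x - a)) = 2 * sqrt r * smooth_kernel_r r T"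
    using smooth_kernel_nonneg by (simp add: F'_def r_def abs_mult)
  hence "norm ((2 * F' r) *\<^sub>R (x - a)) powr q = \<alpha> * (S / T) * (r / (r + 1)) powr (q / 2)"
    using smooth_kernel_gradient[OF r T(1)] by (simp add: S_def)
  \<comment> \<open>Since q < 2, the exponent q/2 is below 1, so the relative smoothing defect is at
    most 1 - r / (r + 1) = 1 / (r + 1), and S / (r + 1) is again Q.\<close>
  moreover have "r / (r + 1) \<le> (r / (r + 1)) powr (q / 2)"
    using powr_mono'[of "q / 2" 1 "r / (r + 1)"] r q_less_2 by simp
  hence "\<alpha> * (S / T) * (r / (r + 1)) \<le> \<alpha> * (S / T) * (r / (r + 1)) powr (q / 2)"
    using T alpha_gt_1 smooth_kernel_nonneg by (intro mult_left_mono) (auto simp: S_def)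
  ultimately have "\<alpha> * S / T - norm ((2 * F' r) *\<^sub>R (x - a)) powr q
      \<le> \<alpha> * (S / T) - \<alpha> * (S / T) * (r / (r + 1))"
    by simp
  also have "\<dots> = \<alpha> * (S / T) * (1 - r / (r + 1))" by (simp add: right_diff_distrib)
  also have "1 - r / (r + 1) = 1 / (r + 1)" using r1 by (simp add: field_simps)
  also have "\<alpha> * (S / T) * (1 / (r + 1)) = \<alpha> * (S / (r + 1)) / T" by simp
  also have "S / (r + 1) = Q" using rQ r1 by (simp add: field_simps)
  also have "\<alpha> * Q / T \<le> \<alpha> * Q"
    using T Q alpha_gt_1 mult_left_mono[of 1 T "\<alpha> * Q"] by (simp add: field_simps)
  finally have time: "\<alpha> * S / T - norm ((2 * F' r) *\<^sub>R (x - a)) powr q \<le> \<alpha> * Q" .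
  have "T powr - decay_exp \<le> d powr - decay_exp"
    using decay_exp_pos T t by (intro powr_mono2') auto
  hence "K * (T powr - decay_exp - d powr - decay_exp) \<le> 0"
    using K by (simp add: mult_nonneg_nonpos)
  hence "S \<le> A"
    using pos by (simp add: upper_barrier_def r_def S_def T_def)
  hence "Q \<le> A powr (1 - 2 / \<beta>) * \<kappa> powr (2 / \<beta>) * T powr - (2 / q)"
    unfolding Q_def S_def by (rule smooth_kernel_level[OF r T(1)])
  hence "(\<alpha> + \<beta> * (\<beta> - 2) + real DIM('a) * \<beta>) * Q
      \<le> (\<alpha> + \<beta> * (\<beta> - 2) + real DIM('a) * \<beta>) * (A powr (1 - 2 / \<beta>) * \<kappa> powr (2 / \<beta>) * T powr - (2 / q))"
    using alpha_gt_1 beta_gt_2 by (intro mult_left_mono) auto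
  also have "\<dots> < K * decay_exp * T powr - (2 / q)"
    using mult_strict_right_mono[OF K(1), of "T powr - (2 / q)"] T by (simp add: mult.assoc)
  finally have "\<tau> - (4 * r * F'' + 2 * real DIM('a) * F' r)
      + - (norm ((2 * F' r) *\<^sub>R (x - a)) powr q) < 0"
    using lap time unfolding \<tau>_def by (simp add: algebra_simps)
  thus ?thesis using jet by blast
qed

lemma continuous_on_upper_barrier:
  assumes "0 < d"
  shows "continuous_on (UNIV \<times> {t0..t1}) (upper_barrier A K a t0 d)"
proof -
  have 2: "(norm y)\<^sup>2 + 1 \<noteq> 0" for y :: "'b::real_normed_vector"
    using zero_le_power2[of "norm y"] by linarith
  show ?thesis
    unfolding upper_barrier_def smooth_kernel_def case_prod_beta
    using assms by (intro continuous_intros) (auto simp: 2)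
qed

section \<open>Quantitative spreading of positivity in unit time\<close>

definition spreading_barrier :: "real \<Rightarrow> real \<Rightarrow> real \<Rightarrow> real \<Rightarrow> 'a \<Rightarrow> real \<Rightarrow> 'a::euclidean_space \<times> real \<Rightarrow> real" where
  "spreading_barrier A \<Lambda> \<rho> R a t0 = (\<lambda>(x, t).
     A * exp (- \<Lambda> * (t - t0)) * (\<rho>\<^sup>2 + 4 * R\<^sup>2 * (t - t0) - (norm (x - a))\<^sup>2) ^ 3)"

text \<open>With p the bracket under the cube, the expression to be signed is at most E p
  (-\<Lambda> p^2 + D p - 24 r). Near the edge p = 0 the last term, from the second derivative of
  the cube, wins because r >= \<rho>^2 - p; for larger p the decay rate \<Lambda> wins. The odd
  power makes the barrier nonpositive outside its ball without truncation.\<close>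

lemma spreading_barrier_jet:
  fixes a :: "'a::euclidean_space" and \<rho> R :: real
  assumes "0 < \<rho>" "0 < R"
  shows "\<exists>\<Lambda> A0. 0 < \<Lambda> \<and> 0 < A0 \<and> (\<forall>A (a::'a) t0 x t. 0 < A \<longrightarrow> A \<le> A0 \<longrightarrow> t0 \<le> t \<longrightarrow> t \<le> t0 + 1 \<longrightarrow>
     0 < spreading_barrier A \<Lambda> \<rho> R a t0 (x, t) \<longrightarrow>
     (\<exists>\<tau> g l. has_jet (spreading_barrier A \<Lambda> \<rho> R a t0) x t \<tau> g l \<and> \<tau> - l + norm g powr q \<le> 0))"
proof -
  define Q where "Q = \<rho>\<^sup>2 + 4 * R\<^sup>2"
  have Q: "0 < Q" using assms by (simp add: Q_def add_pos_pos)
  \<comment> \<open>The summands stem from the expanding radius, from the Laplacian and from |g|^q,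
    in this order.\<close>
  define D where "D = 12 * R\<^sup>2 + 6 * real DIM('a) + 6 * sqrt Q"
  have D: "0 < D" using Q by (simp add: D_def add_nonneg_pos)
  \<comment> \<open>The discriminant of \<Lambda> p^2 - (D + 24) p + 24 \<rho>^2 vanishes for this
    value; the extra 24 comes from r >= \<rho>^2 - p.\<close>
  define \<Lambda> where "\<Lambda> = (D + 24)\<^sup>2 / (96 * \<rho>\<^sup>2)"
  have \<Lambda>: "0 < \<Lambda>" using D assms by (simp add: \<Lambda>_def)
  \<comment> \<open>Amplitudes up to \<open>A0\<close> keep the gradient norm at most 1, so its q-th
    power is at most the norm itself, which is linear in the amplitude.\<close>
  define A0 where "A0 = 1 / (6 * Q\<^sup>2 * sqrt Q)"
  have A0: "0 < A0" using Q by (simp add: A0_def)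
  have "\<exists>\<tau> g l. has_jet (spreading_barrier A \<Lambda> \<rho> R a t0) x t \<tau> g l \<and> \<tau> - l + norm g powr q \<le> 0"
    if A: "0 < A" "A \<le> A0" and t: "t0 \<le> t" "t \<le> t0 + 1"
      and pos: "0 < spreading_barrier A \<Lambda> \<rho> R a t0 (x, t)" for A t0 t and a x :: 'a
  proof -
    define r where "r = (norm (x - a))\<^sup>2"
    have r: "0 \<le> r" by (simp add: r_def)
    define E where "E = A * exp (- \<Lambda> * (t - t0))"
    have E: "0 < E" "E \<le> A" using A \<Lambda> t by (auto simp: E_def)
    define p where "p = \<rho>\<^sup>2 + 4 * R\<^sup>2 * (t - t0) - r"
    have "0 < E * p ^ 3"
      using pos unfolding spreading_barrier_def by (simp add: p_def r_def E_def)
    hence p: "0 < p" using E by (simp add: zero_less_mult_iff)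
    have "4 * R\<^sup>2 * (t - t0) \<le> 4 * R\<^sup>2 * 1" using t by (intro mult_left_mono) auto
    hence pQ: "p \<le> Q" "r \<le> Q" using p r by (auto simp: p_def Q_def)
    have "0 \<le> 4 * R\<^sup>2 * (t - t0)" using t by simp
    hence rp: "\<rho>\<^sup>2 - p \<le> r" by (simp add: p_def)
    define F' where "F' r = E * (- 3 * (\<rho>\<^sup>2 + 4 * R\<^sup>2 * (t - t0) - r)\<^sup>2)" for r
    define F'' where "F'' = E * (6 * p)"
    define \<tau> where "\<tau> = E * (- \<Lambda> * p ^ 3 + 12 * R\<^sup>2 * p\<^sup>2)"
    have "has_jet (\<lambda>(y, s). A * exp (- \<Lambda> * (s - t0)) * (\<rho>\<^sup>2 + 4 * R\<^sup>2 * (s - t0) - (norm (y - a))\<^sup>2) ^ 3)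
      x t \<tau> ((2 * F' ((norm (x - a))\<^sup>2)) *\<^sub>R (x - a))
     (4 * (norm (x - a))\<^sup>2 * F'' + 2 * real DIM('a) * F' ((norm (x - a))\<^sup>2))"
    proof (rule has_jet_radial[of "\<lambda>r s. A * exp (- \<Lambda> * (s - t0)) * (\<rho>\<^sup>2 + 4 * R\<^sup>2 * (s - t0) - r) ^ 3"])
      fix r :: real
      show "((\<lambda>r. A * exp (- \<Lambda> * (t - t0)) * (\<rho>\<^sup>2 + 4 * R\<^sup>2 * (t - t0) - r) ^ 3)
          has_real_derivative F' r) (at r)"
        unfolding F'_def E_def by (auto intro!: derivative_eq_intros)
    next
      show "(F' has_real_derivative F'') (at ((norm (x - a))\<^sup>2))"
        unfolding F'_def[abs_def] F''_def p_def r_def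
        by (auto intro!: derivative_eq_intros simp: algebra_simps)
    next
      show "((\<lambda>s. A * exp (- \<Lambda> * (s - t0)) * (\<rho>\<^sup>2 + 4 * R\<^sup>2 * (s - t0) - (norm (x - a))\<^sup>2) ^ 3)
          has_real_derivative \<tau>) (at t)"
        unfolding \<tau>_def E_def p_def r_def
        by (auto intro!: derivative_eq_intros simp: algebra_simps)
    qed
    hence jet: "has_jet (spreading_barrier A \<Lambda> \<rho> R a t0) x t \<tau> ((2 * F' r) *\<^sub>R (x - a))
       (4 * r * F'' + 2 * real DIM('a) * F' r)"
      by (simp add: spreading_barrier_def r_def)
    have F': "F' r = - 3 * E * p\<^sup>2" by (simp add: F'_def p_def)
    define G where "G = norm ((2 * F' r) *\<^sub>R (x - a))"
    have "G = E * p\<^sup>2 * (6 * sqrt r)"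
      unfolding G_def norm_scaleR F' using E by (simp add: r_def abs_mult)
    also have "\<dots> \<le> E * p\<^sup>2 * (6 * sqrt Q)"
      using E pQ by (intro mult_left_mono) auto
    finally have G: "G \<le> E * p\<^sup>2 * (6 * sqrt Q)" .
    also have "\<dots> \<le> A0 * Q\<^sup>2 * (6 * sqrt Q)"
      using E A A0 p pQ Q by (intro mult_right_mono mult_mono power_mono) auto
    also have "\<dots> = 1" using Q by (simp add: A0_def)
    finally have "G \<le> 1" .
    hence "G powr q \<le> G"
      using powr_mono'[of 1 q G] q_gt_1 by (simp add: G_def)
    hence grad: "G powr q \<le> E * p\<^sup>2 * (6 * sqrt Q)" using G by linarith
    have "\<tau> - (4 * r * F'' + 2 * real DIM('a) * F' r) + G powr q
        \<le> E * p * (- \<Lambda> * p\<^sup>2 + D * p - 24 * r)"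
      using grad unfolding \<tau>_def F''_def F' D_def
      by (simp add: algebra_simps power2_eq_square power3_eq_cube)
    also have "\<dots> \<le> E * p * (- (\<Lambda> * p\<^sup>2 - (D + 24) * p + 24 * \<rho>\<^sup>2))"
      using E p rp by (intro mult_left_mono) (auto simp: algebra_simps)
    also have "\<dots> \<le> 0"
    proof -
      have "\<Lambda> * p\<^sup>2 - (D + 24) * p + 24 * \<rho>\<^sup>2 = 24 * ((D + 24) * p / (48 * \<rho>) - \<rho>)\<^sup>2"
        using assms by (simp add: \<Lambda>_def power2_eq_square field_simps)
      hence "0 \<le> \<Lambda> * p\<^sup>2 - (D + 24) * p + 24 * \<rho>\<^sup>2" by simp
      thus ?thesis using E p by (simp add: mult_nonneg_nonpos)
    qed
    finally show ?thesis using jet unfolding G_def by blast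
  qed
  thus ?thesis using \<Lambda> A0 by blast
qed

text \<open>Comparison with \<open>spreading_barrier\<close> centred at a. The bound
  \<open>\<epsilon>\<close> depends on \<rho>, R and \<delta> alone and is fixed before v, a and t0;
  a contradiction argument at a late, unspecified time requires this uniformity.\<close>

lemma positivity_spreads:
  assumes "0 < \<rho>" "0 < R" "0 < \<delta>"
  obtains \<epsilon> where "0 < \<epsilon>" and
    "\<And>v (a::'a::euclidean_space) t0 x.
       continuous_on (UNIV \<times> {t0..t0 + 1}) v \<Longrightarrow>
       (\<And>y t. t0 < t \<Longrightarrow> t \<le> t0 + 1 \<Longrightarrow> \<exists>\<tau> g l. has_jet v y t \<tau> g l \<and> 0 \<le> \<tau> - l + norm g powr q) \<Longrightarrow>
       (\<And>y t. t \<in> {t0..t0 + 1} \<Longrightarrow> 0 \<le> v (y, t)) \<Longrightarrow> (\<And>y. y \<in> ball a \<rho> \<Longrightarrow> \<delta> \<le> v (y, t0)) \<Longrightarrow>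
       norm (x - a) \<le> R \<Longrightarrow> \<epsilon> \<le> v (x, t0 + 1)"
proof -
  obtain \<Lambda> A0 where \<Lambda>: "0 < \<Lambda>" and A0: "0 < A0"
    and jet: "\<And>A (a::'a) t0 x t. 0 < A \<Longrightarrow> A \<le> A0 \<Longrightarrow> t0 \<le> t \<Longrightarrow> t \<le> t0 + 1 \<Longrightarrow>
     0 < spreading_barrier A \<Lambda> \<rho> R a t0 (x, t) \<Longrightarrow>
     (\<exists>\<tau> g l. has_jet (spreading_barrier A \<Lambda> \<rho> R a t0) x t \<tau> g l \<and> \<tau> - l + norm g powr q \<le> 0)"
    using spreading_barrier_jet[OF assms(1,2), where 'a = 'a] by blast
  \<comment> \<open>The barrier starts at most at A \<rho>^6, which must not exceed
    \<delta>.\<close>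
  define A where "A = min A0 (\<delta> / \<rho> ^ 6)"
  have A: "0 < A" "A \<le> A0" "A * \<rho> ^ 6 \<le> \<delta>"
    using A0 assms by (auto simp: A_def min_def field_simps)
  \<comment> \<open>At time t0 + 1 and within distance R of a, the bracket is at least \<rho>^2 + 3
    R^2.\<close>
  define \<epsilon> where "\<epsilon> = A * exp (- \<Lambda>) * (\<rho>\<^sup>2 + 3 * R\<^sup>2) ^ 3"
  have pos: "0 < \<epsilon>" using A assms by (simp add: \<epsilon>_def add_pos_pos)
  have main: "\<epsilon> \<le> v (x, t0 + 1)"
    if cont: "continuous_on (UNIV \<times> {t0..t0 + 1}) v"
      and v: "\<And>y t. t0 < t \<Longrightarrow> t \<le> t0 + 1 \<Longrightarrow> (\<exists>\<tau> g l. has_jet v y t \<tau> g l \<and> 0 \<le> \<tau> - l + norm g powr q)"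
      and nonneg: "\<And>y t. t \<in> {t0..t0 + 1} \<Longrightarrow> 0 \<le> v (y, t)"
      and ball: "\<And>y. y \<in> ball a \<rho> \<Longrightarrow> \<delta> \<le> v (y, t0)" and x: "norm (x - a) \<le> R"
    for v t0 and a x :: 'a
  proof -
    define W where "W = spreading_barrier A \<Lambda> \<rho> R a t0"
    have "W (x, t0 + 1) \<le> v (x, t0 + 1)"
    proof (rule comparison[of t0 "t0 + 1" W v "A * (\<rho>\<^sup>2 + 4 * R\<^sup>2) ^ 3"])
      show "continuous_on (UNIV \<times> {t0..t0 + 1}) W"
        unfolding W_def spreading_barrier_def case_prod_beta by (intro continuous_intros)
    next
      fix y :: 'a
      show "W (y, t0) \<le> v (y, t0)"
      proof (cases "norm (y - a) < \<rho>")
        case True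
        have "(\<rho>\<^sup>2 - (norm (y - a))\<^sup>2) ^ 3 \<le> (\<rho>\<^sup>2) ^ 3"
          using True by (intro power_mono) (auto intro!: power_mono)
        hence "W (y, t0) \<le> A * \<rho> ^ 6"
          using A by (simp add: W_def spreading_barrier_def flip: power_mult)
        thus ?thesis using ball[of y] True A by (simp add: dist_norm norm_minus_commute)
      next
        case False
        hence "\<rho>\<^sup>2 \<le> (norm (y - a))\<^sup>2" using assms by (intro power_mono) auto
        hence "(\<rho>\<^sup>2 - (norm (y - a))\<^sup>2) ^ 3 \<le> 0" by (simp add: power_le_zero_eq)
        hence "W (y, t0) \<le> 0" using A by (simp add: W_def spreading_barrier_def mult_nonneg_nonpos)
        thus ?thesis using nonneg[of t0 y] by simp
      qed
    next
      fix y :: 'a and t assume t: "t0 \<le> t" "t \<le> t0 + 1"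
      show "- (A * (\<rho>\<^sup>2 + 4 * R\<^sup>2) ^ 3) \<le> v (y, t)"
        using nonneg[of t y] t A by (simp add: order.trans[of "- (A * (\<rho>\<^sup>2 + 4 * R\<^sup>2) ^ 3)" 0])
      have "4 * R\<^sup>2 * (t - t0) \<le> 4 * R\<^sup>2 * 1" using t by (intro mult_left_mono) auto
      hence "(\<rho>\<^sup>2 + 4 * R\<^sup>2 * (t - t0) - (norm (y - a))\<^sup>2) \<le> \<rho>\<^sup>2 + 4 * R\<^sup>2"
        using zero_le_power2[of "norm (y - a)"] by linarith
      hence "(\<rho>\<^sup>2 + 4 * R\<^sup>2 * (t - t0) - (norm (y - a))\<^sup>2) ^ 3 \<le> (\<rho>\<^sup>2 + 4 * R\<^sup>2) ^ 3"
        by (simp add: power_mono_odd)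
      hence "A * exp (- \<Lambda> * (t - t0)) * (\<rho>\<^sup>2 + 4 * R\<^sup>2 * (t - t0) - (norm (y - a))\<^sup>2) ^ 3
          \<le> A * exp (- \<Lambda> * (t - t0)) * (\<rho>\<^sup>2 + 4 * R\<^sup>2) ^ 3"
        using A by (intro mult_left_mono) auto
      also have "\<dots> \<le> A * 1 * (\<rho>\<^sup>2 + 4 * R\<^sup>2) ^ 3"
        using A \<Lambda> t by (intro mult_right_mono mult_left_mono) auto
      finally show "W (y, t) \<le> A * (\<rho>\<^sup>2 + 4 * R\<^sup>2) ^ 3"
        by (simp add: W_def spreading_barrier_def)
    next
      fix y :: 'a and t assume t: "t0 < t" "t \<le> t0 + 1" and "v (y, t) < W (y, t)"
      hence "0 < W (y, t)" using nonneg[of t y] by simp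
      thus "\<exists>\<tau> g l. has_jet W y t \<tau> g l \<and> \<tau> - l + norm g powr q \<le> 0"
        unfolding W_def using t A by (intro jet) auto
    qed (use cont v A in auto)
    moreover have "\<epsilon> \<le> W (x, t0 + 1)"
    proof -
      have "(norm (x - a))\<^sup>2 \<le> R\<^sup>2" using x by (intro power_mono) auto
      hence "(\<rho>\<^sup>2 + 3 * R\<^sup>2) ^ 3 \<le> (\<rho>\<^sup>2 + 4 * R\<^sup>2 - (norm (x - a))\<^sup>2) ^ 3"
        by (intro power_mono) auto
      thus ?thesis using A by (simp add: \<epsilon>_def W_def spreading_barrier_def)
    qed
    ultimately show ?thesis by linarith
  qed
  show ?thesis by (rule that[OF pos], rule main)
qed

end

section \<open>Large time behaviour of the solution\<close>

lemma in_C0_vanishes: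
  assumes "in_C0 v" "0 < e"
  shows "\<exists>R. \<forall>x. R \<le> norm x \<longrightarrow> \<bar>v x\<bar> \<le> e"
proof -
  have "((\<lambda>R. SUP x\<in>{x. R \<le> norm x}. ereal \<bar>v x\<bar>) \<longlongrightarrow> 0) at_top"
    using assms by (simp add: in_C0_def)
  hence "\<forall>\<^sub>F R in at_top. (SUP x\<in>{x. R \<le> norm x}. ereal \<bar>v x\<bar>) < ereal e"
    using assms by (intro order_tendstoD) auto
  then obtain R where R: "(SUP x\<in>{x. R \<le> norm x}. ereal \<bar>v x\<bar>) < ereal e"
    by (auto simp: eventually_at_top_linorder)
  have "\<bar>v x\<bar> \<le> e" if "R \<le> norm x" for x
  proof -
    have "ereal \<bar>v x\<bar> \<le> (SUP x\<in>{x. R \<le> norm x}. ereal \<bar>v x\<bar>)"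
      using that by (intro SUP_upper) auto
    hence "ereal \<bar>v x\<bar> < ereal e" using R by (rule order.strict_trans1)
    thus ?thesis by simp
  qed
  thus ?thesis by blast
qed

lemma in_C0_uniformly_continuous:
  fixes v :: "'a::euclidean_space \<Rightarrow> real"
  assumes "in_C0 v" "0 < e"
  shows "\<exists>\<rho>>0. \<forall>x y. norm (x - y) < \<rho> \<longrightarrow> \<bar>v x - v y\<bar> \<le> e"
proof -
  obtain R where R: "\<And>x. R \<le> norm x \<Longrightarrow> \<bar>v x\<bar> \<le> e / 2"
    using in_C0_vanishes[OF assms(1), of "e / 2"] assms(2) by auto
  have "continuous_on (cball 0 (\<bar>R\<bar> + 1)) v"
    using assms by (auto simp: in_C0_def intro: continuous_on_subset)
  hence "uniformly_continuous_on (cball 0 (\<bar>R\<bar> + 1)) v"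
    by (intro compact_uniformly_continuous) auto
  then obtain d where d: "d > 0"
    "\<And>x y. x \<in> cball 0 (\<bar>R\<bar> + 1) \<Longrightarrow> y \<in> cball 0 (\<bar>R\<bar> + 1) \<Longrightarrow> dist y x < d \<Longrightarrow> dist (v y) (v x) < e"
    using assms(2) unfolding uniformly_continuous_on_def by meson
  \<comment> \<open>The cutoff at distance 1 matches the enlarged radius: if one point lies outside
    the larger ball, both have norm at least R.\<close>
  have "\<bar>v x - v y\<bar> \<le> e" if xy: "norm (x - y) < min d 1" for x y
  proof (cases "norm x \<le> \<bar>R\<bar> + 1 \<and> norm y \<le> \<bar>R\<bar> + 1")
    case True
    thus ?thesis using d(2)[of y x] xy by (auto simp: dist_norm)
  next
    case False
    hence "R \<le> norm x" "R \<le> norm y"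
      using xy norm_triangle_ineq2[of x y] norm_triangle_ineq3[of x y] by auto
    thus ?thesis using R[of x] R[of y] by linarith
  qed
  thus ?thesis using d(1) by (intro exI[of _ "min d 1"]) auto
qed

lemma powr_neg_small:
  fixes p c e :: real
  assumes "0 < p" "0 < e"
  shows "\<forall>\<^sub>F d in at_top. c * d powr - p \<le> e"
proof -
  have "((\<lambda>d. c * d powr - p) \<longlongrightarrow> c * 0) at_top"
    by (intro tendsto_intros tendsto_neg_powr filterlim_ident) (use assms in simp)
  hence "\<forall>\<^sub>F d in at_top. c * d powr - p < e"
    using assms by (intro order_tendstoD) auto
  thus ?thesis by (rule eventually_mono) simp
qed

context hj_exponent
begin

lemma smooth_kernel_ge_kernel: "kernel x T \<le> smooth_kernel ((norm x)\<^sup>2) T"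
proof -
  have "norm x powr \<beta> = ((norm x)\<^sup>2) powr (\<beta> / 2)"
    using powr_powr[of "norm x" 2 "\<beta> / 2"] by simp
  also have "\<dots> \<le> ((norm x)\<^sup>2 + 1) powr (\<beta> / 2)"
    using beta_gt_2 by (intro powr_mono2) auto
  finally show ?thesis
    unfolding kernel_def smooth_kernel_def using kappa_pos
    by (intro mult_right_mono mult_left_mono) auto
qed

lemma smooth_kernel_mono:
  "0 \<le> r \<Longrightarrow> r \<le> r' \<Longrightarrow> smooth_kernel r T \<le> smooth_kernel r' T"
  unfolding smooth_kernel_def using kappa_pos beta_gt_2
  by (intro mult_right_mono mult_left_mono powr_mono2) auto

text \<open>The kernel decreases in time, so its growth at the latest time T gives one radius for
  all earlier times.\<close>

lemma kernel_coercive: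
  assumes "0 < T"
  shows "\<exists>R. \<forall>t x. 0 < t \<longrightarrow> t \<le> T \<longrightarrow> R \<le> norm x \<longrightarrow> B \<le> kernel (x::'a::euclidean_space) t"
proof -
  define R where "R = (\<bar>B\<bar> / (\<kappa> * T powr - \<alpha>)) powr (1 / \<beta>)"
  have c: "0 < \<kappa> * T powr - \<alpha>" using kappa_pos assms by simp
  have "B \<le> kernel x t" if t: "0 < t" "t \<le> T" and x: "R \<le> norm x" for t and x :: 'a
  proof -
    have "R powr \<beta> \<le> norm x powr \<beta>"
      using x beta_gt_2 by (intro powr_mono2) (auto simp: R_def)
    moreover have "R powr \<beta> = \<bar>B\<bar> / (\<kappa> * T powr - \<alpha>)"
      using beta_gt_2 c by (simp add: R_def powr_powr)
    ultimately have "\<bar>B\<bar> \<le> norm x powr \<beta> * (\<kappa> * T powr - \<alpha>)"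
      using c by (simp only: pos_divide_le_eq)
    hence "\<bar>B\<bar> \<le> kernel x T" by (simp add: kernel_def mult_ac)
    also have "\<dots> \<le> kernel x t" by (rule kernel_antimono[OF t])
    finally show ?thesis by linarith
  qed
  thus ?thesis by blast
qed

end

section \<open>Estimates for a bounded nonpositive solution\<close>

locale hj_solution = hj_exponent +
  fixes u0 :: "'a::euclidean_space \<Rightarrow> real" and u :: "'a \<times> real \<Rightarrow> real" and B :: real
  assumes sol: "classical_solution q u0 u"
    and u0_C0: "in_C0 u0"
    and nonpos: "\<And>x t. 0 \<le> t \<Longrightarrow> u (x, t) \<le> 0"
    and lower: "\<And>x t. 0 \<le> t \<Longrightarrow> - B \<le> u (x, t)"
begin

lemma continuous_on_u: "0 \<le> t0 \<Longrightarrow> continuous_on (UNIV \<times> {t0..t1}) u"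
  using sol by (auto simp: classical_solution_def intro: continuous_on_subset)

lemma u_initial: "u (x, 0) = u0 x"
  using sol by (simp add: classical_solution_def)

lemma B_nonneg: "0 \<le> B"
  using lower[of 0 0] nonpos[of 0 0] by linarith

lemma u_jet: "0 < t \<Longrightarrow> \<exists>\<tau> g l. has_jet u x t \<tau> g l \<and> \<tau> - l + norm g powr q = 0"
  by (rule classical_solution_jet[OF sol])

text \<open>The equation is invariant under translations in space and under adding constants, so the
  shifted function is again a solution and \<open>comparison\<close> applies.\<close>

lemma shift_invariant_bound:
  assumes init: "\<And>x. u0 (x + h) - c \<le> u0 x" and t: "0 \<le> t"
  shows "u (x + h, t) - c \<le> u (x, t)"
proof -
  define W where "W = (\<lambda>(y, s). u (y + h, s) - c)"
  have "W (x, t) \<le> u (x, t)"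
  proof (rule comparison[of 0 t W u "B + \<bar>c\<bar>"])
    have "continuous_on (UNIV \<times> {0..t}) (\<lambda>p. u (fst p + h, snd p))"
      by (rule continuous_on_compose2[OF continuous_on_u[of 0 t]])
         (auto intro!: continuous_intros)
    thus "continuous_on (UNIV \<times> {0..t}) W"
      unfolding W_def case_prod_beta by (intro continuous_intros)
    show "continuous_on (UNIV \<times> {0..t}) u" by (rule continuous_on_u) simp
    show "W (y, 0) \<le> u (y, 0)" for y using init[of y] by (simp add: W_def u_initial)
    show "0 \<le> B + \<bar>c\<bar>" using B_nonneg by simp
    fix y :: 'a and s :: real assume s: "0 \<le> s" "s \<le> t"
    show "W (y, s) \<le> B + \<bar>c\<bar>" using nonpos[OF s(1), of "y + h"] B_nonneg by (simp add: W_def)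
    show "- (B + \<bar>c\<bar>) \<le> u (y, s)" using lower[OF s(1), of y] by simp
  next
    fix y :: 'a and s :: real assume s: "0 < s" "s \<le> t"
    show "\<exists>\<tau> g l. has_jet u y s \<tau> g l \<and> 0 \<le> \<tau> - l + norm g powr q"
      using u_jet[OF s(1), of y] by force
    show "\<exists>\<tau> g l. has_jet W y s \<tau> g l \<and> \<tau> - l + norm g powr q \<le> 0"
      using u_jet[OF s(1), of "y + h"] has_jet_translate[of u y h s] unfolding W_def by force
  qed (use t in auto)
  thus ?thesis by (simp add: W_def)
qed

lemma equicontinuous:
  assumes "0 < e"
  shows "\<exists>\<rho>>0. \<forall>t\<ge>0. \<forall>x y. norm (x - y) < \<rho> \<longrightarrow> u (x, t) - e \<le> u (y, t)"
proof -
  obtain \<rho> where \<rho>: "\<rho> > 0" "\<And>x y. norm (x - y) < \<rho> \<Longrightarrow> \<bar>u0 x - u0 y\<bar> \<le> e"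
    using in_C0_uniformly_continuous[OF u0_C0 assms] by blast
  have "u (x, t) - e \<le> u (y, t)" if "0 \<le> t" "norm (x - y) < \<rho>" for x y t
  proof -
    have "u (y + (x - y), t) - e \<le> u (y, t)"
    proof (rule shift_invariant_bound[OF _ that(1)])
      show "u0 (z + (x - y)) - e \<le> u0 z" for z
        using \<rho>(2)[of "z + (x - y)" z] that by simp
    qed
    thus ?thesis by simp
  qed
  thus ?thesis using \<rho>(1) by blast
qed

text \<open>The loss 3 e has three sources: the gap ln 2 / k of the soft minimum, the total
  correction and the initial downward shift. A large d flattens the kernel to at most e on the ball
  of radius |R|, so the barrier starts below -A there; outside that ball the shift alone
  suffices.\<close>

lemma lower_bound:
  assumes t0: "0 \<le> t0" and "0 < e" "0 < A" and A: "\<And>x. - A \<le> u (x, t0)"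
    and far: "\<And>x. R \<le> norm x \<Longrightarrow> - e \<le> u (x, t0)"
  shows "\<exists>d>0. \<forall>t\<ge>t0. \<forall>x. min 0 (kernel x (t - t0 + d) - A) - 3 * e \<le> u (x, t)"
proof -
  define k where "k = ln 2 / e"
  have k: "0 < k" "ln 2 / k = e" using assms by (auto simp: k_def)
  obtain C where C: "C \<ge> 0" "\<And>g. 0 \<le> g \<Longrightarrow> softmin' k A g * (\<alpha> * g) powr (2 / q) \<le> C"
    using softmin'_moment_bounded[OF k(1), of A] by blast
  define K where "K = k * C / decay_exp"
  have K: "0 \<le> K" using k C decay_exp_pos by (simp add: K_def)
  have "\<forall>\<^sub>F d in at_top. K * d powr - decay_exp \<le> e"
    by (rule powr_neg_small[OF decay_exp_pos \<open>0 < e\<close>])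
  moreover have "\<forall>\<^sub>F d in at_top. (\<kappa> * ((\<bar>R\<bar>)\<^sup>2 + 1) powr (\<beta> / 2)) * d powr - \<alpha> \<le> e"
    using alpha_gt_1 \<open>0 < e\<close> by (intro powr_neg_small) auto
  ultimately have "\<forall>\<^sub>F d in at_top. K * d powr - decay_exp \<le> e \<and>
      smooth_kernel ((\<bar>R\<bar>)\<^sup>2) d \<le> e \<and> 0 < d"
    using eventually_gt_at_top[of 0] unfolding smooth_kernel_def by eventually_elim auto
  then obtain d where d: "K * d powr - decay_exp \<le> e" "smooth_kernel ((\<bar>R\<bar>)\<^sup>2) d \<le> e" "0 < d"
    by (auto simp: eventually_at_top_linorder)
  define W where "W = (lower_barrier k A K e t0 d :: 'a \<times> real \<Rightarrow> real)"
  have "min 0 (kernel x (t - t0 + d) - A) - 3 * e \<le> u (x, t)" if t: "t0 \<le> t" for t x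
  proof -
    have "W (x, t) \<le> u (x, t)"
    proof (rule comparison[of t0 t W u B])
      show "continuous_on (UNIV \<times> {t0..t}) W"
        unfolding W_def by (rule continuous_on_lower_barrier[OF k(1) d(3)])
      show "continuous_on (UNIV \<times> {t0..t}) u" by (rule continuous_on_u[OF t0])
      show "W (y, t0) \<le> u (y, t0)" for y
      proof (cases "norm y \<le> \<bar>R\<bar>")
        case True
        have "W (y, t0) \<le> smooth_kernel ((norm y)\<^sup>2) d - A - e"
          using softmin_le[OF k(1), of A "smooth_kernel ((norm y)\<^sup>2) d"]
          by (simp add: W_def lower_barrier_def)
        moreover have "smooth_kernel ((norm y)\<^sup>2) d \<le> smooth_kernel ((\<bar>R\<bar>)\<^sup>2) d"
          using True by (intro smooth_kernel_mono power_mono) auto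
        ultimately show ?thesis using A[of y] d(2) by linarith
      next
        case False
        have "W (y, t0) \<le> - e"
          using softmin_le[OF k(1), of A "smooth_kernel ((norm y)\<^sup>2) d"]
          by (simp add: W_def lower_barrier_def)
        thus ?thesis using far[of y] False by linarith
      qed
      show "0 \<le> B" by (rule B_nonneg)
      fix y :: 'a and s :: real assume s: "t0 \<le> s" "s \<le> t"
      have "(s - t0 + d) powr - decay_exp \<le> d powr - decay_exp"
        using decay_exp_pos d s by (intro powr_mono2') auto
      hence "K * ((s - t0 + d) powr - decay_exp - d powr - decay_exp) \<le> 0"
        using K by (simp add: mult_nonneg_nonpos)
      thus "W (y, s) \<le> B"
        using softmin_le[OF k(1), of A "smooth_kernel ((norm y)\<^sup>2) (s - t0 + d)"] B_nonneg \<open>0 < e\<close>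
        by (simp add: W_def lower_barrier_def)
      show "- B \<le> u (y, s)" using lower[of s y] s t0 by simp
    next
      fix y :: 'a and s :: real assume s: "t0 < s" "s \<le> t"
      show "\<exists>\<tau> g l. has_jet u y s \<tau> g l \<and> 0 \<le> \<tau> - l + norm g powr q"
        using u_jet[of s y] s t0 by force
      show "\<exists>\<tau> g l. has_jet W y s \<tau> g l \<and> \<tau> - l + norm g powr q \<le> 0"
        unfolding W_def
      proof (rule lower_barrier_jet[OF k(1)])
        fix g :: real assume "0 \<le> g"
        from C(2)[OF this] show "k * (softmin' k A g * (\<alpha> * g) powr (2 / q)) \<le> K * decay_exp"
          using k decay_exp_pos by (simp add: K_def)
      qed (use s d in auto)
    qed (use t in auto)
    moreover have "min 0 (kernel x (t - t0 + d) - A) \<le> min 0 (smooth_kernel ((norm x)\<^sup>2) (t - t0 + d) - A)"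
      using smooth_kernel_ge_kernel[of x "t - t0 + d"] by simp
    moreover have "min 0 (smooth_kernel ((norm x)\<^sup>2) (t - t0 + d) - A) - e
        \<le> softmin k A (smooth_kernel ((norm x)\<^sup>2) (t - t0 + d))"
      using softmin_ge[OF k(1), of "smooth_kernel ((norm x)\<^sup>2) (t - t0 + d)" A] k(2) by simp
    moreover have "0 \<le> K * (t - t0 + d) powr - decay_exp" using K by simp
    ultimately show ?thesis
      using d(1) unfolding W_def lower_barrier_def by (simp add: right_diff_distrib)
  qed
  thus ?thesis using d(3) by blast
qed

text \<open>\<open>lower_bound\<close> from time 0 places u(t) above a profile that equals -e far
  out, where the kernel exceeds the depth B + 1. This provides the hypothesis \<open>far\<close>
  when \<open>lower_bound\<close> is restarted at a later time; the summand 1 keeps the depth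
  positive.\<close>

lemma vanishes_at_infinity:
  assumes "0 \<le> t" "0 < e"
  shows "\<exists>R. \<forall>x. R \<le> norm x \<longrightarrow> - e \<le> u (x, t)"
proof -
  obtain R0 where R0: "\<And>x. R0 \<le> norm x \<Longrightarrow> \<bar>u0 x\<bar> \<le> e / 3"
    using in_C0_vanishes[OF u0_C0, of "e / 3"] assms by auto
  have "\<exists>d>0. \<forall>t\<ge>0. \<forall>x. min 0 (kernel x (t - 0 + d) - (B + 1)) - 3 * (e / 3) \<le> u (x, t)"
  proof (rule lower_bound[where R = R0])
    show "- (B + 1) \<le> u (x, 0)" for x using lower[of 0 x] by simp
    show "- (e / 3) \<le> u (x, 0)" if "R0 \<le> norm x" for x using R0[OF that] by (simp add: u_initial)
  qed (use assms B_nonneg in auto)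
  then obtain d where d: "0 < d"
    "\<And>x. min 0 (kernel x (t + d) - (B + 1)) - e \<le> u (x, t)"
    using assms(1) by auto
  have "0 < t + d" using d(1) assms(1) by simp
  then obtain R where "\<And>x::'a. R \<le> norm x \<Longrightarrow> B + 1 \<le> kernel x (t + d)"
    using kernel_coercive[of "t + d" "B + 1", where 'a = 'a] by blast
  hence "- e \<le> u (x, t)" if "R \<le> norm x" for x using d(2)[of x] that by force
  thus ?thesis by blast
qed

lemma hole:
  assumes floor: "\<And>e. 0 < e \<Longrightarrow> \<forall>\<^sub>F t in at_top. \<forall>x. - (M + e) \<le> u (x, t)"
    and reached: "\<And>e. 0 < e \<Longrightarrow> \<forall>\<^sub>F t in at_top. \<exists>x. u (x, t) \<le> - M + e"
    and "0 < e" "0 < R"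
  shows "\<exists>t0\<ge>0. \<exists>x0. \<forall>y\<in>ball x0 R. u (y, t0) \<le> - M + e"
proof -
  obtain \<rho> where \<rho>: "\<rho> > 0"
    "\<And>t x y. 0 \<le> t \<Longrightarrow> norm (x - y) < \<rho> \<Longrightarrow> u (x, t) - e / 2 \<le> u (y, t)"
    using equicontinuous[of "e / 2"] \<open>0 < e\<close> by auto
  show ?thesis
  proof (rule positivity_spreads[OF \<rho>(1) \<open>0 < R\<close> half_gt_zero[OF \<open>0 < e\<close>]])
    fix \<epsilon> :: real
    assume \<epsilon>: "0 < \<epsilon>" and spread: "\<And>v (a::'a) t0 x.
       continuous_on (UNIV \<times> {t0..t0 + 1}) v \<Longrightarrow>
       (\<And>y t. t0 < t \<Longrightarrow> t \<le> t0 + 1 \<Longrightarrow> \<exists>\<tau> g l. has_jet v y t \<tau> g l \<and> 0 \<le> \<tau> - l + norm g powr q) \<Longrightarrow>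
       (\<And>y t. t \<in> {t0..t0 + 1} \<Longrightarrow> 0 \<le> v (y, t)) \<Longrightarrow> (\<And>y. y \<in> ball a \<rho> \<Longrightarrow> e / 2 \<le> v (y, t0)) \<Longrightarrow>
       norm (x - a) \<le> R \<Longrightarrow> \<epsilon> \<le> v (x, t0 + 1)"
    \<comment> \<open>v = u + M + \<eta> will be nonnegative on the unit time interval and at most 2
      \<eta> at (x0, t0 + 1), below the threshold \<open>\<epsilon>\<close>.\<close>
    define \<eta> where "\<eta> = \<epsilon> / 3"
    have \<eta>: "0 < \<eta>" "2 * \<eta> < \<epsilon>" using \<epsilon> by (auto simp: \<eta>_def)
    obtain t1 where t1: "\<And>t x. t1 \<le> t \<Longrightarrow> - (M + \<eta>) \<le> u (x, t)"
      using floor[OF \<eta>(1)] by (auto simp: eventually_at_top_linorder)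
    obtain t2 where t2: "\<And>t. t2 \<le> t \<Longrightarrow> \<exists>x. u (x, t) \<le> - M + \<eta>"
      using reached[OF \<eta>(1)] by (auto simp: eventually_at_top_linorder)
    define t0 where "t0 = Max {0, t1, t2}"
    have t0: "0 \<le> t0" "t1 \<le> t0" "t2 \<le> t0" by (auto simp: t0_def)
    obtain x0 where x0: "u (x0, t0 + 1) \<le> - M + \<eta>" using t2[of "t0 + 1"] t0 by auto
    \<comment> \<open>A point y violating the claim gives, by equicontinuity, v >= e/2 on the ball
      of radius \<rho> around y. Positivity then spreads from y to x0, which is within distance R,
      against the choice of x0.\<close>
    have "u (y, t0) \<le> - M + e" if y: "y \<in> ball x0 R" for y
    proof (rule ccontr)
      assume big: "\<not> u (y, t0) \<le> - M + e"
      define v where "v = (\<lambda>(x, t). u (x + 0, t) - (- (M + \<eta>)))"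
      have "\<epsilon> \<le> v (x0, t0 + 1)"
      proof (rule spread[of t0 v y x0])
        show "continuous_on (UNIV \<times> {t0..t0 + 1}) v"
          unfolding v_def case_prod_beta using continuous_on_u[OF t0(1), of "t0 + 1"]
          by (auto intro!: continuous_intros)
        show "\<exists>\<tau> g l. has_jet v z t \<tau> g l \<and> 0 \<le> \<tau> - l + norm g powr q" if "t0 < t" for z t
          using u_jet[of t z] has_jet_translate[of u z 0 t _ _ _ "- (M + \<eta>)"] that t0(1)
          unfolding v_def by force
        show "0 \<le> v (z, t)" if "t \<in> {t0..t0 + 1}" for z t
          using t1[of t z] that t0 by (simp add: v_def)
        show "e / 2 \<le> v (z, t0)" if "z \<in> ball y \<rho>" for z
          using \<rho>(2)[OF t0(1), of y z] that big \<eta> by (simp add: v_def dist_norm)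
        show "norm (x0 - y) \<le> R" using y by (simp add: dist_norm)
      qed
      thus False using x0 \<eta> by (simp add: v_def)
    qed
    thus ?thesis using t0(1) by blast
  qed
qed

text \<open>The order of choices avoids circularity: A = M - e fixes K, K fixes the age d that keeps
  the total correction below e, d fixes the radius R where the kernel reaches A, and only then does
  \<open>hole\<close> provide t0 and x0. The loss is e from A and e from the correction.\<close>

lemma upper_bound:
  assumes floor: "\<And>e. 0 < e \<Longrightarrow> \<forall>\<^sub>F t in at_top. \<forall>x. - (M + e) \<le> u (x, t)"
    and reached: "\<And>e. 0 < e \<Longrightarrow> \<forall>\<^sub>F t in at_top. \<exists>x. u (x, t) \<le> - M + e"
    and e: "0 < e" "e < M"
  shows "\<exists>t0\<ge>0. \<exists>x0. \<exists>d>0. \<forall>t\<ge>t0. \<forall>x.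
           u (x, t) \<le> - M + 2 * e + smooth_kernel ((norm (x - x0))\<^sup>2) (t - t0 + d)"
proof -
  define A where "A = M - e"
  have A: "0 < A" using e by (simp add: A_def)
  define C where "C = (\<alpha> + \<beta> * (\<beta> - 2) + real DIM('a) * \<beta>) * (A powr (1 - 2 / \<beta>) * \<kappa> powr (2 / \<beta>))"
  have "0 \<le> C" using alpha_gt_1 beta_gt_2 by (simp add: C_def)
  define K where "K = (C + 1) / decay_exp"
  have K: "0 \<le> K" "C < K * decay_exp" using decay_exp_pos \<open>0 \<le> C\<close> by (auto simp: K_def)
  have "\<forall>\<^sub>F d in at_top. K * d powr - decay_exp \<le> e \<and> 1 \<le> d"
    using powr_neg_small[OF decay_exp_pos e(1), of K] eventually_ge_at_top[of 1]
    by eventually_elim auto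
  then obtain d where d: "K * d powr - decay_exp \<le> e" "1 \<le> d"
    by (auto simp: eventually_at_top_linorder)
  have coercive: "\<exists>R>0. \<forall>t x. 0 < t \<longrightarrow> t \<le> T \<longrightarrow> R \<le> norm (x::'a) \<longrightarrow> A \<le> smooth_kernel ((norm x)\<^sup>2) t"
    if T: "0 < T" for T
  proof -
    obtain R where "\<And>t (x::'a). 0 < t \<Longrightarrow> t \<le> T \<Longrightarrow> R \<le> norm x \<Longrightarrow> A \<le> kernel x t"
      using kernel_coercive[OF T, of A, where 'a = 'a] by blast
    thus ?thesis
      by (intro exI[of _ "max R 1"]) (auto intro: order.trans[OF _ smooth_kernel_ge_kernel])
  qed
  obtain R where R: "R > 0" "\<And>x::'a. R \<le> norm x \<Longrightarrow> A \<le> smooth_kernel ((norm x)\<^sup>2) d"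
    using coercive[of d] d(2) by force
  obtain t0 x0 where t0: "0 \<le> t0" and x0: "\<And>y. y \<in> ball x0 R \<Longrightarrow> u (y, t0) \<le> - M + e"
    using hole[of M e R] floor reached e R(1) by blast
  define W where "W = upper_barrier A K x0 t0 d"
  have "u (x, t) \<le> - M + 2 * e + smooth_kernel ((norm (x - x0))\<^sup>2) (t - t0 + d)" if t: "t0 \<le> t" for t x
  proof -
    obtain R' where R': "R' > 0" "\<And>s (x::'a). 0 < s \<Longrightarrow> s \<le> t - t0 + d \<Longrightarrow> R' \<le> norm x \<Longrightarrow>
        A \<le> smooth_kernel ((norm x)\<^sup>2) s"
      using coercive[of "t - t0 + d"] d(2) t by auto
    have W_le: "W (y, s) \<le> A - smooth_kernel ((norm (y - x0))\<^sup>2) (s - t0 + d)" if "t0 \<le> s" for y s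
    proof -
      have "(s - t0 + d) powr - decay_exp \<le> d powr - decay_exp"
        using decay_exp_pos d that by (intro powr_mono2') auto
      hence "K * ((s - t0 + d) powr - decay_exp - d powr - decay_exp) \<le> 0"
        using K by (simp add: mult_nonneg_nonpos)
      thus ?thesis by (simp add: W_def upper_barrier_def)
    qed
    have "W (x, t) \<le> - u (x, t)"
    proof (rule comparison_strict[of t0 t W "\<lambda>p. - u p" "norm x0 + R'" "\<lambda>g. - (norm g powr q)"])
      show "continuous_on (UNIV \<times> {t0..t}) W"
        unfolding W_def using d(2) by (intro continuous_on_upper_barrier) auto
      show "continuous_on (UNIV \<times> {t0..t}) (\<lambda>p. - u p)"
        by (intro continuous_intros continuous_on_u[OF t0])
      \<comment> \<open>Inside the ball W is at most A = M - e, and -u is at least that; outside,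
        the kernel has reached A, so W is nonpositive while -u is nonnegative.\<close>
      show "W (y, t0) \<le> - u (y, t0)" for y
      proof (cases "norm (y - x0) < R")
        case True
        thus ?thesis using x0[of y] W_le[of t0 y] smooth_kernel_nonneg(1)[of "(norm (y - x0))\<^sup>2" d]
          by (simp add: A_def dist_norm norm_minus_commute)
      next
        case False
        thus ?thesis using R(2)[of "y - x0"] W_le[of t0 y] nonpos[OF t0, of y] by simp
      qed
    next
      fix y :: 'a and s assume y: "norm x0 + R' \<le> norm y" and s: "t0 \<le> s" "s \<le> t"
      have "R' \<le> norm (y - x0)" using y norm_triangle_ineq2[of y x0] by linarith
      hence "A \<le> smooth_kernel ((norm (y - x0))\<^sup>2) (s - t0 + d)"
        using s d(2) by (intro R') auto
      thus "W (y, s) \<le> - u (y, s)" using W_le[OF s(1), of y] nonpos[of s y] s t0 by simp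
    next
      fix y :: 'a and s assume s: "t0 < s" "s \<le> t"
      obtain \<tau> g l where "has_jet u y s \<tau> g l" "\<tau> - l + norm g powr q = 0"
        using u_jet[of s y] s t0 by force
      thus "\<exists>\<tau> g l. has_jet (\<lambda>p. - u p) y s \<tau> g l \<and> 0 \<le> \<tau> - l + - (norm g powr q)"
        using has_jet_uminus[of u y s \<tau> g l]
        by (intro exI[of _ "- \<tau>"] exI[of _ "- g"] exI[of _ "- l"]) simp
      assume "- u (y, s) < W (y, s)"
      hence "0 < W (y, s)" using nonpos[of s y] s t0 by simp
      thus "\<exists>\<tau> g l. has_jet W y s \<tau> g l \<and> \<tau> - l + - (norm g powr q) < 0"
        unfolding W_def using s d(2) K by (intro upper_barrier_jet) (auto simp: C_def)
    qed (use t in auto)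
    moreover have "0 \<le> K * (t - t0 + d) powr - decay_exp" using K by simp
    ultimately show ?thesis
      using d(1) unfolding W_def upper_barrier_def by (simp add: right_diff_distrib A_def)
  qed
  thus ?thesis using t0 d(2) by (meson less_le_trans zero_less_one)
qed

end

section \<open>Self-similarity and the limit in time\<close>

lemma tendsto_time_shift_ratio: "((\<lambda>t::real. (t / (t + s)) powr a) \<longlongrightarrow> 1) at_top"
proof -
  have "((\<lambda>t. 1 / (1 + s / t)) \<longlongrightarrow> 1 / (1 + 0)) at_top"
    by (intro tendsto_intros tendsto_divide_0[OF tendsto_const] filterlim_at_top_imp_at_infinity
        filterlim_ident) auto
  moreover have "\<forall>\<^sub>F t in at_top. 1 / (1 + s / t) = t / (t + s)"
    using eventually_gt_at_top[of 0] by eventually_elim (simp add: divide_simps)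
  ultimately have "((\<lambda>t. t / (t + s)) \<longlongrightarrow> 1 / (1 + 0)) at_top"
    by (rule Lim_transform_eventually)
  from tendsto_powr[OF this tendsto_const, of a] show ?thesis by simp
qed

context hj_exponent
begin

lemma kernel_time_shift:
  "0 < t \<Longrightarrow> 0 < T \<Longrightarrow> kernel x T = kernel x t * (t / T) powr \<alpha>"
  by (simp add: kernel_def powr_divide powr_minus_divide)

text \<open>In the variable |x| / t^(1/q), the centre x0 and the smoothing together cost a
  displacement of (|x0| + 1) t^(-1/q), and the age costs a factor (t / T)^\<alpha>. Both effects
  vanish as t grows with T - t fixed.\<close>

lemma smooth_kernel_self_similar:
  assumes "0 < t" "0 < T"
  shows "smooth_kernel ((norm (x - x0))\<^sup>2) T
    \<le> \<kappa> * (norm x / t powr (1 / q) + (norm x0 + 1) * t powr - (1 / q)) powr \<beta> * (t / T) powr \<alpha>"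
proof -
  have "norm (x - x0) \<le> norm x + norm x0" by (rule norm_triangle_ineq4)
  hence "(norm (x - x0))\<^sup>2 \<le> (norm x + norm x0)\<^sup>2" by (intro power_mono) auto
  moreover have eq: "(norm x + (norm x0 + 1))\<^sup>2 = (norm x + norm x0)\<^sup>2 + 2 * (norm x + norm x0) + 1"
    by (simp add: power2_eq_square algebra_simps)
  ultimately have "(norm (x - x0))\<^sup>2 + 1 \<le> (norm x + (norm x0 + 1))\<^sup>2"
    by (simp only: eq) (simp add: add_increasing2)
  hence "((norm (x - x0))\<^sup>2 + 1) powr (\<beta> / 2) \<le> ((norm x + (norm x0 + 1))\<^sup>2) powr (\<beta> / 2)"
    using beta_gt_2 by (intro powr_mono2) auto
  also have "\<dots> = (norm x + (norm x0 + 1)) powr \<beta>"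
    using powr_powr[of "norm x + (norm x0 + 1)" 2 "\<beta> / 2"] by simp
  also have "norm x + (norm x0 + 1)
      = (norm x / t powr (1 / q) + (norm x0 + 1) * t powr - (1 / q)) * t powr (1 / q)"
    using assms by (simp add: powr_minus field_simps)
  also have "\<dots> powr \<beta> = (norm x / t powr (1 / q) + (norm x0 + 1) * t powr - (1 / q)) powr \<beta> * t powr \<alpha>"
    unfolding powr_mult powr_powr using q_gt_1 by (simp flip: alpha_q)
  finally have "\<kappa> * ((norm (x - x0))\<^sup>2 + 1) powr (\<beta> / 2) * T powr - \<alpha>
    \<le> \<kappa> * ((norm x / t powr (1 / q) + (norm x0 + 1) * t powr - (1 / q)) powr \<beta> * t powr \<alpha>) * T powr - \<alpha>"
    using kappa_pos by (intro mult_right_mono mult_left_mono) auto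
  moreover have "(t / T) powr \<alpha> = t powr \<alpha> * T powr - \<alpha>"
    by (simp add: powr_divide powr_minus_divide)
  ultimately show ?thesis by (simp only: smooth_kernel_def mult.assoc)
qed

lemma kernel_self_similar:
  "kernel x t = \<kappa> * (norm x / t powr (1 / q)) powr \<beta>"
proof -
  have "1 / q * \<beta> = \<alpha>" using q_gt_1 by (simp flip: alpha_q)
  thus ?thesis unfolding kernel_def powr_divide powr_powr by (simp add: powr_minus_divide)
qed

lemma continuous_on_Z_profile: "continuous_on space_time (Z_profile q m)"
proof -
  have "continuous_on space_time (\<lambda>p :: 'a::euclidean_space \<times> real. min 0 (kernel (fst p) (snd p) - m))"
    by (intro continuous_intros) auto
  thus ?thesis
    by (rule continuous_on_eq) (auto simp: Z_profile_kernel)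
qed

end

context hj_solution
begin

lemma above_profile:
  assumes floor: "\<And>e. 0 < e \<Longrightarrow> \<forall>\<^sub>F t in at_top. \<forall>x. - (M + e) \<le> u (x, t)"
    and e: "0 < e" "0 < M"
  shows "\<forall>\<^sub>F t in at_top. \<forall>x. Z_profile q M (x, t) - 5 * e \<le> u (x, t)"
proof -
  obtain t1 where "\<And>t x. t1 \<le> t \<Longrightarrow> - (M + e) \<le> u (x, t)"
    using floor[OF e(1)] by (auto simp: eventually_at_top_linorder)
  then obtain t0 where t0: "0 \<le> t0" "\<And>x. - (M + e) \<le> u (x, t0)"
    by (meson max.cobounded1 max.cobounded2)
  obtain R where R: "\<And>x. R \<le> norm x \<Longrightarrow> - e \<le> u (x, t0)"
    using vanishes_at_infinity[OF t0(1) e(1)] by blast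
  obtain d where d: "d > 0"
    "\<And>t x. t0 \<le> t \<Longrightarrow> min 0 (kernel x (t - t0 + d) - (M + e)) - 3 * e \<le> u (x, t)"
    using lower_bound[OF t0(1) e(1) _ t0(2) R] e by (force simp: add_pos_pos)
  have "\<forall>\<^sub>F t in at_top. 1 - e / M < (t / (t + (d - t0))) powr \<alpha>"
    using e by (intro order_tendstoD(1)[OF tendsto_time_shift_ratio]) auto
  thus ?thesis
    using eventually_gt_at_top[of t0]
  proof eventually_elim
    case (elim t)
    show ?case
    proof
      fix x :: 'a
      define \<theta> where "\<theta> = (t / (t - t0 + d)) powr \<alpha>"
      have \<theta>: "1 - e / M \<le> \<theta>" "0 \<le> \<theta>" using elim(1) by (auto simp: \<theta>_def algebra_simps)
      have t: "0 < t" "0 < t - t0 + d" using elim(2) t0(1) d(1) by auto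
      have K: "kernel x (t - t0 + d) = kernel x t * \<theta>"
        unfolding \<theta>_def by (rule kernel_time_shift[OF t])
      \<comment> \<open>\<open>\<theta>\<close> introduces a relative error. Where the kernel is at
        most M this costs at most e; where it exceeds M, the product is still at least M - e.
        Another e comes from the depth M + e.\<close>
      have "min 0 (kernel x t - M) - 2 * e \<le> min 0 (kernel x t * \<theta> - (M + e))"
      proof (cases "kernel x t \<le> M")
        case True
        have "kernel x t * (1 - e / M) \<le> kernel x t * \<theta>"
          using \<theta> kernel_nonneg by (intro mult_left_mono) auto
        moreover have "kernel x t * (e / M) \<le> M * (e / M)"
          using True e by (intro mult_right_mono) auto
        ultimately have "kernel x t - e \<le> kernel x t * \<theta>" using e by (simp add: right_diff_distrib)
        thus ?thesis using True e by (auto simp: min_def)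
      next
        case False
        have "M - e \<le> M * \<theta>" using mult_left_mono[OF \<theta>(1), of M] e by (simp add: right_diff_distrib)
        also have "\<dots> \<le> kernel x t * \<theta>" using False \<theta> by (intro mult_right_mono) auto
        finally show ?thesis using False e by (auto simp: min_def)
      qed
      thus "Z_profile q M (x, t) - 5 * e \<le> u (x, t)"
        using d(2)[of t x] elim(2) unfolding K Z_profile_kernel[OF t(1)] by linarith
    qed
  qed
qed

lemma below_profile:
  assumes floor: "\<And>e. 0 < e \<Longrightarrow> \<forall>\<^sub>F t in at_top. \<forall>x. - (M + e) \<le> u (x, t)"
    and reached: "\<And>e. 0 < e \<Longrightarrow> \<forall>\<^sub>F t in at_top. \<exists>x. u (x, t) \<le> - M + e"
    and e: "0 < e" "e < M"
  shows "\<forall>\<^sub>F t in at_top. \<forall>x. u (x, t) \<le> Z_profile q M (x, t) + 4 * e"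
proof -
  obtain t0 x0 d where t0: "0 \<le> t0" and d: "0 < d" and upper:
    "\<And>t x. t0 \<le> t \<Longrightarrow> u (x, t) \<le> - M + 2 * e + smooth_kernel ((norm (x - x0))\<^sup>2) (t - t0 + d)"
    using upper_bound[OF floor reached e] by blast
  \<comment> \<open>The profile vanishes where |x| / t^(1/q) exceeds Y; the interval up to Y + 1
    leaves room for the displacement s <= 1.\<close>
  define Y where "Y = (M / \<kappa>) powr (1 / \<beta>)"
  define f where "f y = \<kappa> * y powr \<beta>" for y
  have "continuous_on {0..Y + 1} f"
    unfolding f_def using beta_gt_2 by (intro continuous_intros continuous_on_powr') auto
  hence "uniformly_continuous_on {0..Y + 1} f" by (intro compact_uniformly_continuous) auto
  then obtain \<delta> where \<delta>: "\<delta> > 0"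
    "\<And>y z. y \<in> {0..Y + 1} \<Longrightarrow> z \<in> {0..Y + 1} \<Longrightarrow> dist z y < \<delta> \<Longrightarrow> dist (f z) (f y) < e"
    using e(1) unfolding uniformly_continuous_on_def by meson
  have "\<forall>\<^sub>F t in at_top. (norm x0 + 1) * t powr - (1 / q) \<le> min (\<delta> / 2) 1"
    using q_gt_1 \<delta>(1) by (intro powr_neg_small) auto
  \<comment> \<open>The relative error will multiply f y + e, which is at most M + e where the
    profile is at issue, so it costs at most e.\<close>
  moreover have "\<forall>\<^sub>F t in at_top. (t / (t + (d - t0))) powr \<alpha> < 1 + e / (M + e)"
    using e by (intro order_tendstoD(2)[OF tendsto_time_shift_ratio]) (auto simp: add_pos_pos)
  ultimately show ?thesis
    using eventually_gt_at_top[of t0]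
  proof eventually_elim
    case (elim t)
    have t: "0 < t" "0 < t - t0 + d" using elim(3) t0(1) d(1) by auto
    define \<theta> where "\<theta> = (t / (t - t0 + d)) powr \<alpha>"
    have \<theta>: "\<theta> \<le> 1 + e / (M + e)" "0 \<le> \<theta>" using elim(2) by (auto simp: \<theta>_def algebra_simps)
    define s where "s = (norm x0 + 1) * t powr - (1 / q)"
    have s: "0 \<le> s" "s < \<delta>" "s \<le> 1" using elim(1) \<delta>(1) by (auto simp: s_def)
    show ?case
    proof
      fix x :: 'a
      define y where "y = norm x / t powr (1 / q)"
      have y: "0 \<le> y" by (simp add: y_def)
      have Z: "Z_profile q M (x, t) = min 0 (f y - M)"
        by (simp add: Z_profile_kernel[OF t(1)] kernel_self_similar f_def y_def)
      show "u (x, t) \<le> Z_profile q M (x, t) + 4 * e"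
      proof (cases "f y \<le> M")
        case False
        thus ?thesis using nonpos[of t x] t e by (simp add: Z)
      next
        case True
        have "y powr \<beta> \<le> M / \<kappa>" using True kappa_pos by (simp add: f_def field_simps)
        hence "(y powr \<beta>) powr (1 / \<beta>) \<le> Y"
          unfolding Y_def using beta_gt_2 by (intro powr_mono2) auto
        hence "y \<le> Y" using y beta_gt_2 by (simp add: powr_powr)
        hence "f (y + s) \<le> f y + e"
          using \<delta>(2)[of y "y + s"] y s by (auto simp: dist_real_def)
        hence "f (y + s) * \<theta> \<le> (f y + e) * (1 + e / (M + e))"
          using \<theta> kappa_pos by (intro mult_mono) (auto simp: f_def e(1) less_imp_le add_nonneg_nonneg)
        also have "\<dots> = f y + e + (f y + e) * (e / (M + e))" by (simp add: algebra_simps)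
        also have "(f y + e) * (e / (M + e)) \<le> (M + e) * (e / (M + e))"
          using True e by (intro mult_right_mono) auto
        also have "\<dots> = e" using e by (simp add: field_simps)
        finally have "f (y + s) * \<theta> \<le> f y + 2 * e" by simp
        moreover have "smooth_kernel ((norm (x - x0))\<^sup>2) (t - t0 + d) \<le> f (y + s) * \<theta>"
          using smooth_kernel_self_similar[OF t, of x x0] by (simp add: f_def y_def s_def \<theta>_def)
        ultimately show ?thesis using upper[of t x] elim(3) True by (simp add: Z)
      qed
    qed
  qed
qed

text \<open>For a continuous nonpositive u, convergence of the norms says two things: eventually u
  is above -(M + e) everywhere, and eventually it is below -M + e somewhere. These are
  \<open>floor\<close> and \<open>reached\<close>.\<close>

lemma Linf_convergence:
  assumes lim: "((\<lambda>t. Linf_norm (\<lambda>x. u (x, t))) \<longlongrightarrow> ereal M) at_top" and M: "0 < M"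
  shows "((\<lambda>t. Linf_norm (\<lambda>x. u (x, t) - Z_profile q M (x, t))) \<longlongrightarrow> 0) at_top"
proof -
  have cont: "continuous_on UNIV (\<lambda>x. u (x, t))" if "0 < t" for t
    using that continuous_on_compose2[OF continuous_on_u[of 0 t], of UNIV "\<lambda>x. (x, t)"]
    by (force intro: continuous_intros)
  have contZ: "continuous_on UNIV (\<lambda>x. Z_profile q M (x :: 'a, t))" if "0 < t" for t
    using that continuous_on_compose2[OF continuous_on_Z_profile, of UNIV "\<lambda>x::'a. (x, t)" M]
    by (force intro: continuous_intros)
  have contD: "continuous_on UNIV (\<lambda>x. u (x, t) - Z_profile q M (x, t))" if "0 < t" for t
    by (intro continuous_intros cont contZ that)
  have floor: "\<forall>\<^sub>F t in at_top. \<forall>x. - (M + e) \<le> u (x, t)" if "0 < e" for e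
  proof -
    have "\<forall>\<^sub>F t in at_top. Linf_norm (\<lambda>x. u (x, t)) < ereal (M + e)"
      using that by (intro order_tendstoD(2)[OF lim]) simp
    thus ?thesis using eventually_gt_at_top[of 0]
    proof eventually_elim
      case (elim t)
      show ?case
      proof
        fix x
        have "ereal \<bar>u (x, t)\<bar> < ereal (M + e)"
          by (rule order.strict_trans1[OF continuous_le_Linf_norm[OF cont[OF elim(2)]] elim(1)])
        thus "- (M + e) \<le> u (x, t)" by simp
      qed
    qed
  qed
  have reached: "\<forall>\<^sub>F t in at_top. \<exists>x. u (x, t) \<le> - M + e" if "0 < e" for e
  proof -
    have "\<forall>\<^sub>F t in at_top. ereal (M - e) < Linf_norm (\<lambda>x. u (x, t))"
      using that by (intro order_tendstoD(1)[OF lim]) simp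
    thus ?thesis using eventually_gt_at_top[of 0]
    proof eventually_elim
      case (elim t)
      show ?case
      proof (rule ccontr)
        assume "\<nexists>x. u (x, t) \<le> - M + e"
        hence "\<bar>u (x, t)\<bar> \<le> M - e" for x using nonpos[of t x] elim(2) by (smt (verit))
        hence "Linf_norm (\<lambda>x. u (x, t)) \<le> ereal (M - e)"
          by (intro Linf_norm_le borel_measurable_continuous_onI cont elim)
        thus False using elim(1) by simp
      qed
    qed
  qed
  show ?thesis
  proof (rule order_tendstoI)
    fix a :: ereal assume "a < 0"
    show "\<forall>\<^sub>F t in at_top. a < Linf_norm (\<lambda>x. u (x, t) - Z_profile q M (x, t))"
      using eventually_gt_at_top[of 0]
    proof eventually_elim
      case (elim t)
      have "ereal \<bar>u (0, t) - Z_profile q M (0 :: 'a, t)\<bar> \<le> Linf_norm (\<lambda>x. u (x, t) - Z_profile q M (x, t))"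
        by (rule continuous_le_Linf_norm[OF contD[OF elim]])
      moreover have "0 \<le> ereal \<bar>u (0, t) - Z_profile q M (0 :: 'a, t)\<bar>" by simp
      ultimately show ?case using \<open>a < 0\<close> by (meson order.strict_trans2)
    qed
  next
    fix a :: ereal assume "0 < a"
    then obtain b where b: "0 < ereal b" "ereal b < a" using ereal_dense2 by blast
    \<comment> \<open>The estimates from below and above have errors 5 e and 4 e, and
      \<open>below_profile\<close> requires e < M.\<close>
    define e where "e = min (b / 5) (M / 2)"
    have e: "0 < e" "e < M" "5 * e \<le> b" using b M by (auto simp: e_def)
    have "\<forall>\<^sub>F t in at_top. \<forall>x. Z_profile q M (x, t) - 5 * e \<le> u (x, t)"
      by (rule above_profile) (use floor e M in auto)
    moreover have "\<forall>\<^sub>F t in at_top. \<forall>x. u (x, t) \<le> Z_profile q M (x, t) + 4 * e"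
      by (rule below_profile) (use floor reached e in auto)
    ultimately show "\<forall>\<^sub>F t in at_top. Linf_norm (\<lambda>x. u (x, t) - Z_profile q M (x, t)) < a"
      using eventually_gt_at_top[of 0]
    proof eventually_elim
      case (elim t)
      have "\<bar>u (x, t) - Z_profile q M (x, t)\<bar> \<le> b" for x
        using elim(1)[rule_format, of x] elim(2)[rule_format, of x] e by linarith
      hence "Linf_norm (\<lambda>x. u (x, t) - Z_profile q M (x, t)) \<le> ereal b"
        by (intro Linf_norm_le borel_measurable_continuous_onI contD elim)
      thus ?case using b(2) by (rule order.strict_trans1)
    qed
  qed
qed

end

section \<open>The profile as a viscosity solution\<close>

lemma C1_space_time_derivative:
  fixes \<phi> :: "'a::euclidean_space \<times> real \<Rightarrow> real"
  assumes "C1_space_time \<phi>" "0 < t"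
  shows "(\<phi> has_derivative (\<lambda>h. grad (at_time \<phi> t) x \<bullet> fst h + dt \<phi> (x, t) * snd h)) (at (x, t))"
proof -
  define F where "F = frechet_derivative \<phi> (at (x, t))"
  have F: "(\<phi> has_derivative F) (at (x, t))"
    using assms frechet_derivative_works unfolding C1_space_time_def F_def by auto
  interpret linear F using has_derivative_linear[OF F] .
  have "((\<lambda>y. (y, t)) has_derivative (\<lambda>v. (v, 0))) (at x)"
    by (auto intro!: derivative_eq_intros)
  from diff_chain_at[OF this F] have "(at_time \<phi> t has_derivative (\<lambda>v. F (v, 0))) (at x)"
    by (simp add: o_def)
  hence "frechet_derivative (at_time \<phi> t) (at x) = (\<lambda>v. F (v, 0))"
    by (rule frechet_derivative_at[symmetric])
  hence grad: "grad (at_time \<phi> t) x = (\<Sum>b\<in>Basis. F (b, 0) *\<^sub>R b)"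
    by (simp add: grad_def partial_def)
  have space: "F (v, 0) = grad (at_time \<phi> t) x \<bullet> v" for v
  proof -
    have eq: "(v, 0) = (\<Sum>b\<in>Basis. (v \<bullet> b) *\<^sub>R (b, 0::real))"
      by (simp add: prod_eq_iff fst_sum snd_sum euclidean_representation)
    have "F (v, 0) = (\<Sum>b\<in>Basis. (v \<bullet> b) * F (b, 0))"
      by (subst eq) (simp only: sum scale real_scaleR_def)
    thus ?thesis by (simp add: grad inner_sum_left inner_commute[of v] mult.commute)
  qed
  have "((\<lambda>s. (x, s)) has_derivative (\<lambda>s. (0, s))) (at t)"
    by (auto intro!: derivative_eq_intros)
  from diff_chain_at[OF this F] have "((\<lambda>s. \<phi> (x, s)) has_derivative (\<lambda>s. F (0, s))) (at t)"
    by (simp add: o_def)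
  moreover have time: "F (0, s) = F (0, 1) * s" for s
    using scale[of s "(0, 1)"] by simp
  hence "(\<lambda>s. F (0, s)) = (*) (F (0, 1))" by (rule ext)
  ultimately have "((\<lambda>s. \<phi> (x, s)) has_real_derivative F (0, 1)) (at t)"
    by (simp only: has_field_derivative_def)
  hence dt: "dt \<phi> (x, t) = F (0, 1)" by (simp add: dt_def DERIV_imp_deriv)
  have "F h = grad (at_time \<phi> t) x \<bullet> fst h + dt \<phi> (x, t) * snd h" for h
    using add[of "(fst h, 0)" "(0, snd h)"] space[of "fst h"] time[of "snd h"] dt by simp
  hence "F = (\<lambda>h. grad (at_time \<phi> t) x \<bullet> fst h + dt \<phi> (x, t) * snd h)" by auto
  thus ?thesis using F by simp
qed

text \<open>The path runs backwards in time with velocity v, since the kernel links (x, t) to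
  earlier times.\<close>

lemma C1_space_time_path_DERIV:
  fixes \<phi> :: "'a::euclidean_space \<times> real \<Rightarrow> real"
  assumes "C1_space_time \<phi>" "0 < t"
  shows "((\<lambda>s. \<phi> (x - s *\<^sub>R v, t - s)) has_real_derivative
           - (grad (at_time \<phi> t) x \<bullet> v + dt \<phi> (x, t))) (at 0)"
proof -
  have 1: "((\<lambda>s. (x - s *\<^sub>R v, t - s)) has_derivative (\<lambda>s. (- (s *\<^sub>R v), - s))) (at 0)"
    by (auto intro!: derivative_eq_intros)
  have 2: "(\<phi> has_derivative (\<lambda>h. grad (at_time \<phi> t) x \<bullet> fst h + dt \<phi> (x, t) * snd h))
      (at (x - 0 *\<^sub>R v, t - 0))"
    using C1_space_time_derivative[OF assms] by simp
  from diff_chain_at[OF 1 2]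
  have "((\<lambda>s. \<phi> (x - s *\<^sub>R v, t - s)) has_derivative
      (\<lambda>s. grad (at_time \<phi> t) x \<bullet> (- (s *\<^sub>R v)) + dt \<phi> (x, t) * (- s))) (at 0)"
    by (simp add: o_def)
  moreover have "(\<lambda>s. grad (at_time \<phi> t) x \<bullet> (- (s *\<^sub>R v)) + dt \<phi> (x, t) * (- s))
      = (*) (- (grad (at_time \<phi> t) x \<bullet> v + dt \<phi> (x, t)))"
    by (rule ext) (simp add: algebra_simps)
  ultimately show ?thesis by (simp only: has_field_derivative_def)
qed

lemma eventually_path:
  fixes x v :: "'a::euclidean_space"
  assumes "\<forall>\<^sub>F p in nhds (x, t). P p"
  shows "\<forall>\<^sub>F s in at_right (0::real). P (x - s *\<^sub>R v, t - s)"
proof -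
  have "((\<lambda>s. (x - s *\<^sub>R v, t - s)) \<longlongrightarrow> (x - 0 *\<^sub>R v, t - 0)) (at_right 0)"
    by (intro tendsto_intros)
  thus ?thesis using assms by (auto simp: filterlim_iff)
qed

lemma DERIV_ge_right:
  fixes f :: "real \<Rightarrow> real"
  assumes f: "(f has_real_derivative D) (at 0)"
    and ev: "\<forall>\<^sub>F s in at_right 0. f 0 + c * s \<le> f s"
  shows "c \<le> D"
proof -
  have "((\<lambda>s. (f s - f 0) / (s - 0)) \<longlongrightarrow> D) (at_right 0)"
    using has_field_derivative_at_within[OF f, of "{0<..}"] by (simp add: has_field_derivative_iff)
  moreover have "\<forall>\<^sub>F s in at_right 0. c \<le> (f s - f 0) / (s - 0)"
    using ev eventually_at_right_less[of 0] by eventually_elim (simp add: field_simps)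
  ultimately show ?thesis by (rule tendsto_lowerbound) simp
qed

context hj_exponent
begin

text \<open>Dynamic programming bounds the drop of \<phi> along the backward path with velocity v by
  s times the Lagrangian of v. With v from the equality case of Young's inequality, differentiating
  at s = 0 gives the required sign.\<close>

lemma viscosity_subsolution_of_dpp:
  fixes z :: "'a::euclidean_space \<times> real \<Rightarrow> real"
  assumes dpp: "\<And>x t y s. 0 < s \<Longrightarrow> s < t \<Longrightarrow> z (x, t) \<le> z (y, s) + kernel (x - y) (t - s)"
  shows "viscosity_subsolution (\<lambda>p. norm p powr q) z"
  unfolding viscosity_subsolution_def
proof (intro allI impI)
  fix \<phi> :: "'a \<times> real \<Rightarrow> real" and x t
  assume asm: "C1_space_time \<phi> \<and> 0 < t \<and> (\<forall>\<^sub>F p in nhds (x, t). z p - \<phi> p \<le> z (x, t) - \<phi> (x, t))"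
  obtain v where v: "v \<bullet> grad (at_time \<phi> t) x = lagrangian v + norm (grad (at_time \<phi> t) x) powr q"
    by (rule lagrangian_young_attained)
  have "\<forall>\<^sub>F s in at_right (0::real). s < t"
    using asm eventually_at_right_less[of 0] by (simp add: eventually_at_right[of 0 "t"] , intro exI[of _ t]) auto
  moreover have "\<forall>\<^sub>F s in at_right 0. z (x - s *\<^sub>R v, t - s) - \<phi> (x - s *\<^sub>R v, t - s) \<le> z (x, t) - \<phi> (x, t)"
    using asm by (intro eventually_path) auto
  ultimately have "\<forall>\<^sub>F s in at_right 0. \<phi> (x - 0 *\<^sub>R v, t - 0) + (- lagrangian v) * s \<le> \<phi> (x - s *\<^sub>R v, t - s)"
    using eventually_at_right_less[of 0]
  proof eventually_elim
    case (elim s)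
    have "z (x, t) \<le> z (x - s *\<^sub>R v, t - s) + kernel (s *\<^sub>R v) s"
      using dpp[of "t - s" t x "x - s *\<^sub>R v"] elim by simp
    thus ?case using elim kernel_lagrangian[of s v] by (simp add: mult.commute)
  qed
  from DERIV_ge_right[OF C1_space_time_path_DERIV this] asm
  have "- lagrangian v \<le> - (grad (at_time \<phi> t) x \<bullet> v + dt \<phi> (x, t))" by blast
  thus "dt \<phi> (x, t) + norm (grad (at_time \<phi> t) x) powr q \<le> 0"
    using v by (simp add: inner_commute)
qed

text \<open>Nonnegativity of the kernel carries its triangle inequality through the minimum with
  0.\<close>

lemma Z_profile_dpp:
  assumes "0 < s" "s < t"
  shows "Z_profile q m (x, t) \<le> Z_profile q m (y, s) + kernel (x - y) (t - s)"
  using kernel_triangle[OF assms, of x y] kernel_nonneg[of "x - y" "t - s"] assms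
  by (auto simp: Z_profile_kernel min_def)

text \<open>Along the ray through the origin, which is the optimal path, the kernel is linear in time;
  where the profile is \<open>0\<close> the constant path is optimal.\<close>

lemma Z_profile_supersolution: "viscosity_supersolution (\<lambda>p. norm p powr q) (Z_profile q m)"
  unfolding viscosity_supersolution_def
proof (intro allI impI)
  fix \<phi> :: "'a::euclidean_space \<times> real \<Rightarrow> real" and x t
  assume asm: "C1_space_time \<phi> \<and> 0 < t \<and>
      (\<forall>\<^sub>F p in nhds (x, t). Z_profile q m p - \<phi> p \<ge> Z_profile q m (x, t) - \<phi> (x, t))"
  define v where "v = (if kernel x t \<le> m then (1 / t) *\<^sub>R x else 0)"
  have t: "0 < t" using asm by simp
  have small: "\<forall>\<^sub>F s in at_right (0::real). s < t"
    using t by (auto simp: eventually_at_right[of 0 t])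
  have Z: "s * lagrangian v \<le> Z_profile q m (x, t) - Z_profile q m (x - s *\<^sub>R v, t - s)"
    if s: "0 < s" "s < t" for s
  proof (cases "kernel x t \<le> m")
    case True
    have x: "x = t *\<^sub>R v" using True t by (simp add: v_def)
    have "x - s *\<^sub>R v = (t - s) *\<^sub>R v" by (simp add: x scaleR_left_diff_distrib)
    hence "kernel (x - s *\<^sub>R v) (t - s) = (t - s) * lagrangian v" "kernel x t = t * lagrangian v"
      using s t kernel_lagrangian[of "t - s" v] kernel_lagrangian[of t v] by (simp_all flip: x)
    thus ?thesis using True s t by (simp add: Z_profile_kernel algebra_simps)
  next
    case False
    thus ?thesis using s t by (simp add: Z_profile_kernel v_def lagrangian_def)
  qed
  have "\<forall>\<^sub>F s in at_right 0. Z_profile q m (x - s *\<^sub>R v, t - s) - \<phi> (x - s *\<^sub>R v, t - s)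
      \<ge> Z_profile q m (x, t) - \<phi> (x, t)"
    using asm by (intro eventually_path) auto
  hence "\<forall>\<^sub>F s in at_right 0. - \<phi> (x - 0 *\<^sub>R v, t - 0) + lagrangian v * s \<le> - \<phi> (x - s *\<^sub>R v, t - s)"
    using small eventually_at_right_less[of 0]
  proof eventually_elim
    case (elim s)
    thus ?case using Z[of s] by (simp add: mult.commute)
  qed
  from DERIV_ge_right[OF DERIV_minus[OF C1_space_time_path_DERIV] this] asm
  have "lagrangian v \<le> grad (at_time \<phi> t) x \<bullet> v + dt \<phi> (x, t)" by simp
  thus "dt \<phi> (x, t) + norm (grad (at_time \<phi> t) x) powr q \<ge> 0"
    using lagrangian_young[of v "grad (at_time \<phi> t) x"] by (simp add: inner_commute)
qed

lemma Z_profile_viscosity_solution: "viscosity_solution (\<lambda>p. norm p powr q) (Z_profile q m)"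
  unfolding viscosity_solution_def
  by (intro conjI continuous_on_Z_profile Z_profile_supersolution viscosity_subsolution_of_dpp
      Z_profile_dpp)

section \<open>Regularity and initial trace of the profile\<close>

lemma Z_profile_BUC:
  assumes m: "0 < m"
  shows "BUC_space_time (Z_profile q m :: 'a::euclidean_space \<times> real \<Rightarrow> real)"
  unfolding BUC_space_time_def
proof (intro conjI allI impI)
  have "\<bar>Z_profile q m (x, t)\<bar> \<le> m" if "0 < t" for t and x :: 'a
    using m kernel_nonneg[of x t] by (auto simp: Z_profile_kernel[OF that] min_def)
  thus "bounded (Z_profile q m ` (space_time :: ('a \<times> real) set))"
    by (auto simp: bounded_iff)
next
  fix \<tau> :: real assume \<tau>: "0 < \<tau>"
  define f where "f y = min 0 (\<kappa> * y powr \<beta> - m)" for y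
  define Y where "Y = (m / \<kappa>) powr (1 / \<beta>)"
  have Y: "0 \<le> Y" "\<kappa> * Y powr \<beta> = m"
    using kappa_pos m beta_gt_2 by (auto simp: Y_def powr_powr)
  \<comment> \<open>The profile is a function of |x| / t^(1/q) that is constant beyond Y. Truncating
    the variable at Y makes it Lipschitz in time uniformly in x.\<close>
  define w where "w x t = min Y (norm x / t powr (1 / q))" for x :: 'a and t
  have Z: "Z_profile q m (x, t) = f (w x t)" if "0 < t" for x :: 'a and t
  proof (cases "norm x / t powr (1 / q) \<le> Y")
    case True
    thus ?thesis using Z_profile_kernel[OF that, of m x] by (simp add: w_def f_def kernel_self_similar)
  next
    case False
    hence "Y powr \<beta> \<le> (norm x / t powr (1 / q)) powr \<beta>"
      using Y beta_gt_2 by (intro powr_mono2) auto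
    hence "m \<le> kernel x t" using Y kappa_pos by (simp add: kernel_self_similar flip: Y(2))
    thus ?thesis using False Z_profile_kernel[OF that, of m x] Y by (simp add: w_def f_def)
  qed
  have w_range: "w x t \<in> {0..Y}" if "0 < t" for x t using Y that by (simp add: w_def)
  define C where "C = 1 / \<tau> powr (1 / q) + Y / \<tau>"
  have C: "0 < C" using \<tau> Y by (simp add: C_def add_pos_nonneg)
  have w_space: "\<bar>w x t - w y t\<bar> \<le> norm (x - y) / \<tau> powr (1 / q)" if "\<tau> < t" for x y t
  proof -
    have "\<bar>w x t - w y t\<bar> \<le> \<bar>norm x / t powr (1 / q) - norm y / t powr (1 / q)\<bar>"
      by (auto simp: w_def min_def)
    also have "\<dots> = \<bar>norm x - norm y\<bar> / t powr (1 / q)" by (simp flip: diff_divide_distrib)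
    also have "\<dots> \<le> norm (x - y) / \<tau> powr (1 / q)"
      using that \<tau> q_gt_1 by (intro frac_le norm_triangle_ineq3 powr_mono2) auto
    finally show ?thesis .
  qed
  have w_time: "\<bar>w x t - w x s\<bar> \<le> Y * (s - t) / \<tau>" if "\<tau> < t" "t \<le> s" for x t s
  proof -
    \<comment> \<open>From t to s the untruncated variable is multiplied by r, and r >= t / s
      because 1/q < 1; so \<open>w\<close> falls by at most the fraction 1 - t / s.\<close>
    define r where "r = (t / s) powr (1 / q)"
    have ts: "0 < t / s" "t / s \<le> 1" using that \<tau> by auto
    have r: "t / s \<le> r" "r \<le> 1"
      using powr_mono'[of "1 / q" 1 "t / s"] that \<tau> powr_mono2[of "1 / q" "t / s" 1] ts q_gt_1
      by (simp_all add: r_def)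
    define a where "a = norm x / t powr (1 / q)"
    have a: "0 \<le> a" by (simp add: a_def)
    have w_t: "w x t = min Y a" and w_s: "w x s = min Y (r * a)"
      using that \<tau> by (simp_all add: w_def a_def r_def powr_divide)
    have "r * w x t = min (r * Y) (r * a)"
      using r ts by (simp add: w_t min_mult_distrib_left)
    also have "\<dots> \<le> w x s"
      unfolding w_s using mult_right_mono[OF r(2) Y(1)] by (intro min.mono) auto
    finally have "r * w x t \<le> w x s" .
    moreover have "w x s \<le> w x t"
      unfolding w_s w_t using mult_right_mono[OF r(2) a] by (intro min.mono) auto
    ultimately have "\<bar>w x t - w x s\<bar> \<le> (1 - r) * w x t" by (simp add: algebra_simps)
    also have "\<dots> \<le> (1 - t / s) * Y"
      using r ts Y w_range[of t x] that \<tau> by (intro mult_mono) auto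
    also have "1 - t / s = (s - t) / s" using that \<tau> by (simp add: field_simps)
    also have "(s - t) / s * Y \<le> (s - t) / \<tau> * Y"
      using that \<tau> Y by (intro mult_right_mono divide_left_mono) auto
    finally show ?thesis by (simp add: mult.commute)
  qed
  have w_Lipschitz: "\<bar>w x t - w y s\<bar> \<le> C * dist (x, t) (y, s)" if "\<tau> < t" "\<tau> < s" for x y t s
  proof -
    have "\<bar>w y t - w y s\<bar> \<le> Y * \<bar>t - s\<bar> / \<tau>"
      using w_time[of t s y] w_time[of s t y] that by (cases "t \<le> s") auto
    hence "\<bar>w x t - w y s\<bar> \<le> norm (x - y) / \<tau> powr (1 / q) + Y * \<bar>t - s\<bar> / \<tau>"
      using w_space[OF that(1), of x y] by linarith
    also have "\<dots> \<le> dist (x, t) (y, s) / \<tau> powr (1 / q) + Y * dist (x, t) (y, s) / \<tau>"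
      using \<tau> Y dist_fst_le[of "(x, t)" "(y, s)"] dist_snd_le[of "(x, t)" "(y, s)"]
      by (intro add_mono divide_right_mono mult_left_mono) (auto simp: dist_norm dist_real_def)
    finally show ?thesis by (simp add: C_def algebra_simps)
  qed
  have "continuous_on {0..Y} f"
    unfolding f_def using beta_gt_2 by (intro continuous_intros continuous_on_powr') auto
  hence f: "uniformly_continuous_on {0..Y} f" by (intro compact_uniformly_continuous) auto
  show "uniformly_continuous_on (UNIV \<times> {\<tau><..}) (Z_profile q m :: 'a \<times> real \<Rightarrow> real)"
    unfolding uniformly_continuous_on_def
  proof (intro allI impI)
    fix e :: real assume "0 < e"
    then obtain d where d: "d > 0"
      "\<And>y z. y \<in> {0..Y} \<Longrightarrow> z \<in> {0..Y} \<Longrightarrow> dist z y < d \<Longrightarrow> dist (f z) (f y) < e"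
      using f unfolding uniformly_continuous_on_def by meson
    have "dist (Z_profile q m p') (Z_profile q m p) < e"
      if p: "p \<in> UNIV \<times> {\<tau><..}" "p' \<in> UNIV \<times> {\<tau><..}" "dist p' p < d / C" for p p' :: "'a \<times> real"
    proof -
      obtain x t y s where eq: "p' = (x, t)" "p = (y, s)" by (cases p, cases p')
      have ts: "\<tau> < t" "\<tau> < s" "0 < t" "0 < s" using p eq \<tau> by auto
      have "C * dist (x, t) (y, s) < d" using p(3) C eq by (simp add: field_simps)
      hence "dist (w x t) (w y s) < d" using w_Lipschitz[OF ts(1,2), of x y] by (simp add: dist_real_def)
      thus ?thesis unfolding eq Z[OF ts(3)] Z[OF ts(4)]
        by (intro d(2) w_range ts)
    qed
    thus "\<exists>d>0. \<forall>x\<in>(UNIV :: 'a set) \<times> {\<tau><..}. \<forall>x'\<in>UNIV \<times> {\<tau><..}.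
        dist x' x < d \<longrightarrow> dist (Z_profile q m x') (Z_profile q m x) < e"
      using d(1) C by (intro exI[of _ "d / C"]) simp
  qed
qed

end

lemma at_initial_time_nontrivial:
  "at (x, 0) within (space_time :: ('a::euclidean_space \<times> real) set) \<noteq> bot"
proof -
  have "(x, 0) \<in> closure (UNIV \<times> {0<..} :: ('a \<times> real) set)"
    unfolding closure_Times by simp
  thus ?thesis
    by (auto simp: trivial_limit_within islimpt_in_closure)
qed

lemma eventually_initial_time:
  assumes "\<forall>\<^sub>F p in at (x, 0) within (space_time :: ('a::euclidean_space \<times> real) set). P p"
  shows "\<exists>t>0. P (x, t)"
proof -
  obtain d where d: "d > 0" "\<And>p. p \<in> space_time \<Longrightarrow> p \<noteq> (x, 0) \<Longrightarrow> dist p (x, 0) < d \<Longrightarrow> P p"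
    using assms unfolding eventually_at by blast
  have "P (x, d / 2)" using d(1) by (intro d(2)) (auto simp: dist_Pair_Pair dist_real_def)
  thus ?thesis using d(1) by (intro exI[of _ "d / 2"]) simp
qed

lemma (in hj_exponent) Z_profile_attains_datum:
  assumes m: "0 < m"
  shows "attains_lsc_datum (Z_profile q m) (Z_datum m :: 'a::euclidean_space \<Rightarrow> real)"
  unfolding attains_lsc_datum_def
proof
  fix x :: 'a
  let ?F = "at (x, 0) within (space_time :: ('a \<times> real) set)"
  have pos: "\<forall>\<^sub>F p in ?F. 0 < snd p" by (auto simp: eventually_at intro!: exI[of _ 1])
  show "Liminf ?F (\<lambda>p. ereal (Z_profile q m p)) = ereal (Z_datum m x)"
  proof (cases "x = 0")
    case True
    have "ereal (- m) \<le> Liminf ?F (\<lambda>p. ereal (Z_profile q m p))"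
    proof (rule Liminf_bounded)
      show "\<forall>\<^sub>F p in ?F. ereal (- m) \<le> ereal (Z_profile q m p)"
        using pos
      proof eventually_elim
        case (elim p)
        thus ?case using m kernel_nonneg[of "fst p" "snd p"] Z_profile_kernel[of "snd p" m "fst p"] by simp
      qed
    qed
    moreover have "Liminf ?F (\<lambda>p. ereal (Z_profile q m p)) \<le> ereal (- m)"
    proof (rule ccontr)
      assume "\<not> Liminf ?F (\<lambda>p. ereal (Z_profile q m p)) \<le> ereal (- m)"
      hence "\<forall>\<^sub>F p in ?F. ereal (- m) < ereal (Z_profile q m p)"
        by (intro less_LiminfD) simp
      then obtain t where "t > 0" "ereal (- m) < ereal (Z_profile q m (x, t))"
        using eventually_initial_time by blast
      thus False using True Z_profile_kernel[of t m x] m by simp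
    qed
    ultimately show ?thesis using True by (simp add: Z_datum_def)
  next
    case False
    \<comment> \<open>c t^(-\<alpha>) bounds the kernel from below at points of norm above |x| / 2
      and exceeds m once t < (c / m)^(1/\<alpha>), so at positive times near (x, 0) the profile is
      identically 0.\<close>
    define c where "c = \<kappa> * (norm x / 2) powr \<beta>"
    have c: "0 < c" using False kappa_pos by (simp add: c_def)
    have "((\<lambda>p. norm (fst p)) \<longlongrightarrow> norm (fst (x, 0::real))) ?F"
      "((\<lambda>p. snd p) \<longlongrightarrow> snd (x, 0::real)) ?F"
      by (intro tendsto_intros)+
    from order_tendstoD(1)[OF this(1), of "norm x / 2"]
      order_tendstoD(2)[OF this(2), of "(c / m) powr (1 / \<alpha>)"]
    have "\<forall>\<^sub>F p in ?F. norm x / 2 < norm (fst p)" "\<forall>\<^sub>F p in ?F. snd p < (c / m) powr (1 / \<alpha>)"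
      using False c m by auto
    hence "\<forall>\<^sub>F p in ?F. Z_profile q m p = 0"
      using pos
    proof eventually_elim
      case (elim p)
      have "snd p powr \<alpha> \<le> c / m"
        using powr_mono2[of \<alpha> "snd p" "(c / m) powr (1 / \<alpha>)"] elim alpha_gt_1 c m
        by (simp add: powr_powr)
      hence "m \<le> c * snd p powr - \<alpha>" using elim m by (simp add: powr_minus field_simps)
      also have "\<dots> \<le> kernel (fst p) (snd p)"
        unfolding c_def kernel_def using elim kappa_pos beta_gt_2
        by (intro mult_right_mono mult_left_mono powr_mono2) auto
      finally show ?case using elim Z_profile_kernel[of "snd p" m "fst p"] by simp
    qed
    hence "((\<lambda>p. ereal (Z_profile q m p)) \<longlongrightarrow> ereal 0) ?F"
      by (intro tendsto_eventually) (auto elim: eventually_mono)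
    from lim_imp_Liminf[OF at_initial_time_nontrivial this] show ?thesis
      using False by (simp add: Z_datum_def)
  qed
qed

lemma Z_datum_bounded: "bounded (range (Z_datum m))"
  by (rule finite_imp_bounded, rule finite_subset[of _ "{- m, 0}"]) (auto simp: Z_datum_def)

lemma Z_datum_lsc:
  fixes m :: real
  assumes "0 < m"
  shows "lower_semicontinuous (Z_datum m :: 'a::euclidean_space \<Rightarrow> real)"
  unfolding lower_semicontinuous_def
proof (intro allI impI)
  fix x :: 'a and a assume a: "a < Z_datum m x"
  show "\<forall>\<^sub>F y in nhds x. a < Z_datum m y"
  proof (cases "x = 0")
    case True
    hence "a < Z_datum m y" for y :: 'a using a assms by (simp add: Z_datum_def)
    thus ?thesis by simp
  next
    case False
    hence "\<forall>\<^sub>F y in nhds x. y \<noteq> 0" by (rule t1_space_nhds)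
    thus ?thesis by eventually_elim (use a False in \<open>simp add: Z_datum_def\<close>)
  qed
qed

section \<open>Uniqueness of the viscosity solution\<close>

definition C1_gradient ::
    "('a::euclidean_space \<times> real \<Rightarrow> real) \<Rightarrow> ('a \<times> real \<Rightarrow> 'a) \<Rightarrow> ('a \<times> real \<Rightarrow> real) \<Rightarrow> bool" where
  "C1_gradient \<phi> G D \<longleftrightarrow>
     (\<forall>p\<in>space_time. (\<phi> has_derivative (\<lambda>h. G p \<bullet> fst h + D p * snd h)) (at p)) \<and>
     continuous_on space_time G \<and> continuous_on space_time D"

text \<open>Uniqueness of the Frechet derivative identifies the explicit pair G, D with
  \<open>grad\<close> and \<open>dt\<close>. Test functions are assembled by the rules for
  \<open>C1_gradient\<close> and enter the viscosity inequalities through this lemma.\<close>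

lemma C1_gradient_D:
  fixes \<phi> :: "'a::euclidean_space \<times> real \<Rightarrow> real"
  assumes "C1_gradient \<phi> G D"
  shows "C1_space_time \<phi>"
    "0 < t \<Longrightarrow> dt \<phi> (x, t) = D (x, t)"
    "0 < t \<Longrightarrow> grad (at_time \<phi> t) x = G (x, t)"
    "continuous_on space_time \<phi>"
proof -
  have der: "(\<phi> has_derivative (\<lambda>h. G p \<bullet> fst h + D p * snd h)) (at p)" if "p \<in> space_time" for p
    using assms that by (auto simp: C1_gradient_def)
  have eq: "frechet_derivative \<phi> (at p) = (\<lambda>h. G p \<bullet> fst h + D p * snd h)" if "p \<in> space_time" for p
    by (rule frechet_derivative_at[symmetric, OF der[OF that]])
  show "continuous_on space_time \<phi>"
    by (rule has_derivative_continuous_on[OF has_derivative_at_withinI[OF der]])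
  show C1: "C1_space_time \<phi>"
    unfolding C1_space_time_def
  proof (intro conjI ballI)
    show "\<phi> differentiable (at p)" if "p \<in> space_time" for p
      using der[OF that] by (auto simp: differentiable_def)
    fix b :: "'a \<times> real"
    have "continuous_on space_time (\<lambda>p. G p \<bullet> fst b + D p * snd b)"
      using assms by (auto simp: C1_gradient_def intro!: continuous_intros)
    thus "continuous_on space_time (partial b \<phi>)"
      by (rule continuous_on_eq) (simp add: partial_def eq)
  qed
  assume t: "0 < t"
  hence ext: "(\<lambda>h. grad (at_time \<phi> t) x \<bullet> fst h + dt \<phi> (x, t) * snd h)
     = (\<lambda>h. G (x, t) \<bullet> fst h + D (x, t) * snd h)"
    using has_derivative_unique[OF C1_space_time_derivative[OF C1 t, of x] der[of "(x, t)"]] by simp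
  have *: "grad (at_time \<phi> t) x \<bullet> v + dt \<phi> (x, t) * s = G (x, t) \<bullet> v + D (x, t) * s" for v s
    using fun_cong[OF ext, of "(v, s)"] by simp
  show "dt \<phi> (x, t) = D (x, t)" using *[of 0 1] by simp
  show "grad (at_time \<phi> t) x = G (x, t)"
  proof (rule euclidean_eqI)
    show "grad (at_time \<phi> t) x \<bullet> b = G (x, t) \<bullet> b" for b
      using *[of b 0] by simp
  qed
qed

lemma C1_gradient_add:
  "C1_gradient \<phi> G D \<Longrightarrow> C1_gradient \<psi> G' D' \<Longrightarrow>
   C1_gradient (\<lambda>p. \<phi> p + \<psi> p) (\<lambda>p. G p + G' p) (\<lambda>p. D p + D' p)"
  unfolding C1_gradient_def
  by (auto intro!: continuous_intros derivative_eq_intros simp: inner_add_left algebra_simps)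

lemma C1_gradient_cmult:
  "C1_gradient \<phi> G D \<Longrightarrow> C1_gradient (\<lambda>p. c * \<phi> p) (\<lambda>p. c *\<^sub>R G p) (\<lambda>p. c * D p)"
  unfolding C1_gradient_def
  by (auto intro!: continuous_intros derivative_eq_intros simp: algebra_simps)

lemma C1_gradient_mult:
  assumes "C1_gradient \<phi> G D" "C1_gradient \<psi> G' D'"
  shows "C1_gradient (\<lambda>p. \<phi> p * \<psi> p) (\<lambda>p. \<phi> p *\<^sub>R G' p + \<psi> p *\<^sub>R G p) (\<lambda>p. \<phi> p * D' p + \<psi> p * D p)"
  using assms C1_gradient_D(4)[OF assms(1)] C1_gradient_D(4)[OF assms(2)]
  unfolding C1_gradient_def
  by (auto intro!: continuous_intros derivative_eq_intros simp: inner_add_left algebra_simps)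

lemma C1_gradient_compose:
  assumes \<phi>: "C1_gradient \<phi> G D"
    and f: "\<And>p. p \<in> space_time \<Longrightarrow> (f has_real_derivative f' (\<phi> p)) (at (\<phi> p))"
    and f': "continuous_on (\<phi> ` space_time) f'"
  shows "C1_gradient (\<lambda>p. f (\<phi> p)) (\<lambda>p. f' (\<phi> p) *\<^sub>R G p) (\<lambda>p. f' (\<phi> p) * D p)"
proof -
  have "continuous_on space_time (\<lambda>p. f' (\<phi> p))"
    by (rule continuous_on_compose2[OF f' C1_gradient_D(4)[OF \<phi>]]) auto
  moreover have "((\<lambda>p. f (\<phi> p)) has_derivative (\<lambda>h. (f' (\<phi> p) *\<^sub>R G p) \<bullet> fst h + (f' (\<phi> p) * D p) * snd h)) (at p)"
    if "p \<in> space_time" for p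
  proof -
    have "(\<phi> has_derivative (\<lambda>h. G p \<bullet> fst h + D p * snd h)) (at p)"
      using \<phi> that by (auto simp: C1_gradient_def)
    from diff_chain_at[OF this] f[OF that]
    have "((\<lambda>p. f (\<phi> p)) has_derivative (\<lambda>h. f' (\<phi> p) * (G p \<bullet> fst h + D p * snd h))) (at p)"
      by (auto simp: has_field_derivative_def o_def)
    thus ?thesis by (simp add: algebra_simps)
  qed
  ultimately show ?thesis
    using \<phi> unfolding C1_gradient_def by (auto intro!: continuous_intros)
qed

lemma C1_gradient_time:
  assumes "\<And>t. 0 < t \<Longrightarrow> (f has_real_derivative f' t) (at t)" "continuous_on {0<..} f'"
  shows "C1_gradient (\<lambda>p. f (snd p)) (\<lambda>p. 0) (\<lambda>p. f' (snd p))"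
proof -
  have "C1_gradient snd (\<lambda>p :: 'a \<times> real. 0) (\<lambda>p. 1)"
    unfolding C1_gradient_def by (auto intro!: derivative_eq_intros)
  from C1_gradient_compose[OF this, of f f'] show ?thesis
    using assms by (force intro: continuous_on_subset)
qed

lemma C1_gradient_norm2:
  "C1_gradient (\<lambda>p :: 'a::euclidean_space \<times> real. (norm (fst p - a))\<^sup>2) (\<lambda>p. 2 *\<^sub>R (fst p - a)) (\<lambda>p. 0)"
  unfolding C1_gradient_def power2_norm_eq_inner
  by (auto intro!: continuous_intros derivative_eq_intros simp: inner_commute inner_diff_left inner_diff_right)

text \<open>At r = 0 the difference quotient is at most |h|^(p - 1) in absolute value from both
  sides, since \<open>powr\<close> is even in its base. This case matters because the squared
  distance vanishes at the centre of the kernel.\<close>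

lemma powr_DERIV_nonneg:
  fixes r p :: real
  assumes "1 < p" "0 \<le> r"
  shows "((\<lambda>r. r powr p) has_real_derivative p * r powr (p - 1)) (at r)"
proof (cases "r = 0")
  case False
  thus ?thesis using assms by (auto intro!: derivative_eq_intros)
next
  case True
  have "((\<lambda>h. \<bar>h\<bar> powr (p - 1)) \<longlongrightarrow> \<bar>0\<bar> powr (p - 1)) (at (0::real))"
    using assms by (intro tendsto_powr' tendsto_intros) auto
  hence lim: "((\<lambda>h. \<bar>h\<bar> powr (p - 1)) \<longlongrightarrow> 0) (at (0::real))" by simp
  have bound: "norm (h powr p / h) \<le> \<bar>h\<bar> powr (p - 1)" for h :: real
  proof (cases "h = 0")
    case False
    have "h powr p = \<bar>h\<bar> powr p" by (cases "0 \<le> h") (auto simp: uminus_powr_eq)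
    hence "norm (h powr p / h) = \<bar>h\<bar> powr p / \<bar>h\<bar> powr 1" by simp
    also have "\<dots> = \<bar>h\<bar> powr (p - 1)" by (simp add: powr_diff)
    finally show ?thesis by simp
  qed simp
  have "((\<lambda>h. h powr p / h) \<longlongrightarrow> 0) (at (0::real))"
    by (rule Lim_null_comparison[OF always_eventually[OF allI[OF bound]] lim])
  thus ?thesis using True assms by (simp add: has_field_derivative_iff)
qed

context hj_exponent
begin

text \<open>The kernel run with a clock \<theta> satisfies z_t + |grad z|^q = E (1 - \<theta>'),
  where E = |grad z|^q: a solution for \<theta>' = 1 and a supersolution for \<theta>' <= 1.\<close>

lemma kernel_C1_gradient:
  fixes a :: "'a::euclidean_space"
  assumes \<theta>: "\<And>t. 0 < t \<Longrightarrow> 0 < \<theta> t" "\<And>t. 0 < t \<Longrightarrow> (\<theta> has_real_derivative \<theta>' t) (at t)"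
    "continuous_on {0<..} \<theta>'"
  shows "\<exists>G D E. C1_gradient (\<lambda>p. kernel (fst p - a) (\<theta> (snd p))) G D \<and>
    (\<forall>p\<in>space_time. 0 \<le> E p \<and> norm (G p) powr q = E p \<and> D p = - E p * \<theta>' (snd p))"
proof -
  define N where "N p = (norm (fst p - a))\<^sup>2" for p :: "'a \<times> real"
  have "C1_gradient (\<lambda>p. N p powr (\<beta> / 2))
      (\<lambda>p. (\<beta> / 2 * N p powr (\<beta> / 2 - 1)) *\<^sub>R (2 *\<^sub>R (fst p - a)))
      (\<lambda>p. \<beta> / 2 * N p powr (\<beta> / 2 - 1) * 0)"
    unfolding N_def using beta_gt_2
    by (intro C1_gradient_compose[OF C1_gradient_norm2, where f = "\<lambda>r. r powr (\<beta> / 2)"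
          and f' = "\<lambda>r. \<beta> / 2 * r powr (\<beta> / 2 - 1)"]
        powr_DERIV_nonneg continuous_intros continuous_on_powr') auto
  moreover have "C1_gradient (\<lambda>p :: 'a \<times> real. \<theta> (snd p) powr - \<alpha>) (\<lambda>p. 0)
      (\<lambda>p. - \<alpha> * \<theta> (snd p) powr (- \<alpha> - 1) * \<theta>' (snd p))"
  proof (rule C1_gradient_time)
    show "((\<lambda>t. \<theta> t powr - \<alpha>) has_real_derivative - \<alpha> * \<theta> t powr (- \<alpha> - 1) * \<theta>' t) (at t)" if "0 < t" for t
      using \<theta>(1,2)[of t] that by (auto intro!: derivative_eq_intros)
    have "continuous_on {0<..} \<theta>"
      by (rule DERIV_continuous_on[OF has_field_derivative_at_within[OF \<theta>(2)]]) simp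
    thus "continuous_on {0<..} (\<lambda>t. - \<alpha> * \<theta> t powr (- \<alpha> - 1) * \<theta>' t)"
      using \<theta>(1,3) by (intro continuous_intros) force+
  qed
  ultimately have C1: "C1_gradient (\<lambda>p. \<kappa> * (N p powr (\<beta> / 2) * \<theta> (snd p) powr - \<alpha>))
      (\<lambda>p. \<kappa> *\<^sub>R (N p powr (\<beta> / 2) *\<^sub>R 0 + \<theta> (snd p) powr - \<alpha> *\<^sub>R ((\<beta> / 2 * N p powr (\<beta> / 2 - 1)) *\<^sub>R (2 *\<^sub>R (fst p - a)))))
      (\<lambda>p. \<kappa> * (N p powr (\<beta> / 2) * (- \<alpha> * \<theta> (snd p) powr (- \<alpha> - 1) * \<theta>' (snd p))
         + \<theta> (snd p) powr - \<alpha> * (\<beta> / 2 * N p powr (\<beta> / 2 - 1) * 0)))"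
    (is "C1_gradient _ ?G ?D")
    by (intro C1_gradient_cmult C1_gradient_mult)
  have N: "N p powr (\<beta> / 2) = norm (fst p - a) powr \<beta>" for p
    using powr_powr[of "norm (fst p - a)" 2 "\<beta> / 2"] by (simp add: N_def)
  have kern: "\<kappa> * (N p powr (\<beta> / 2) * \<theta> (snd p) powr - \<alpha>) = kernel (fst p - a) (\<theta> (snd p))" for p
    unfolding N by (simp add: kernel_def)
  define E where "E p = \<alpha> * \<kappa> * norm (fst p - a) powr \<beta> * \<theta> (snd p) powr (- \<alpha> - 1)" for p
  have "0 \<le> E p" for p using alpha_gt_1 kappa_pos by (simp add: E_def)
  moreover have "norm (?G p) powr q = E p" if "p \<in> space_time" for p
  proof -
    have "N p powr (\<beta> / 2 - 1) * norm (fst p - a) = norm (fst p - a) powr (\<beta> - 1)"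
    proof -
      have "N p powr (\<beta> / 2 - 1) = norm (fst p - a) powr (\<beta> - 2)"
        using powr_powr[of "norm (fst p - a)" 2 "\<beta> / 2 - 1"] by (simp add: N_def right_diff_distrib)
      thus ?thesis using powr_mult_base[of "norm (fst p - a)" "\<beta> - 2"] by (simp add: mult.commute)
    qed
    moreover have "norm (?G p) = \<kappa> * \<beta> * (N p powr (\<beta> / 2 - 1) * norm (fst p - a)) * \<theta> (snd p) powr - \<alpha>"
      using kappa_pos beta_gt_2 by (simp add: abs_mult)
    ultimately have "norm (?G p) powr q
        = (\<kappa> * \<beta> * norm (fst p - a) powr (\<beta> - 1) * \<theta> (snd p) powr - \<alpha>) powr q" by simp
    also have "\<dots> = (\<kappa> * \<beta>) powr q * (norm (fst p - a) powr (\<beta> - 1)) powr q * (\<theta> (snd p) powr - \<alpha>) powr q"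
      by (simp only: powr_mult)
    also have "\<dots> = \<alpha> * \<kappa> * norm (fst p - a) powr ((\<beta> - 1) * q) * \<theta> (snd p) powr (- \<alpha> * q)"
      by (simp only: powr_powr kappa_beta_powr)
    also have "(\<beta> - 1) * q = \<beta>" using alpha_q beta_eq by simp
    also have "- \<alpha> * q = - \<alpha> - 1" using alpha_q beta_eq by simp
    finally show ?thesis by (simp add: E_def)
  qed
  moreover have "?D p = - E p * \<theta>' (snd p)" for p
    by (simp add: E_def N)
  ultimately show ?thesis using C1 unfolding kern by blast
qed

text \<open>The test function \<open>z(y,s) + k + kernel (x - y) \<theta>(t) + k (t - s)\<close> needs \<open>\<theta>\<close> positive and smooth for
  all \<open>t\<close>, above \<open>t - s\<close>, and with \<open>\<theta>' \<le> 1\<close>; the positive root of \<open>\<theta>\<^sup>2 - (t - s) \<theta> = d\<^sup>2\<close> is such a function.\<close>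

lemma subsolution_dpp:
  fixes z :: "'a::euclidean_space \<times> real \<Rightarrow> real"
  assumes sub: "viscosity_subsolution (\<lambda>p. norm p powr q) z"
    and cont: "continuous_on space_time z"
    and K: "\<And>p. p \<in> space_time \<Longrightarrow> \<bar>z p\<bar> \<le> K"
    and st: "0 < s" "s < t"
  shows "z (x, t) \<le> z (y, s) + kernel (x - y) (t - s)"
proof -
  have K0: "0 \<le> K" using K[of "(y, s)"] st by force
  \<comment> \<open>The margin k makes the test function a strict supersolution and covers the
    variation of z near y at time s; it tends to 0 at the end.\<close>
  have main: "z (x, t) \<le> z (y, s) + kernel (x - y) (t - s) + k * (1 + (t - s))" if k: "0 < k" for k
  proof -
    have "continuous_on UNIV (\<lambda>w. z (w, s))"
      using continuous_on_compose2[OF cont, of UNIV "\<lambda>w. (w, s)"] st by (force intro: continuous_intros)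
    hence "isCont (\<lambda>w. z (w, s)) y" by (simp add: continuous_on_eq_continuous_at)
    then obtain \<rho> where \<rho>: "\<rho> > 0" "\<And>w. dist w y < \<rho> \<Longrightarrow> dist (z (w, s)) (z (y, s)) < k"
      using k unfolding continuous_at_eps_delta by meson
    define c where "c = \<kappa> * \<rho> powr \<beta>"
    have c: "0 < c" using \<rho>(1) kappa_pos by (simp add: c_def)
    \<comment> \<open>So small that at age d the kernel is at least 2 K outside the \<rho>-ball
      around y; the summand 1 keeps the denominator positive.\<close>
    define d where "d = (c / (2 * K + 1)) powr (1 / \<alpha>)"
    have d: "0 < d" using c K0 by (simp add: d_def)
    have near: "2 * K \<le> kernel (w - y) d" if "\<rho> \<le> norm (w - y)" for w
    proof -
      have "d powr \<alpha> = c / (2 * K + 1)"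
        using alpha_gt_1 c K0 by (simp add: d_def powr_powr)
      hence "2 * K + 1 = c * d powr - \<alpha>" using c K0 by (simp add: powr_minus_divide)
      also have "\<dots> \<le> kernel (w - y) d"
        unfolding c_def kernel_def using that \<rho>(1) kappa_pos beta_gt_2
        by (intro mult_right_mono mult_left_mono powr_mono2) auto
      finally show ?thesis by simp
    qed
    define R where "R r = sqrt (((r - s) / 2)\<^sup>2 + d\<^sup>2)" for r
    define \<theta> where "\<theta> r = (r - s) / 2 + R r" for r
    define \<theta>' where "\<theta>' r = 1 / 2 + (r - s) / (4 * R r)" for r
    have R_gt: "(r - s) / 2 < R r" "- ((r - s) / 2) < R r" for r
    proof -
      have "sqrt (((r - s) / 2)\<^sup>2) < R r"
        unfolding R_def using d by (intro real_sqrt_less_mono) simp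
      thus "(r - s) / 2 < R r" "- ((r - s) / 2) < R r"
        by (simp_all only: real_sqrt_abs abs_less_iff)
    qed
    have R_pos: "0 < R r" for r using R_gt(1)[of r] R_gt(2)[of r] by linarith
    have \<theta>_pos: "0 < \<theta> r" for r using R_gt(1)[of r] R_gt(2)[of r] unfolding \<theta>_def by linarith
    have \<theta>_ge: "r - s \<le> \<theta> r" for r
      using R_gt(1)[of r] unfolding \<theta>_def by (simp add: field_simps)
    have \<theta>_le: "\<theta> r \<le> r - s + d" if "s \<le> r" for r
    proof -
      have "R r \<le> (r - s) / 2 + d" unfolding R_def
        using that d by (intro real_le_lsqrt) (auto simp: power2_eq_square algebra_simps)
      thus ?thesis unfolding \<theta>_def by (simp add: field_simps)
    qed
    have \<theta>s: "\<theta> s = d" using d by (simp add: \<theta>_def R_def)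
    have \<theta>'_le: "\<theta>' r \<le> 1" for r
    proof -
      have "(r - s) / (4 * R r) \<le> 1 / 2"
        using R_gt(1)[of r] R_pos[of r] by (simp add: field_simps)
      hence "1 / 2 + (r - s) / (4 * R r) \<le> 1 / 2 + 1 / 2" by (rule add_left_mono)
      thus ?thesis unfolding \<theta>'_def by (simp only: field_sum_of_halves)
    qed
    have R_DERIV: "(R has_real_derivative (r - s) / (4 * R r)) (at r)" for r
    proof -
      have pos: "0 < ((r - s) / 2)\<^sup>2 + d\<^sup>2" using d by (simp add: add_nonneg_pos)
      have "((\<lambda>r. ((r - s) / 2)\<^sup>2 + d\<^sup>2) has_real_derivative (r - s) / 2) (at r)"
        by (auto intro!: derivative_eq_intros)
      from DERIV_chain2[OF DERIV_real_sqrt[OF pos] this]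
      have "(R has_real_derivative inverse (R r) / 2 * ((r - s) / 2)) (at r)"
        unfolding R_def .
      moreover have "inverse (R r) / 2 * ((r - s) / 2) = (r - s) / (4 * R r)"
        using R_pos[of r] by (simp add: field_simps)
      ultimately show ?thesis by (simp only:)
    qed
    have \<theta>_DERIV: "(\<theta> has_real_derivative \<theta>' r) (at r)" for r
      unfolding \<theta>_def[abs_def] \<theta>'_def
      by (rule DERIV_add[OF _ R_DERIV]) (auto intro!: derivative_eq_intros)
    have R_cont: "continuous_on {0<..} R"
      unfolding R_def by (intro continuous_intros) simp
    have \<theta>'_cont: "continuous_on {0<..} \<theta>'"
      unfolding \<theta>'_def using R_pos by (intro continuous_intros R_cont) (auto dest: less_imp_neq[OF R_pos, THEN not_sym, THEN notE])
    obtain G D E where "C1_gradient (\<lambda>p. kernel (fst p - y) (\<theta> (snd p))) G D \<and>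
        (\<forall>p\<in>space_time. 0 \<le> E p \<and> norm (G p) powr q = E p \<and> D p = - E p * \<theta>' (snd p))"
      using kernel_C1_gradient[of \<theta> \<theta>' y, OF \<theta>_pos \<theta>_DERIV \<theta>'_cont] by (elim exE) (rule that)
    hence GDE: "C1_gradient (\<lambda>p. kernel (fst p - y) (\<theta> (snd p))) G D"
      "\<And>p. p \<in> space_time \<Longrightarrow> 0 \<le> E p \<and> norm (G p) powr q = E p \<and> D p = - E p * \<theta>' (snd p)"
      by (rule conjunct1, blast dest: conjunct2)
    define \<phi> where "\<phi> p = kernel (fst p - y) (\<theta> (snd p)) + (z (y, s) + k + k * (snd p - s))" for p :: "'a \<times> real"
    have "C1_gradient (\<lambda>p :: 'a \<times> real. z (y, s) + k + k * (snd p - s)) (\<lambda>p. 0) (\<lambda>p. k)"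
      by (rule C1_gradient_time[of "\<lambda>t. z (y, s) + k + k * (t - s)" "\<lambda>t. k"])
        (auto intro!: derivative_eq_intros)
    from C1_gradient_add[OF GDE(1) this]
    have \<phi>: "C1_gradient \<phi> (\<lambda>p. G p + 0) (\<lambda>p. D p + k)" unfolding \<phi>_def .
    have "z (x, t) \<le> \<phi> (x, t)"
    proof (rule ccontr)
      assume neg: "\<not> z (x, t) \<le> \<phi> (x, t)"
      \<comment> \<open>A subsolution is tested at a maximum over a full neighbourhood in time, so
        the region cannot end at time t. It extends to T, from where on the term k (r - s) alone
        outweighs the oscillation 2 K of z.\<close>
      define T where "T = s + 2 * K / k"
      have T: "s \<le> T" using k K0 by (simp add: T_def)
      obtain R1 where R1: "\<And>r (w::'a). 0 < r \<Longrightarrow> r \<le> T - s + d \<Longrightarrow> R1 \<le> norm w \<Longrightarrow> 2 * K \<le> kernel w r"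
        using kernel_coercive[of "T - s + d" "2 * K", where 'a = 'a] T d by force
      have low: "z (w, r) \<le> \<phi> (w, r)" if sr: "s \<le> r" and cases: "T \<le> r \<or> R1 \<le> norm (w - y) \<or> r = s" for w r
      proof -
        have zK: "z (w, r) \<le> K" "- K \<le> z (y, s)" using K[of "(w, r)"] K[of "(y, s)"] sr st by auto
        have kr: "0 \<le> k * (r - s)" using k sr by simp
        consider "T \<le> r" | "r \<le> T" "R1 \<le> norm (w - y)" | "r = s" using cases by linarith
        thus ?thesis
        proof cases
          case 1
          hence "k * (T - s) \<le> k * (r - s)" using k by (intro mult_left_mono) auto
          moreover have "k * (T - s) = 2 * K" using k by (simp add: T_def)
          ultimately show ?thesis using zK k kernel_nonneg[of "w - y" "\<theta> r"] by (simp add: \<phi>_def)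
        next
          case 2
          have "2 * K \<le> kernel (w - y) (\<theta> r)"
            using \<theta>_le[OF sr] 2 by (intro R1 \<theta>_pos) auto
          thus ?thesis using zK k kr by (simp add: \<phi>_def)
        next
          case 3
          show ?thesis
          proof (cases "\<rho> \<le> norm (w - y)")
            case True
            thus ?thesis using near[OF True] zK k by (simp add: \<phi>_def 3 \<theta>s)
          next
            case False
            hence "z (w, s) < z (y, s) + k" using \<rho>(2)[of w] by (simp add: dist_norm abs_if split: if_splits)
            thus ?thesis using kernel_nonneg[of "w - y" d] by (simp add: \<phi>_def 3 \<theta>s)
          qed
        qed
      qed
      define S where "S = cball y \<bar>R1\<bar> \<times> {s..T}"
      define f where "f p = z p - \<phi> p" for p
      have xt: "(x, t) \<in> S"
      proof (rule ccontr)
        assume "(x, t) \<notin> S"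
        hence "T \<le> t \<or> R1 \<le> norm (x - y) \<or> t = s"
          using st by (auto simp: S_def dist_norm norm_minus_commute)
        thus False using low[of t x] st neg by simp
      qed
      have "compact S" unfolding S_def by (intro compact_Times) auto
      moreover have "continuous_on S f"
        unfolding f_def using st
        by (intro continuous_on_diff continuous_on_subset[OF cont] continuous_on_subset[OF C1_gradient_D(4)[OF \<phi>]])
          (auto simp: S_def)
      ultimately obtain p where p: "p \<in> S" "\<And>w. w \<in> S \<Longrightarrow> f w \<le> f p"
        using continuous_attains_sup[of S f] xt by blast
      obtain w r where wr: "p = (w, r)" by (cases p)
      have pos: "0 < f (w, r)" using p(2)[OF xt] neg wr by (simp add: f_def)
      have r: "s < r"
        using low[of r w] pos p(1) wr by (auto simp: f_def S_def order_less_le)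
      have "\<forall>\<^sub>F p' in nhds (w, r). s < snd p'"
        using order_tendstoD(1)[OF tendsto_snd[OF filterlim_ident], of s "(w, r)"] r by simp
      hence "\<forall>\<^sub>F p' in nhds (w, r). z p' - \<phi> p' \<le> z (w, r) - \<phi> (w, r)"
      proof eventually_elim
        case (elim p')
        obtain w' r' where wr': "p' = (w', r')" by (cases p')
        show ?case
        proof (cases "p' \<in> S")
          case True
          thus ?thesis using p(2)[OF True] wr by (simp add: f_def)
        next
          case False
          hence "T \<le> r' \<or> R1 \<le> norm (w' - y) \<or> r' = s"
            using elim wr' by (auto simp: S_def dist_norm norm_minus_commute)
          thus ?thesis using low[of r' w'] elim wr' pos by (simp add: f_def)
        qed
      qed
      hence "dt \<phi> (w, r) + norm (grad (at_time \<phi> r) w) powr q \<le> 0"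
        using sub C1_gradient_D(1)[OF \<phi>] r st unfolding viscosity_subsolution_def by simp
      hence "D (w, r) + k + norm (G (w, r)) powr q \<le> 0"
        using C1_gradient_D(2,3)[OF \<phi>, of r w] r st by simp
      moreover have "0 \<le> E (w, r)" "norm (G (w, r)) powr q = E (w, r)" "D (w, r) = - E (w, r) * \<theta>' r"
        using GDE(2)[of "(w, r)"] r st by auto
      \<comment> \<open>The clock runs at most at unit speed, so D + |G|^q = E (1 - \<theta>') >= 0,
        and the viscosity inequality would give k <= 0.\<close>
      moreover have "E (w, r) * \<theta>' r \<le> E (w, r) * 1"
        using calculation \<theta>'_le by (intro mult_left_mono) auto
      ultimately show False using k by simp
    qed
    moreover have "kernel (x - y) (\<theta> t) \<le> kernel (x - y) (t - s)"
      using st by (intro kernel_antimono \<theta>_ge) auto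
    ultimately show ?thesis by (simp add: \<phi>_def algebra_simps)
  qed
  show ?thesis
  proof (rule field_le_epsilon)
    fix e :: real assume "0 < e"
    thus "z (x, t) \<le> z (y, s) + kernel (x - y) (t - s) + e"
      using main[of "e / (1 + (t - s))"] st by simp
  qed
qed

section \<open>Strict test functions below a supersolution\<close>

lemma continuous_on_softmin:
  assumes "0 < k" "continuous_on S f"
  shows "continuous_on S (\<lambda>x. softmin k A (f x))"
proof -
  have "continuous_on UNIV (softmin k A)"
    by (rule DERIV_continuous_on[OF has_field_derivative_at_within[OF softmin_DERIV(1)[OF assms(1)]]])
  from continuous_on_compose2[OF this assms(2)] show ?thesis by simp
qed

lemma continuous_on_softmin': "0 < k \<Longrightarrow> continuous_on S (softmin' k A)"
  by (rule DERIV_continuous_on[OF has_field_derivative_at_within[OF softmin_DERIV(2)]])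

text \<open>The convex combination of \<open>comparison\<close>, now for the first-order equation:
  with no Laplacian to pay for, the rate 2 covers |g|^q <= 1 and a gap of 1. The age d gives
  continuity up to t = 0, and a positive weight e makes the function tend to -infinity far
  away.\<close>

definition test_barrier :: "real \<Rightarrow> real \<Rightarrow> real \<Rightarrow> real \<Rightarrow> real \<Rightarrow> 'a::euclidean_space \<times> real \<Rightarrow> real" where
  "test_barrier e k A B d = (\<lambda>p. (1 - e) * softmin k A (kernel (fst p) (snd p + d))
     + e * (- sqrt (1 + (norm (fst p))\<^sup>2) + (- 2 * snd p - B)))"

lemma test_barrier_strict:
  assumes e: "0 < e" "e < 1" and k: "0 < k" and d: "0 < d"
  shows "\<exists>G D. C1_gradient (test_barrier e k A B d :: 'a::euclidean_space \<times> real \<Rightarrow> real) G D \<and>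
           (\<forall>p\<in>space_time. D p + norm (G p) powr q < 0)"
proof -
  define S where "S p = kernel (fst p) (snd p + d)" for p :: "'a \<times> real"
  have "\<exists>G D E. C1_gradient (\<lambda>p. kernel (fst p - (0::'a)) (snd p + d)) G D \<and>
    (\<forall>p\<in>space_time. 0 \<le> E p \<and> norm (G p) powr q = E p \<and> D p = - E p * 1)"
    using d by (intro kernel_C1_gradient[of "\<lambda>t. t + d" "\<lambda>t. 1"]) (auto intro!: derivative_eq_intros)
  then obtain G D E where *: "C1_gradient (\<lambda>p. kernel (fst p - (0::'a)) (snd p + d)) G D \<and>
    (\<forall>p\<in>space_time. 0 \<le> E p \<and> norm (G p) powr q = E p \<and> D p = - E p * 1)"
    by (elim exE) (rule that)
  have GDE: "C1_gradient S G D"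
      "\<And>p. p \<in> space_time \<Longrightarrow> 0 \<le> E p \<and> norm (G p) powr q = E p \<and> D p = - E p"
    using conjunct1[OF *] bspec[OF conjunct2[OF *]] by (simp_all add: S_def[abs_def])
  have soft: "C1_gradient (\<lambda>p. softmin k A (S p)) (\<lambda>p. softmin' k A (S p) *\<^sub>R G p) (\<lambda>p. softmin' k A (S p) * D p)"
    by (rule C1_gradient_compose[OF GDE(1) softmin_DERIV(1)[OF k] continuous_on_softmin'[OF k]])
  have root: "C1_gradient (\<lambda>p :: 'a \<times> real. - sqrt (1 + (norm (fst p - 0))\<^sup>2))
     (\<lambda>p. (- 1 / (2 * sqrt (1 + (norm (fst p - 0))\<^sup>2))) *\<^sub>R (2 *\<^sub>R (fst p - 0)))
     (\<lambda>p. - 1 / (2 * sqrt (1 + (norm (fst p - 0))\<^sup>2)) * 0)"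
  proof (rule C1_gradient_compose[OF C1_gradient_norm2, where f = "\<lambda>r. - sqrt (1 + r)"
        and f' = "\<lambda>r. - 1 / (2 * sqrt (1 + r))"])
    fix p :: "'a \<times> real"
    have pos: "0 < 1 + (norm (fst p - 0))\<^sup>2" by (simp add: add_pos_nonneg)
    show "((\<lambda>r. - sqrt (1 + r)) has_real_derivative - 1 / (2 * sqrt (1 + (norm (fst p - 0))\<^sup>2)))
        (at ((norm (fst p - 0))\<^sup>2))"
      using pos by (auto intro!: derivative_eq_intros simp: field_simps)
  next
    have "1 + r \<noteq> 0" if "r \<in> (\<lambda>p. (norm (fst p - 0))\<^sup>2) ` (space_time :: ('a \<times> real) set)" for r :: real
    proof -
      have "0 \<le> r" using that by auto
      thus ?thesis by simp
    qed
    thus "continuous_on ((\<lambda>p. (norm (fst p - 0))\<^sup>2) ` (space_time :: ('a \<times> real) set)) (\<lambda>r. - 1 / (2 * sqrt (1 + r)))"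
      by (intro continuous_intros) auto
  qed
  have time: "C1_gradient (\<lambda>p :: 'a \<times> real. - 2 * snd p - B) (\<lambda>p. 0) (\<lambda>p. - 2)"
    by (rule C1_gradient_time[of "\<lambda>t. - 2 * t - B" "\<lambda>t. - 2"]) (auto intro!: derivative_eq_intros)
  define g where "g p = (- 1 / (2 * sqrt (1 + (norm (fst p - 0))\<^sup>2))) *\<^sub>R (2 *\<^sub>R (fst p - 0)) + 0" for p :: "'a \<times> real"
  have C1: "C1_gradient (test_barrier e k A B d)
     (\<lambda>p. (1 - e) *\<^sub>R (softmin' k A (S p) *\<^sub>R G p) + e *\<^sub>R g p)
     (\<lambda>p. (1 - e) * (softmin' k A (S p) * D p) + e * (- 1 / (2 * sqrt (1 + (norm (fst p - 0))\<^sup>2)) * 0 + (- 2)))"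
    using C1_gradient_add[OF C1_gradient_cmult[OF soft, of "1 - e"]
        C1_gradient_cmult[OF C1_gradient_add[OF root time], of e]]
    unfolding test_barrier_def S_def g_def by simp
  have "(1 - e) * (softmin' k A (S p) * D p) + e * (- 1 / (2 * sqrt (1 + (norm (fst p - 0))\<^sup>2)) * 0 + (- 2))
      + norm ((1 - e) *\<^sub>R (softmin' k A (S p) *\<^sub>R G p) + e *\<^sub>R g p) powr q < 0"
    if p: "p \<in> space_time" for p
  proof -
    define s where "s = softmin' k A (S p)"
    have s: "0 < s" "s < 1" unfolding s_def by (rule softmin'_bounds)+
    have "norm (s *\<^sub>R G p) powr q = s powr q * E p"
      using s GDE(2)[OF p] by (simp add: powr_mult)
    also have "\<dots> \<le> s * E p"
      using s GDE(2)[OF p] powr_mono'[of 1 q s] q_gt_1 by (intro mult_right_mono) auto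
    finally have 1: "norm (s *\<^sub>R G p) powr q \<le> s * E p" .
    have "norm (fst p) \<le> sqrt (1 + (norm (fst p))\<^sup>2)" by (rule real_le_rsqrt) simp
    moreover have "0 < sqrt (1 + (norm (fst p))\<^sup>2)" by (simp add: add_pos_nonneg)
    ultimately have "norm (g p) \<le> 1" by (simp add: g_def)
    hence 2: "norm (g p) powr q \<le> 1"
      using powr_mono2[of q "norm (g p)" 1] q_gt_1 by simp
    have "norm ((1 - e) *\<^sub>R (s *\<^sub>R G p) + e *\<^sub>R g p) powr q
       \<le> (1 - e) * norm (s *\<^sub>R G p) powr q + e * norm (g p) powr q"
      using e q_gt_1 by (intro norm_powr_convex) auto
    also have "\<dots> \<le> (1 - e) * (s * E p) + e * 1"
      using e 1 2 by (intro add_mono mult_left_mono) auto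
    finally show ?thesis using e GDE(2)[OF p] by (simp add: s_def)
  qed
  thus ?thesis using C1 by blast
qed

lemma continuous_on_test_barrier:
  assumes "0 < k" "0 < d"
  shows "continuous_on (UNIV \<times> {0..}) (test_barrier e k A B d)"
  unfolding test_barrier_def using assms
  by (intro continuous_intros continuous_on_softmin) auto

text \<open>Barrier functions that are smooth up to the initial time stay below the solution there because
  the datum is attained by the lower semicontinuous envelope.\<close>

lemma supersolution_ge_test_barrier:
  fixes z :: "'a::euclidean_space \<times> real \<Rightarrow> real"
  assumes super: "viscosity_supersolution (\<lambda>p. norm p powr q) z"
    and cont: "continuous_on space_time z"
    and K: "\<And>p. p \<in> space_time \<Longrightarrow> - K \<le> z p" and K0: "0 \<le> K" and m: "0 < m"
    and datum: "attains_lsc_datum z (Z_datum m)"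
    and e: "0 < e" "e < 1" and k: "0 < k" and d: "0 < d" and p0: "p0 \<in> space_time"
  shows "test_barrier e k m (K + m) d p0 \<le> z p0"
proof (rule ccontr)
  assume neg: "\<not> test_barrier e k m (K + m) d p0 \<le> z p0"
  define w where "w = (test_barrier e k m (K + m) d :: 'a \<times> real \<Rightarrow> real)"
  obtain G D where GD: "C1_gradient w G D" "\<And>p. p \<in> space_time \<Longrightarrow> D p + norm (G p) powr q < 0"
    using test_barrier_strict[OF e k d, of m "K + m", where 'a = 'a] unfolding w_def by blast
  define f where "f p = z p - w p" for p
  define \<eta> where "\<eta> = - f p0"
  have \<eta>: "0 < \<eta>" using neg by (simp add: \<eta>_def f_def w_def)
  \<comment> \<open>Points at least as bad as p0. The weight e bounds this set and attainment of the
    datum keeps it away from t = 0, so f attains its minimum over the open half-space.\<close>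
  define A where "A = {p \<in> space_time. f p \<le> - \<eta>}"
  have p0A: "p0 \<in> A" using p0 by (simp add: A_def \<eta>_def)
  have f_cont: "continuous_on space_time f"
    unfolding f_def by (intro continuous_on_diff cont C1_gradient_D(4)[OF GD(1)])
  have soft_le: "softmin k m g \<le> 0" for g using softmin_le[OF k, of m g] by simp
  have w_le: "w p \<le> e * (- norm (fst p) - 2 * snd p - (K + m))" for p
  proof -
    have "norm (fst p) \<le> sqrt (1 + (norm (fst p))\<^sup>2)" by (rule real_le_rsqrt) simp
    hence "e * (- sqrt (1 + (norm (fst p))\<^sup>2) + (- 2 * snd p - (K + m))) \<le> e * (- norm (fst p) - 2 * snd p - (K + m))"
      using e by (intro mult_left_mono) auto
    moreover have "(1 - e) * softmin k m (kernel (fst p) (snd p + d)) \<le> 0"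
      using e soft_le by (intro mult_nonneg_nonpos) auto
    ultimately show ?thesis unfolding w_def test_barrier_def by linarith
  qed
  have A_bound: "norm (fst p) \<le> K / e \<and> \<bar>snd p\<bar> \<le> K / e" if "p \<in> A" for p
  proof -
    have p: "0 < snd p" "f p \<le> - \<eta>" "p \<in> space_time" using that by (auto simp: A_def)
    have "- K < w p" using p \<eta> K[OF p(3)] by (simp add: f_def)
    hence "e * (norm (fst p) + 2 * snd p + (K + m)) < K" using w_le[of p] by (simp add: algebra_simps)
    moreover have "e * (norm (fst p) + 2 * snd p) \<le> e * (norm (fst p) + 2 * snd p + (K + m))"
      using e K0 m by (intro mult_left_mono) auto
    ultimately have "norm (fst p) + 2 * snd p \<le> K / e" using e by (simp add: field_simps)
    thus ?thesis using p(1) norm_ge_zero[of "fst p"] by linarith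
  qed
  have "bounded A"
  proof (rule bounded_subset)
    show "A \<subseteq> cball 0 (K / e) \<times> cball 0 (K / e)"
      using A_bound by (auto simp: dist_norm)
    show "bounded (cball (0::'a) (K / e) \<times> cball (0::real) (K / e))" by (intro bounded_Times) auto
  qed
  moreover have "closed A"
    unfolding closed_sequential_limits
  proof (intro allI impI)
    fix X :: "nat \<Rightarrow> 'a \<times> real" and l
    assume X: "(\<forall>n. X n \<in> A) \<and> X \<longlonglongrightarrow> l"
    obtain x t where l: "l = (x, t)" by (cases l)
    have in_st: "X n \<in> space_time" "f (X n) \<le> - \<eta>" for n using X by (auto simp: A_def)
    have lim_t: "(\<lambda>n. snd (X n)) \<longlonglongrightarrow> t" using tendsto_snd[of X l] X l by auto
    have "0 \<le> t"
      by (rule tendsto_lowerbound[OF lim_t]) (use in_st(1) in \<open>auto simp: mem_Times_iff intro!: always_eventually less_imp_le\<close>)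
    show "l \<in> A"
    proof (cases "t = 0")
      case False
      hence l_st: "l \<in> space_time" using \<open>0 \<le> t\<close> l by simp
      have "(\<lambda>n. f (X n)) \<longlonglongrightarrow> f l"
        by (rule continuous_on_tendsto_compose[OF f_cont _ l_st]) (use X in_st in auto)
      hence "f l \<le> - \<eta>" by (rule tendsto_upperbound) (use in_st in auto)
      thus ?thesis using l_st by (simp add: A_def)
    next
      case True
      let ?F = "at (x, 0) within (space_time :: ('a \<times> real) set)"
      have "Liminf ?F (\<lambda>p. ereal (z p)) = ereal (Z_datum m x)"
        using datum by (simp add: attains_lsc_datum_def)
      hence "\<forall>\<^sub>F p in ?F. ereal (Z_datum m x - \<eta> / 2) < ereal (z p)"
        using \<eta> by (intro less_LiminfD) simp
      moreover have "\<forall>\<^sub>F p in ?F. w p < Z_datum m x + \<eta> / 2"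
      proof -
        have "continuous_on (UNIV \<times> {0..}) w"
          unfolding w_def by (rule continuous_on_test_barrier[OF k d])
        hence "(w \<longlongrightarrow> w (x, 0)) (at (x, 0) within (UNIV \<times> {0..}))"
          by (auto simp: continuous_on_def)
        hence lim: "(w \<longlongrightarrow> w (x, 0)) ?F" by (rule tendsto_within_subset) auto
        \<comment> \<open>At x = 0 both parts of the combination lie below their share of -m: the
          soft minimum because the kernel vanishes there, the other part because of the offset K +
          m. At other points w <= 0 is enough.\<close>
        have "w (x, 0) \<le> Z_datum m x"
        proof (cases "x = 0")
          case False
          have "- norm x - 2 * 0 - (K + m) \<le> 0" using norm_ge_zero[of x] K0 m by linarith
          hence "e * (- norm x - 2 * 0 - (K + m)) \<le> 0" using e by (intro mult_nonneg_nonpos) auto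
          thus ?thesis using w_le[of "(x, 0)"] False by (simp add: Z_datum_def)
        next
          case True
          have "(1 - e) * softmin k m 0 \<le> (1 - e) * (- m)"
            using e softmin_le[OF k, of m 0] by (intro mult_left_mono) auto
          moreover have "e * (- 1 - (K + m)) \<le> e * (- m)"
            using e K0 by (intro mult_left_mono) auto
          ultimately show ?thesis
            using True by (simp add: w_def test_barrier_def Z_datum_def algebra_simps)
        qed
        thus ?thesis using \<eta> by (intro order_tendstoD(2)[OF lim]) simp
      qed
      ultimately have "\<forall>\<^sub>F p in ?F. - \<eta> < f p"
        by eventually_elim (simp add: f_def)
      moreover have "filterlim X ?F sequentially"
      proof -
        have "X n \<in> space_time \<and> X n \<noteq> (x, 0)" for n using in_st(1)[of n] by auto
        thus ?thesis unfolding filterlim_at using X l True by simp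
      qed
      ultimately have "\<forall>\<^sub>F n in sequentially. - \<eta> < f (X n)"
        by (rule eventually_compose_filterlim)
      thus ?thesis using in_st(2) by (auto simp: eventually_sequentially not_less[symmetric])
    qed
  qed
  ultimately have "compact A" by (simp add: compact_eq_bounded_closed)
  moreover have "continuous_on A f" by (rule continuous_on_subset[OF f_cont]) (auto simp: A_def)
  ultimately obtain p where p: "p \<in> A" "\<And>p'. p' \<in> A \<Longrightarrow> f p \<le> f p'"
    using continuous_attains_inf[of A f] p0A by blast
  obtain x t where xt: "p = (x, t)" by (cases p)
  have t: "0 < t" using p(1) xt by (auto simp: A_def)
  have min: "f p \<le> f p'" if "p' \<in> space_time" for p'
    using p(2)[of p'] p(2)[OF p0A] that p(1) by (cases "p' \<in> A") (auto simp: A_def)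
  have "open (space_time :: ('a \<times> real) set)" by (intro open_Times) auto
  hence "\<forall>\<^sub>F p' in nhds (x, t). p' \<in> space_time"
    using t by (intro eventually_nhds_in_open) auto
  hence "\<forall>\<^sub>F p' in nhds (x, t). z p' - w p' \<ge> z (x, t) - w (x, t)"
    by eventually_elim (use min xt in \<open>auto simp: f_def\<close>)
  hence "0 \<le> dt w (x, t) + norm (grad (at_time w t) x) powr q"
    using super C1_gradient_D(1)[OF GD(1)] t unfolding viscosity_supersolution_def by blast
  thus False using GD(2)[of "(x, t)"] C1_gradient_D(2,3)[OF GD(1) t] t by auto
qed

text \<open>The parameters are removed one at a time: e -> 0 removes the penalty, a large k the gap
  ln 2 / k of the soft minimum, and d -> 0 restores the true age of the kernel.\<close>

lemma supersolution_ge_profile: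
  fixes z :: "'a::euclidean_space \<times> real \<Rightarrow> real"
  assumes super: "viscosity_supersolution (\<lambda>p. norm p powr q) z"
    and cont: "continuous_on space_time z"
    and K: "\<And>p. p \<in> space_time \<Longrightarrow> - K \<le> z p" and K0: "0 \<le> K" and m: "0 < m"
    and datum: "attains_lsc_datum z (Z_datum m)"
    and t: "0 < t"
  shows "Z_profile q m (x, t) \<le> z (x, t)"
proof -
  have soft: "softmin k m (kernel x (t + d)) \<le> z (x, t)" if kd: "0 < k" "0 < d" for k d
  proof -
    have "((\<lambda>e. test_barrier e k m (K + m) d (x, t)) \<longlongrightarrow>
        (1 - 0) * softmin k m (kernel x (t + d)) + 0 * (- sqrt (1 + (norm x)\<^sup>2) + (- 2 * t - (K + m)))) (at_right 0)"
      unfolding test_barrier_def fst_conv snd_conv by (intro tendsto_intros)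
    moreover have "\<forall>\<^sub>F e in at_right 0. test_barrier e k m (K + m) d (x, t) \<le> z (x, t)"
      using eventually_at_right_real[OF zero_less_one]
    proof eventually_elim
      case (elim e)
      thus ?case
        using t kd by (intro supersolution_ge_test_barrier[OF super cont K K0 m datum]) auto
    qed
    ultimately have "(1 - 0) * softmin k m (kernel x (t + d))
        + 0 * (- sqrt (1 + (norm x)\<^sup>2) + (- 2 * t - (K + m))) \<le> z (x, t)"
      by (rule tendsto_upperbound) simp
    thus ?thesis by simp
  qed
  have min: "min 0 (kernel x (t + d) - m) \<le> z (x, t)" if d: "0 < d" for d
  proof (rule field_le_epsilon)
    fix e :: real assume e: "0 < e"
    have k: "0 < ln 2 / e" using e by simp
    have "ln 2 / (ln 2 / e) = e" using e by simp
    thus "min 0 (kernel x (t + d) - m) \<le> z (x, t) + e"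
      using softmin_ge[OF k, of "kernel x (t + d)" m] soft[OF k d] by simp
  qed
  have "((\<lambda>d. min 0 (kernel x (t + d) - m)) \<longlongrightarrow> min 0 (kernel x (t + 0) - m)) (at_right 0)"
  proof -
    have "((\<lambda>d. kernel x (t + d)) \<longlongrightarrow> kernel x (t + 0)) (at_right 0)"
      unfolding kernel_def using t by (intro tendsto_intros) auto
    thus ?thesis by (intro tendsto_intros)
  qed
  moreover have "\<forall>\<^sub>F d in at_right 0. min 0 (kernel x (t + d) - m) \<le> z (x, t)"
    using eventually_at_right_less[of 0] by eventually_elim (rule min)
  ultimately have "min 0 (kernel x (t + 0) - m) \<le> z (x, t)"
    by (rule tendsto_upperbound) simp
  thus ?thesis by (simp add: Z_profile_kernel[OF t])
qed

section \<open>Dynamic programming down to the initial time\<close>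

lemma dpp_le_profile:
  fixes z :: "'a::euclidean_space \<times> real \<Rightarrow> real"
  assumes dpp: "\<And>x t y s. 0 < s \<Longrightarrow> s < t \<Longrightarrow> z (x, t) \<le> z (y, s) + kernel (x - y) (t - s)"
    and m: "0 < m" and datum: "attains_lsc_datum z (Z_datum m)" and t: "0 < t"
  shows "z (x, t) \<le> Z_profile q m (x, t)"
proof -
  have le: "z (x, t) \<le> Z_datum m y + kernel (x - y) t" for y
  proof (rule field_le_epsilon)
    fix e :: real assume e: "0 < e"
    let ?F = "at (y, 0) within (space_time :: ('a \<times> real) set)"
    have lim: "Liminf ?F (\<lambda>p. ereal (z p)) = ereal (Z_datum m y)"
      using datum by (simp add: attains_lsc_datum_def)
    \<comment> \<open>The lower limit of z equals the datum, so z does not stay e/2 above it near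
      (y, 0). Points with almost the value of the datum therefore occur arbitrarily close to (y, 0),
      in particular where the kernel is near its limit.\<close>
    have not_above: "\<not> (\<forall>\<^sub>F p in ?F. Z_datum m y + e / 2 \<le> z p)"
    proof
      assume "\<forall>\<^sub>F p in ?F. Z_datum m y + e / 2 \<le> z p"
      hence "ereal (Z_datum m y + e / 2) \<le> Liminf ?F (\<lambda>p. ereal (z p))"
        by (intro Liminf_bounded) (auto elim: eventually_mono)
      thus False using e by (simp add: lim)
    qed
    have near: "\<forall>\<^sub>F p in ?F. 0 < snd p \<and> snd p < t \<and> kernel (x - fst p) (t - snd p) < kernel (x - y) t + e / 2"
    proof -
      have lims: "((\<lambda>p. fst p) \<longlongrightarrow> y) ?F" "((\<lambda>p. snd p) \<longlongrightarrow> 0) ?F"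
        using tendsto_fst[OF tendsto_ident_at, of "(y, 0)" space_time]
          tendsto_snd[OF tendsto_ident_at, of "(y, 0)" space_time] by simp_all
      have "((\<lambda>p. kernel (x - fst p) (t - snd p)) \<longlongrightarrow> kernel (x - y) (t - 0)) ?F"
        unfolding kernel_def using t beta_gt_2
        by (intro tendsto_intros tendsto_powr' lims) auto
      hence "\<forall>\<^sub>F p in ?F. kernel (x - fst p) (t - snd p) < kernel (x - y) t + e / 2"
        using e by (intro order_tendstoD) auto
      moreover have "\<forall>\<^sub>F p in ?F. snd p < t" by (rule order_tendstoD(2)[OF lims(2) t])
      moreover have "\<forall>\<^sub>F p in ?F. 0 < snd p" by (auto simp: eventually_at intro!: exI[of _ 1])
      ultimately show ?thesis by eventually_elim simp
    qed
    have "\<exists>p. z p < Z_datum m y + e / 2 \<and> 0 < snd p \<and> snd p < t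
        \<and> kernel (x - fst p) (t - snd p) < kernel (x - y) t + e / 2"
    proof (rule ccontr)
      assume "\<not> ?thesis"
      hence "\<forall>\<^sub>F p in ?F. Z_datum m y + e / 2 \<le> z p"
        by (intro eventually_mono[OF near]) force
      thus False using not_above by blast
    qed
    then obtain w s where "z (w, s) < Z_datum m y + e / 2" "0 < s" "s < t"
        "kernel (x - w) (t - s) < kernel (x - y) t + e / 2" by auto
    thus "z (x, t) \<le> Z_datum m y + kernel (x - y) t + e"
      using dpp[of s t x w] by linarith
  qed
  \<comment> \<open>Two choices of y suffice: y = 0 yields the kernel minus m, and y = x yields the
    bound 0.\<close>
  have "z (x, t) \<le> kernel x t - m" using le[of 0] by (simp add: Z_datum_def)
  moreover have "z (x, t) \<le> 0" using le[of x] m by (auto simp: Z_datum_def split: if_splits)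
  ultimately show ?thesis by (simp add: Z_profile_kernel[OF t])
qed

lemma viscosity_solution_unique:
  fixes z :: "'a::euclidean_space \<times> real \<Rightarrow> real"
  assumes BUC: "BUC_space_time z" and sol: "viscosity_solution (\<lambda>p. norm p powr q) z"
    and m: "0 < m" and datum: "attains_lsc_datum z (Z_datum m)" and p: "p \<in> space_time"
  shows "z p = Z_profile q m p"
proof -
  obtain K where K: "\<And>p. p \<in> space_time \<Longrightarrow> \<bar>z p\<bar> \<le> K"
    using BUC unfolding BUC_space_time_def bounded_iff by force
  have K0: "0 \<le> K" using K[OF p] by linarith
  have K': "- K \<le> z p" if "p \<in> space_time" for p using K[OF that] by linarith
  have sol': "continuous_on space_time z" "viscosity_subsolution (\<lambda>p. norm p powr q) z"
    "viscosity_supersolution (\<lambda>p. norm p powr q) z"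
    using sol by (auto simp: viscosity_solution_def)
  obtain x t where xt: "p = (x, t)" "0 < t" using p by (cases p) auto
  have "z (x, t) \<le> Z_profile q m (x, t)"
    by (rule dpp_le_profile[OF subsolution_dpp[OF sol'(2,1) K] m datum xt(2)])
  moreover have "Z_profile q m (x, t) \<le> z (x, t)"
    by (rule supersolution_ge_profile[OF sol'(3,1) K' K0 m datum xt(2)])
  ultimately show ?thesis using xt by simp
qed

end

text \<open>Continuity in x upgrades the essential bound of \<open>the_solution\<close> at each
  positive time to a bound at every point; at t = 0 the function is u0 itself.\<close>

lemma the_solution_bounded:
  assumes sol: "the_solution q u0 u" and C0: "in_C0 u0" and W: "in_W1inf u0"
  shows "\<exists>B. \<forall>x. \<forall>t\<ge>0. \<bar>u (x, t)\<bar> \<le> B"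
proof -
  have cl: "classical_solution q u0 u" using sol by (simp add: the_solution_def)
  have "Linf_norm u0 < \<infinity>" using W by (simp add: in_W1inf_def in_Linf_def)
  then obtain B where B: "Linf_norm u0 \<le> ereal B"
    by (cases "Linf_norm u0") auto
  have "ereal \<bar>u (x, t)\<bar> \<le> ereal B" if t: "0 \<le> t" for x t
  proof -
    have "continuous_on UNIV (\<lambda>x. u (x, t))"
      using cl t continuous_on_compose2[of "UNIV \<times> {0..}" u UNIV "\<lambda>x. (x, t)"]
      by (force simp: classical_solution_def intro: continuous_intros)
    hence "ereal \<bar>u (x, t)\<bar> \<le> Linf_norm (\<lambda>x. u (x, t))" by (rule continuous_le_Linf_norm)
    also have "\<dots> \<le> Linf_norm u0"
    proof (cases "t = 0")
      case True
      hence "(\<lambda>x. u (x, t)) = u0" using cl by (auto simp: classical_solution_def)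
      thus ?thesis by simp
    next
      case False
      thus ?thesis using sol t by (simp add: the_solution_def)
    qed
    finally show ?thesis using B by (rule order.trans)
  qed
  thus ?thesis by auto
qed

theorem theorem2p6:
  fixes q M :: real
    and u0 :: "real ^ 'n \<Rightarrow> real"
    and u :: "(real ^ 'n) \<times> real \<Rightarrow> real"
  assumes "1 < q" and "q < 2"
    and "in_C0 u0" and "\<forall>x. u0 x \<le> 0"
    and "integrable lborel u0" and "in_W1inf u0"
    and "\<exists>x. u0 x \<noteq> 0"
    and "the_solution q u0 u" and "\<forall>x. \<forall>t\<ge>0. u (x, t) \<le> 0"
    and "((\<lambda>t. Linf_norm (\<lambda>x. u (x, t))) \<longlongrightarrow> ereal M) at_top"
    and "M > 0"
  shows "((\<lambda>t. Linf_norm (\<lambda>x. u (x, t) - Z_profile q M (x, t))) \<longlongrightarrow> 0) at_top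
    \<and> bounded (range (Z_datum M :: real ^ 'n \<Rightarrow> real))
    \<and> lower_semicontinuous (Z_datum M :: real ^ 'n \<Rightarrow> real)
    \<and> (let is_sol = (\<lambda>z :: (real ^ 'n) \<times> real \<Rightarrow> real.
            BUC_space_time z \<and>
            viscosity_solution (\<lambda>p. norm p powr q) z \<and>
            attains_lsc_datum z (Z_datum M))
        in is_sol (Z_profile q M) \<and>
           (\<forall>z. is_sol z \<longrightarrow> (\<forall>p\<in>space_time. z p = Z_profile q M p)))"
proof -
  interpret hj_exponent q using assms(1,2) by unfold_locales
  obtain B where B: "\<And>x t. 0 \<le> t \<Longrightarrow> \<bar>u (x, t)\<bar> \<le> B"
    using the_solution_bounded[OF assms(8,3,6)] by blast
  interpret hj_solution q u0 u B
  proof unfold_locales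
    show "classical_solution q u0 u" using assms(8) by (simp add: the_solution_def)
    show "in_C0 u0" by fact
    show "u (x, t) \<le> 0" if "0 \<le> t" for x t using assms(9) that by blast
    show "- B \<le> u (x, t)" if "0 \<le> t" for x t using B[OF that, of x] by linarith
  qed
  show ?thesis
    unfolding Let_def
    using Linf_convergence[OF assms(10,11)] Z_datum_bounded Z_datum_lsc[OF assms(11)]
      Z_profile_BUC[OF assms(11)] Z_profile_viscosity_solution Z_profile_attains_datum[OF assms(11)]
      viscosity_solution_unique[OF _ _ assms(11)]
    by blast
qed

end
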